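(* Let $\mathcal{C}$ be a $2$-Calabi-Yau triangulated category with a functorially finite maximal rigid subcategory $\mathcal{R}$, and let $\mathcal{A}$ be the abelian quotient category of $\mathcal{R}[-1]*\mathcal{R}$ by $\mathcal{R}$. Then: (1) The abelian category $\mathcal{A}$ has enough projective objects. (2) The abelian category $\mathcal{A}$ has enough injective objects. (3) The abelian category $\mathcal{A}$ is Gorenstein of Gorenstein dimension at most one.
   Context: Let $k$ be an algebraically closed field. $\mathcal{C}$ is a $k$-linear triangulated category with shift functor $[1]$, which is Hom-finite and Krull-Remak-Schmidt. Put $\mathrm{Ext}^n(X,Y)=\mathrm{Hom}(X,Y[n])$. $\mathcal{C}$ is called $2$-Calabi-Yau ($2$-CY) if there are bifunctorial isomorphisms $\mathrm{Ext}^1(X,Y)\cong D\,\mathrm{Ext}^1(Y,X)$ for $X,Y\in\mathcal{C}$, where $D=\mathrm{Hom}_k(-,k)$. Subcategories are full and closed under isomorphism. A morphism $f:T\to X$ with $T\in\mathcal{T}$ is a right $\mathcal{T}$-approximation of $X$ if every morphism from an object of $\mathcal{T}$ to $X$ factors through $f$; $\mathcal{T}$ is contravariantly finite if every object of $\mathcal{C}$ has a right $\mathcal{T}$-approximation. Left approximations and covariantly finite subcategories are defined dually; $\mathcal{T}$ is functorially finite if it is both. Let $\mathcal{T}$ be a subcategory closed under direct summands and finite direct sums. $\mathcal{T}$ is rigid if $\mathrm{Ext}^1(T,T')=0$ for all $T,T'\in\mathcal{T}$; it is maximal rigid if it is rigid and, whenever $\mathrm{Ext}^1(\mathcal{T}\cup\mathrm{add}\,M,\mathcal{T}\cup\mathrm{add}\,M)=0$,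 one has $M\in\mathcal{T}$ (here $\mathrm{add}\,M$ is the subcategory of direct summands of finite direct sums of copies of $M$). For subcategories $\mathcal{X},\mathcal{Y}$, the subcategory $\mathcal{X}*\mathcal{Y}$ consists of the objects $E$ admitting a triangle $X\to E\to Y\to X[1]$ with $X\in\mathcal{X}$, $Y\in\mathcal{Y}$. The quotient $\mathcal{A}$ of $\mathcal{R}[-1]*\mathcal{R}$ by $\mathcal{R}$ has the same objects as $\mathcal{R}[-1]*\mathcal{R}$, and its morphisms are the morphisms of $\mathcal{C}$ modulo those factoring through an object of $\mathcal{R}$. It is known that $\mathcal{A}$ is an abelian category, equivalent to the category $\mathrm{mod}\,\mathcal{R}$ of finitely presented $\mathcal{R}$-modules (contravariant functors from $\mathcal{R}$ to $k$-vector spaces). An abelian category with enough projectives and enough injectives is Gorenstein of Gorenstein dimension at most one if every injective object has projective dimension at most $1$ and every projective object has injective dimension at most $1$. *)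

theory Defs
  imports "HOL-Algebra.Algebraic_Closure" "HOL-Algebra.Module"
begin

(* frees X for use as a variable *)
no_notation var (\<open>X\<index>\<close>)

section \<open>Linear categories\<close>

text \<open>
  The morphisms from \<open>X\<close> to \<open>Y\<close> form a \<open>K\<close>-module \<open>Hom C X Y\<close>; of this record only the additive
  structure and the scalar multiplication are used, its fields \<open>mult\<close> and \<open>one\<close> are junk.
  Composition is written in the usual order, \<open>g \<cdot>\<^bsub>C\<^esub> f\<close> being \<open>g\<close> after \<open>f\<close>; it does not
  mention the objects because distinct hom-sets are required to be disjoint.
\<close>

record ('k, 'o, 'm) lin_cat =
  Obj :: "'o set"
  Hom :: "'o \<Rightarrow> 'o \<Rightarrow> ('k, 'm) module"
  Id :: "'o \<Rightarrow> 'm"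
  Comp :: "'m \<Rightarrow> 'm \<Rightarrow> 'm" (infixl "\<cdot>\<index>" 70)

abbreviation arr :: "('k, 'o, 'm, 'c) lin_cat_scheme \<Rightarrow> 'o \<Rightarrow> 'o \<Rightarrow> 'm set"
  where "arr C X Y \<equiv> carrier (Hom C X Y)"

locale linear_category = field K
  for K :: "('k, 'b) ring_scheme" (structure)
  and C :: "('k, 'o, 'm, 'c) lin_cat_scheme" (structure) +
  assumes hom_module: "\<lbrakk>X \<in> Obj C; Y \<in> Obj C\<rbrakk> \<Longrightarrow> module K (Hom C X Y)"
    and hom_disjoint: "\<lbrakk>X \<in> Obj C; Y \<in> Obj C; X' \<in> Obj C; Y' \<in> Obj C;
          f \<in> arr C X Y; f \<in> arr C X' Y'\<rbrakk> \<Longrightarrow> X = X' \<and> Y = Y'"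
    and id_closed: "X \<in> Obj C \<Longrightarrow> Id C X \<in> arr C X X"
    and comp_closed: "\<lbrakk>X \<in> Obj C; Y \<in> Obj C; Z \<in> Obj C; f \<in> arr C X Y; g \<in> arr C Y Z\<rbrakk>
          \<Longrightarrow> g \<cdot>\<^bsub>C\<^esub> f \<in> arr C X Z"
    and comp_id_right: "\<lbrakk>X \<in> Obj C; Y \<in> Obj C; f \<in> arr C X Y\<rbrakk> \<Longrightarrow> f \<cdot>\<^bsub>C\<^esub> Id C X = f"
    and comp_id_left: "\<lbrakk>X \<in> Obj C; Y \<in> Obj C; f \<in> arr C X Y\<rbrakk> \<Longrightarrow> Id C Y \<cdot>\<^bsub>C\<^esub> f = f"
    and comp_assoc: "\<lbrakk>W \<in> Obj C; X \<in> Obj C; Y \<in> Obj C; Z \<in> Obj C;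
          f \<in> arr C W X; g \<in> arr C X Y; h \<in> arr C Y Z\<rbrakk>
          \<Longrightarrow> (h \<cdot>\<^bsub>C\<^esub> g) \<cdot>\<^bsub>C\<^esub> f = h \<cdot>\<^bsub>C\<^esub> (g \<cdot>\<^bsub>C\<^esub> f)"
    and comp_add_right: "\<lbrakk>X \<in> Obj C; Y \<in> Obj C; Z \<in> Obj C;
          f \<in> arr C X Y; f' \<in> arr C X Y; g \<in> arr C Y Z\<rbrakk>
          \<Longrightarrow> g \<cdot>\<^bsub>C\<^esub> (f \<oplus>\<^bsub>Hom C X Y\<^esub> f') = (g \<cdot>\<^bsub>C\<^esub> f) \<oplus>\<^bsub>Hom C X Z\<^esub> (g \<cdot>\<^bsub>C\<^esub> f')"
    and comp_add_left: "\<lbrakk>X \<in> Obj C; Y \<in> Obj C; Z \<in> Obj C;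
          f \<in> arr C X Y; g \<in> arr C Y Z; g' \<in> arr C Y Z\<rbrakk>
          \<Longrightarrow> (g \<oplus>\<^bsub>Hom C Y Z\<^esub> g') \<cdot>\<^bsub>C\<^esub> f = (g \<cdot>\<^bsub>C\<^esub> f) \<oplus>\<^bsub>Hom C X Z\<^esub> (g' \<cdot>\<^bsub>C\<^esub> f)"
    and comp_smult_right: "\<lbrakk>X \<in> Obj C; Y \<in> Obj C; Z \<in> Obj C; a \<in> carrier K;
          f \<in> arr C X Y; g \<in> arr C Y Z\<rbrakk>
          \<Longrightarrow> g \<cdot>\<^bsub>C\<^esub> (a \<odot>\<^bsub>Hom C X Y\<^esub> f) = a \<odot>\<^bsub>Hom C X Z\<^esub> (g \<cdot>\<^bsub>C\<^esub> f)"
    and comp_smult_left: "\<lbrakk>X \<in> Obj C; Y \<in> Obj C; Z \<in> Obj C; a \<in> carrier K;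
          f \<in> arr C X Y; g \<in> arr C Y Z\<rbrakk>
          \<Longrightarrow> (a \<odot>\<^bsub>Hom C Y Z\<^esub> g) \<cdot>\<^bsub>C\<^esub> f = a \<odot>\<^bsub>Hom C X Z\<^esub> (g \<cdot>\<^bsub>C\<^esub> f)"

definition is_iso :: "('k, 'o, 'm, 'c) lin_cat_scheme \<Rightarrow> 'o \<Rightarrow> 'o \<Rightarrow> 'm \<Rightarrow> bool"
  where "is_iso C X Y f \<longleftrightarrow> f \<in> arr C X Y \<and>
    (\<exists>g\<in>arr C Y X. g \<cdot>\<^bsub>C\<^esub> f = Id C X \<and> f \<cdot>\<^bsub>C\<^esub> g = Id C Y)"

definition is_zero_object :: "('k, 'o, 'm, 'c) lin_cat_scheme \<Rightarrow> 'o \<Rightarrow> bool"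
  where "is_zero_object C Z \<longleftrightarrow> Z \<in> Obj C \<and>
    (\<forall>X\<in>Obj C. arr C X Z = {\<zero>\<^bsub>Hom C X Z\<^esub>} \<and> arr C Z X = {\<zero>\<^bsub>Hom C Z X\<^esub>})"

text \<open>\<open>S\<close> is a biproduct of the finite family \<open>Xs\<close>; for the empty family this says that \<open>Id C S\<close>
  vanishes.\<close>

definition is_direct_sum :: "('k, 'o, 'm, 'c) lin_cat_scheme \<Rightarrow> 'o \<Rightarrow> 'o list \<Rightarrow> bool"
  where "is_direct_sum C S Xs \<longleftrightarrow> S \<in> Obj C \<and> set Xs \<subseteq> Obj C \<and>
    (\<exists>i p.
      (\<forall>j<length Xs. i j \<in> arr C (Xs ! j) S \<and> p j \<in> arr C S (Xs ! j)) \<and>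
      (\<forall>j<length Xs. \<forall>l<length Xs.
         p l \<cdot>\<^bsub>C\<^esub> i j = (if l = j then Id C (Xs ! j) else \<zero>\<^bsub>Hom C (Xs ! j) (Xs ! l)\<^esub>)) \<and>
      (\<Oplus>\<^bsub>Hom C S S\<^esub>j\<in>{..<length Xs}. i j \<cdot>\<^bsub>C\<^esub> p j) = Id C S)"

locale additive_category = linear_category +
  assumes zero_object_exists: "\<exists>Z. is_zero_object C Z"
    and direct_sum_exists: "\<lbrakk>X \<in> Obj C; Y \<in> Obj C\<rbrakk> \<Longrightarrow> \<exists>S. is_direct_sum C S [X, Y]"

definition direct_summand :: "('k, 'o, 'm, 'c) lin_cat_scheme \<Rightarrow> 'o \<Rightarrow> 'o \<Rightarrow> bool"
  where "direct_summand C X S \<longleftrightarrow> (\<exists>Y. is_direct_sum C S [X, Y])"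

definition hom_finite :: "('k, 'b) ring_scheme \<Rightarrow> ('k, 'o, 'm, 'c) lin_cat_scheme \<Rightarrow> bool"
  where "hom_finite K C \<longleftrightarrow> (\<forall>X\<in>Obj C. \<forall>Y\<in>Obj C.
    \<exists>B. finite B \<and> B \<subseteq> arr C X Y \<and>
      (\<forall>f\<in>arr C X Y. \<exists>a\<in>B \<rightarrow> carrier K. f = (\<Oplus>\<^bsub>Hom C X Y\<^esub>b\<in>B. a b \<odot>\<^bsub>Hom C X Y\<^esub> b)))"

text \<open>The endomorphism ring is nonzero and its non-units are closed under addition.\<close>

definition local_endomorphism_ring :: "('k, 'o, 'm, 'c) lin_cat_scheme \<Rightarrow> 'o \<Rightarrow> bool"
  where "local_endomorphism_ring C X \<longleftrightarrow> Id C X \<noteq> \<zero>\<^bsub>Hom C X X\<^esub> \<and>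
    (\<forall>f\<in>arr C X X. \<forall>g\<in>arr C X X.
      \<not> is_iso C X X f \<longrightarrow> \<not> is_iso C X X g \<longrightarrow> \<not> is_iso C X X (f \<oplus>\<^bsub>Hom C X X\<^esub> g))"

definition krull_remak_schmidt :: "('k, 'o, 'm, 'c) lin_cat_scheme \<Rightarrow> bool"
  where "krull_remak_schmidt C \<longleftrightarrow> (\<forall>X\<in>Obj C.
    \<exists>Xs. is_direct_sum C X Xs \<and> (\<forall>Y\<in>set Xs. local_endomorphism_ring C Y))"


section \<open>Abelian categories\<close>

definition is_mono :: "('k, 'o, 'm, 'c) lin_cat_scheme \<Rightarrow> 'o \<Rightarrow> 'o \<Rightarrow> 'm \<Rightarrow> bool"
  where "is_mono C X Y f \<longleftrightarrow> f \<in> arr C X Y \<and>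
    (\<forall>W\<in>Obj C. \<forall>u\<in>arr C W X. \<forall>v\<in>arr C W X. f \<cdot>\<^bsub>C\<^esub> u = f \<cdot>\<^bsub>C\<^esub> v \<longrightarrow> u = v)"

definition is_epi :: "('k, 'o, 'm, 'c) lin_cat_scheme \<Rightarrow> 'o \<Rightarrow> 'o \<Rightarrow> 'm \<Rightarrow> bool"
  where "is_epi C X Y f \<longleftrightarrow> f \<in> arr C X Y \<and>
    (\<forall>W\<in>Obj C. \<forall>u\<in>arr C Y W. \<forall>v\<in>arr C Y W. u \<cdot>\<^bsub>C\<^esub> f = v \<cdot>\<^bsub>C\<^esub> f \<longrightarrow> u = v)"

text \<open>\<open>k : X \<rightarrow> Y\<close> is a kernel of \<open>f : Y \<rightarrow> Z\<close>.\<close>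

definition is_kernel ::
    "('k, 'o, 'm, 'c) lin_cat_scheme \<Rightarrow> 'o \<Rightarrow> 'o \<Rightarrow> 'o \<Rightarrow> 'm \<Rightarrow> 'm \<Rightarrow> bool"
  where "is_kernel C X Y Z k f \<longleftrightarrow> k \<in> arr C X Y \<and> f \<in> arr C Y Z \<and>
    f \<cdot>\<^bsub>C\<^esub> k = \<zero>\<^bsub>Hom C X Z\<^esub> \<and>
    (\<forall>W\<in>Obj C. \<forall>h\<in>arr C W Y. f \<cdot>\<^bsub>C\<^esub> h = \<zero>\<^bsub>Hom C W Z\<^esub> \<longrightarrow>
      (\<exists>!u. u \<in> arr C W X \<and> k \<cdot>\<^bsub>C\<^esub> u = h))"

text \<open>\<open>c : Y \<rightarrow> Z\<close> is a cokernel of \<open>f : X \<rightarrow> Y\<close>.\<close>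

definition is_cokernel ::
    "('k, 'o, 'm, 'c) lin_cat_scheme \<Rightarrow> 'o \<Rightarrow> 'o \<Rightarrow> 'o \<Rightarrow> 'm \<Rightarrow> 'm \<Rightarrow> bool"
  where "is_cokernel C X Y Z f c \<longleftrightarrow> f \<in> arr C X Y \<and> c \<in> arr C Y Z \<and>
    c \<cdot>\<^bsub>C\<^esub> f = \<zero>\<^bsub>Hom C X Z\<^esub> \<and>
    (\<forall>W\<in>Obj C. \<forall>h\<in>arr C Y W. h \<cdot>\<^bsub>C\<^esub> f = \<zero>\<^bsub>Hom C X W\<^esub> \<longrightarrow>
      (\<exists>!u. u \<in> arr C Z W \<and> u \<cdot>\<^bsub>C\<^esub> c = h))"

locale abelian_category = additive_category +
  assumes kernel_exists: "\<lbrakk>Y \<in> Obj C; Z \<in> Obj C; f \<in> arr C Y Z\<rbrakk>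
          \<Longrightarrow> \<exists>X\<in>Obj C. \<exists>k. is_kernel C X Y Z k f"
    and cokernel_exists: "\<lbrakk>X \<in> Obj C; Y \<in> Obj C; f \<in> arr C X Y\<rbrakk>
          \<Longrightarrow> \<exists>Z\<in>Obj C. \<exists>c. is_cokernel C X Y Z f c"
    and mono_is_kernel: "\<lbrakk>X \<in> Obj C; Y \<in> Obj C; is_mono C X Y f\<rbrakk>
          \<Longrightarrow> \<exists>Z\<in>Obj C. \<exists>g. is_kernel C X Y Z f g"
    and epi_is_cokernel: "\<lbrakk>Y \<in> Obj C; Z \<in> Obj C; is_epi C Y Z f\<rbrakk>
          \<Longrightarrow> \<exists>X\<in>Obj C. \<exists>g. is_cokernel C X Y Z g f"

definition projective :: "('k, 'o, 'm, 'c) lin_cat_scheme \<Rightarrow> 'o \<Rightarrow> bool"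
  where "projective C P \<longleftrightarrow> P \<in> Obj C \<and>
    (\<forall>X\<in>Obj C. \<forall>Y\<in>Obj C. \<forall>e f. is_epi C X Y e \<longrightarrow> f \<in> arr C P Y \<longrightarrow>
      (\<exists>g\<in>arr C P X. e \<cdot>\<^bsub>C\<^esub> g = f))"

definition injective :: "('k, 'o, 'm, 'c) lin_cat_scheme \<Rightarrow> 'o \<Rightarrow> bool"
  where "injective C I \<longleftrightarrow> I \<in> Obj C \<and>
    (\<forall>X\<in>Obj C. \<forall>Y\<in>Obj C. \<forall>m f. is_mono C X Y m \<longrightarrow> f \<in> arr C X I \<longrightarrow>
      (\<exists>g\<in>arr C Y I. g \<cdot>\<^bsub>C\<^esub> m = f))"

definition enough_projectives :: "('k, 'o, 'm, 'c) lin_cat_scheme \<Rightarrow> bool"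
  where "enough_projectives C \<longleftrightarrow> (\<forall>X\<in>Obj C. \<exists>P e. projective C P \<and> is_epi C P X e)"

definition enough_injectives :: "('k, 'o, 'm, 'c) lin_cat_scheme \<Rightarrow> bool"
  where "enough_injectives C \<longleftrightarrow> (\<forall>X\<in>Obj C. \<exists>I m. injective C I \<and> is_mono C X I m)"

definition short_exact ::
    "('k, 'o, 'm, 'c) lin_cat_scheme \<Rightarrow> 'o \<Rightarrow> 'o \<Rightarrow> 'o \<Rightarrow> 'm \<Rightarrow> 'm \<Rightarrow> bool"
  where "short_exact C X Y Z f g \<longleftrightarrow> X \<in> Obj C \<and> Y \<in> Obj C \<and> Z \<in> Obj C \<and>
    is_kernel C X Y Z f g \<and> is_cokernel C X Y Z f g"

text \<open>There is a projective resolution \<open>0 \<rightarrow> P1 \<rightarrow> P0 \<rightarrow> X \<rightarrow> 0\<close>, respectively an injective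
  coresolution \<open>0 \<rightarrow> X \<rightarrow> I0 \<rightarrow> I1 \<rightarrow> 0\<close>.\<close>

definition proj_dim_le_one :: "('k, 'o, 'm, 'c) lin_cat_scheme \<Rightarrow> 'o \<Rightarrow> bool"
  where "proj_dim_le_one C X \<longleftrightarrow>
    (\<exists>P1 P0 f g. projective C P1 \<and> projective C P0 \<and> short_exact C P1 P0 X f g)"

definition inj_dim_le_one :: "('k, 'o, 'm, 'c) lin_cat_scheme \<Rightarrow> 'o \<Rightarrow> bool"
  where "inj_dim_le_one C X \<longleftrightarrow>
    (\<exists>I0 I1 f g. injective C I0 \<and> injective C I1 \<and> short_exact C X I0 I1 f g)"

definition gorenstein_dim_le_one ::
    "('k, 'b) ring_scheme \<Rightarrow> ('k, 'o, 'm, 'c) lin_cat_scheme \<Rightarrow> bool"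
  where "gorenstein_dim_le_one K C \<longleftrightarrow>
    abelian_category K C \<and> enough_projectives C \<and> enough_injectives C \<and>
    (\<forall>I. injective C I \<longrightarrow> proj_dim_le_one C I) \<and>
    (\<forall>P. projective C P \<longrightarrow> inj_dim_le_one C P)"


section \<open>Triangulated categories\<close>

record ('k, 'o, 'm) tri_cat = "('k, 'o, 'm) lin_cat" +
  Shift :: "'o \<Rightarrow> 'o"
  ShiftM :: "'m \<Rightarrow> 'm"
  Triangles :: "('m \<times> 'm \<times> 'm) set"

text \<open>\<open>X \<rightarrow> Y \<rightarrow> Z \<rightarrow> X[1]\<close> with morphisms \<open>f\<close>, \<open>g\<close>, \<open>h\<close> is a distinguished triangle. Only such
  members of \<open>Triangles C\<close> are ever considered.\<close>

definition triangle ::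
    "('k, 'o, 'm, 'c) tri_cat_scheme \<Rightarrow> 'o \<Rightarrow> 'o \<Rightarrow> 'o \<Rightarrow> 'm \<Rightarrow> 'm \<Rightarrow> 'm \<Rightarrow> bool"
  where "triangle C X Y Z f g h \<longleftrightarrow> X \<in> Obj C \<and> Y \<in> Obj C \<and> Z \<in> Obj C \<and>
    f \<in> arr C X Y \<and> g \<in> arr C Y Z \<and> h \<in> arr C Z (Shift C X) \<and> (f, g, h) \<in> Triangles C"

text \<open>The shift is a \<open>K\<close>-linear autoequivalence: a fully faithful and essentially surjective
  functor. It need not be an automorphism.\<close>

locale triangulated_category = additive_category K C
  for K :: "('k, 'b) ring_scheme" (structure)
  and C :: "('k, 'o, 'm, 'c) tri_cat_scheme" (structure) +
  assumes shift_closed: "X \<in> Obj C \<Longrightarrow> Shift C X \<in> Obj C"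
    and shift_id: "X \<in> Obj C \<Longrightarrow> ShiftM C (Id C X) = Id C (Shift C X)"
    and shift_comp: "\<lbrakk>X \<in> Obj C; Y \<in> Obj C; Z \<in> Obj C; f \<in> arr C X Y; g \<in> arr C Y Z\<rbrakk>
          \<Longrightarrow> ShiftM C (g \<cdot>\<^bsub>C\<^esub> f) = ShiftM C g \<cdot>\<^bsub>C\<^esub> ShiftM C f"
    and shift_add: "\<lbrakk>X \<in> Obj C; Y \<in> Obj C; f \<in> arr C X Y; g \<in> arr C X Y\<rbrakk>
          \<Longrightarrow> ShiftM C (f \<oplus>\<^bsub>Hom C X Y\<^esub> g)
              = ShiftM C f \<oplus>\<^bsub>Hom C (Shift C X) (Shift C Y)\<^esub> ShiftM C g"
    and shift_smult: "\<lbrakk>X \<in> Obj C; Y \<in> Obj C; a \<in> carrier K; f \<in> arr C X Y\<rbrakk>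
          \<Longrightarrow> ShiftM C (a \<odot>\<^bsub>Hom C X Y\<^esub> f)
              = a \<odot>\<^bsub>Hom C (Shift C X) (Shift C Y)\<^esub> ShiftM C f"
    and shift_fully_faithful: "\<lbrakk>X \<in> Obj C; Y \<in> Obj C\<rbrakk>
          \<Longrightarrow> bij_betw (ShiftM C) (arr C X Y) (arr C (Shift C X) (Shift C Y))"
    and shift_ess_surj: "Y \<in> Obj C \<Longrightarrow> \<exists>X\<in>Obj C. \<exists>f. is_iso C (Shift C X) Y f"
    and triangle_iso: "\<lbrakk>triangle C X Y Z f g h; X' \<in> Obj C; Y' \<in> Obj C; Z' \<in> Obj C;
          f' \<in> arr C X' Y'; g' \<in> arr C Y' Z'; h' \<in> arr C Z' (Shift C X');
          is_iso C X X' p; is_iso C Y Y' q; is_iso C Z Z' r;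
          q \<cdot>\<^bsub>C\<^esub> f = f' \<cdot>\<^bsub>C\<^esub> p; r \<cdot>\<^bsub>C\<^esub> g = g' \<cdot>\<^bsub>C\<^esub> q; ShiftM C p \<cdot>\<^bsub>C\<^esub> h = h' \<cdot>\<^bsub>C\<^esub> r\<rbrakk>
          \<Longrightarrow> triangle C X' Y' Z' f' g' h'"
    and triangle_id: "\<lbrakk>X \<in> Obj C; is_zero_object C Z\<rbrakk>
          \<Longrightarrow> triangle C X X Z (Id C X) \<zero>\<^bsub>Hom C X Z\<^esub> \<zero>\<^bsub>Hom C Z (Shift C X)\<^esub>"
    and triangle_exists: "\<lbrakk>X \<in> Obj C; Y \<in> Obj C; f \<in> arr C X Y\<rbrakk>
          \<Longrightarrow> \<exists>Z g h. triangle C X Y Z f g h"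
    and triangle_rotate: "\<lbrakk>X \<in> Obj C; Y \<in> Obj C; Z \<in> Obj C;
          f \<in> arr C X Y; g \<in> arr C Y Z; h \<in> arr C Z (Shift C X)\<rbrakk>
          \<Longrightarrow> triangle C X Y Z f g h \<longleftrightarrow>
              triangle C Y Z (Shift C X) g h (\<ominus>\<^bsub>Hom C (Shift C X) (Shift C Y)\<^esub> ShiftM C f)"
    and triangle_morphism: "\<lbrakk>triangle C X Y Z f g h; triangle C X' Y' Z' f' g' h';
          p \<in> arr C X X'; q \<in> arr C Y Y'; q \<cdot>\<^bsub>C\<^esub> f = f' \<cdot>\<^bsub>C\<^esub> p\<rbrakk>
          \<Longrightarrow> \<exists>r\<in>arr C Z Z'. r \<cdot>\<^bsub>C\<^esub> g = g' \<cdot>\<^bsub>C\<^esub> q \<and> ShiftM C p \<cdot>\<^bsub>C\<^esub> h = h' \<cdot>\<^bsub>C\<^esub> r"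
    and octahedral: "\<lbrakk>triangle C X Y U f f' f''; triangle C Y Z W g g' g'';
          triangle C X Z V (g \<cdot>\<^bsub>C\<^esub> f) h' h''\<rbrakk>
          \<Longrightarrow> \<exists>u v. triangle C U V W u v (ShiftM C f' \<cdot>\<^bsub>C\<^esub> g'') \<and>
                u \<cdot>\<^bsub>C\<^esub> f' = h' \<cdot>\<^bsub>C\<^esub> g \<and> h'' \<cdot>\<^bsub>C\<^esub> u = f'' \<and>
                v \<cdot>\<^bsub>C\<^esub> h' = g' \<and> g'' \<cdot>\<^bsub>C\<^esub> v = ShiftM C f \<cdot>\<^bsub>C\<^esub> h''"

abbreviation Ext1 :: "('k, 'o, 'm, 'c) tri_cat_scheme \<Rightarrow> 'o \<Rightarrow> 'o \<Rightarrow> ('k, 'm) module"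
  where "Ext1 C X Y \<equiv> Hom C X (Shift C Y)"

text \<open>Functionals are normalized to \<open>undefined\<close> outside the carrier, so that equality of functions is
  equality of functionals.\<close>

definition dual_space ::
    "('k, 'b) ring_scheme \<Rightarrow> ('k, 'm, 'c) module_scheme \<Rightarrow> ('k, 'm \<Rightarrow> 'k) module"
  where "dual_space K V = \<lparr>
    carrier = {\<phi> \<in> carrier V \<rightarrow>\<^sub>E carrier K.
      (\<forall>x\<in>carrier V. \<forall>y\<in>carrier V. \<phi> (x \<oplus>\<^bsub>V\<^esub> y) = \<phi> x \<oplus>\<^bsub>K\<^esub> \<phi> y) \<and>
      (\<forall>a\<in>carrier K. \<forall>x\<in>carrier V. \<phi> (a \<odot>\<^bsub>V\<^esub> x) = a \<otimes>\<^bsub>K\<^esub> \<phi> x)},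
    monoid.mult = undefined,
    one = undefined,
    zero = (\<lambda>x\<in>carrier V. \<zero>\<^bsub>K\<^esub>),
    add = (\<lambda>\<phi> \<psi>. \<lambda>x\<in>carrier V. \<phi> x \<oplus>\<^bsub>K\<^esub> \<psi> x),
    smult = (\<lambda>a \<phi>. \<lambda>x\<in>carrier V. a \<otimes>\<^bsub>K\<^esub> \<phi> x)\<rparr>"

definition linear_iso ::
    "('k, 'b) ring_scheme \<Rightarrow> ('k, 'v, 'c) module_scheme \<Rightarrow> ('k, 'w, 'd) module_scheme
      \<Rightarrow> ('v \<Rightarrow> 'w) \<Rightarrow> bool"
  where "linear_iso K V W \<phi> \<longleftrightarrow> bij_betw \<phi> (carrier V) (carrier W) \<and>
    (\<forall>x\<in>carrier V. \<forall>y\<in>carrier V. \<phi> (x \<oplus>\<^bsub>V\<^esub> y) = \<phi> x \<oplus>\<^bsub>W\<^esub> \<phi> y) \<and>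
    (\<forall>a\<in>carrier K. \<forall>x\<in>carrier V. \<phi> (a \<odot>\<^bsub>V\<^esub> x) = a \<odot>\<^bsub>W\<^esub> \<phi> x)"

text \<open>The second conjunct is naturality of \<open>\<phi>\<close> with respect to \<open>a : X' \<rightarrow> X\<close> and \<open>b : Y \<rightarrow> Y'\<close>:
  both sides are elements of the dual of \<open>Ext1 C Y' X'\<close>, evaluated at \<open>g\<close>.\<close>

definition calabi_yau_2 ::
    "('k, 'b) ring_scheme \<Rightarrow> ('k, 'o, 'm, 'c) tri_cat_scheme \<Rightarrow> bool"
  where "calabi_yau_2 K C \<longleftrightarrow> (\<exists>\<phi>.
    (\<forall>X\<in>Obj C. \<forall>Y\<in>Obj C. linear_iso K (Ext1 C X Y) (dual_space K (Ext1 C Y X)) (\<phi> X Y)) \<and>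
    (\<forall>X\<in>Obj C. \<forall>X'\<in>Obj C. \<forall>Y\<in>Obj C. \<forall>Y'\<in>Obj C.
      \<forall>a\<in>arr C X' X. \<forall>b\<in>arr C Y Y'.
      \<forall>f\<in>carrier (Ext1 C X Y). \<forall>g\<in>carrier (Ext1 C Y' X').
        \<phi> X' Y' (ShiftM C b \<cdot>\<^bsub>C\<^esub> f \<cdot>\<^bsub>C\<^esub> a) g = \<phi> X Y f (ShiftM C a \<cdot>\<^bsub>C\<^esub> g \<cdot>\<^bsub>C\<^esub> b)))"


section \<open>Subcategories\<close>

text \<open>A full subcategory is given by its set of objects.\<close>

definition right_approximation ::
    "('k, 'o, 'm, 'c) lin_cat_scheme \<Rightarrow> 'o set \<Rightarrow> 'o \<Rightarrow> 'o \<Rightarrow> 'm \<Rightarrow> bool"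
  where "right_approximation C R X T f \<longleftrightarrow> T \<in> R \<and> f \<in> arr C T X \<and>
    (\<forall>T'\<in>R. \<forall>g\<in>arr C T' X. \<exists>h\<in>arr C T' T. f \<cdot>\<^bsub>C\<^esub> h = g)"

definition left_approximation ::
    "('k, 'o, 'm, 'c) lin_cat_scheme \<Rightarrow> 'o set \<Rightarrow> 'o \<Rightarrow> 'o \<Rightarrow> 'm \<Rightarrow> bool"
  where "left_approximation C R X T f \<longleftrightarrow> T \<in> R \<and> f \<in> arr C X T \<and>
    (\<forall>T'\<in>R. \<forall>g\<in>arr C X T'. \<exists>h\<in>arr C T T'. h \<cdot>\<^bsub>C\<^esub> f = g)"

definition contravariantly_finite :: "('k, 'o, 'm, 'c) lin_cat_scheme \<Rightarrow> 'o set \<Rightarrow> bool"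
  where "contravariantly_finite C R \<longleftrightarrow> (\<forall>X\<in>Obj C. \<exists>T f. right_approximation C R X T f)"

definition covariantly_finite :: "('k, 'o, 'm, 'c) lin_cat_scheme \<Rightarrow> 'o set \<Rightarrow> bool"
  where "covariantly_finite C R \<longleftrightarrow> (\<forall>X\<in>Obj C. \<exists>T f. left_approximation C R X T f)"

definition functorially_finite :: "('k, 'o, 'm, 'c) lin_cat_scheme \<Rightarrow> 'o set \<Rightarrow> bool"
  where "functorially_finite C R \<longleftrightarrow> contravariantly_finite C R \<and> covariantly_finite C R"

definition subcategory :: "('k, 'o, 'm, 'c) lin_cat_scheme \<Rightarrow> 'o set \<Rightarrow> bool"
  where "subcategory C R \<longleftrightarrow> R \<subseteq> Obj C \<and>
    (\<forall>X\<in>R. \<forall>Y\<in>Obj C. \<forall>f. is_iso C X Y f \<longrightarrow> Y \<in> R)"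

definition summand_sum_closed :: "('k, 'o, 'm, 'c) lin_cat_scheme \<Rightarrow> 'o set \<Rightarrow> bool"
  where "summand_sum_closed C R \<longleftrightarrow>
    (\<forall>S\<in>R. \<forall>X. direct_summand C X S \<longrightarrow> X \<in> R) \<and>
    (\<forall>Xs S. set Xs \<subseteq> R \<longrightarrow> is_direct_sum C S Xs \<longrightarrow> S \<in> R)"

definition add_closure :: "('k, 'o, 'm, 'c) lin_cat_scheme \<Rightarrow> 'o \<Rightarrow> 'o set"
  where "add_closure C M =
    {X. \<exists>n S. is_direct_sum C S (replicate n M) \<and> direct_summand C X S}"

definition ext_orthogonal :: "('k, 'o, 'm, 'c) tri_cat_scheme \<Rightarrow> 'o set \<Rightarrow> bool"
  where "ext_orthogonal C R \<longleftrightarrow>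
    (\<forall>X\<in>R. \<forall>Y\<in>R. carrier (Ext1 C X Y) = {\<zero>\<^bsub>Ext1 C X Y\<^esub>})"

definition rigid :: "('k, 'o, 'm, 'c) tri_cat_scheme \<Rightarrow> 'o set \<Rightarrow> bool"
  where "rigid C R \<longleftrightarrow> subcategory C R \<and> summand_sum_closed C R \<and> ext_orthogonal C R"

definition maximal_rigid :: "('k, 'o, 'm, 'c) tri_cat_scheme \<Rightarrow> 'o set \<Rightarrow> bool"
  where "maximal_rigid C R \<longleftrightarrow> rigid C R \<and>
    (\<forall>M\<in>Obj C. ext_orthogonal C (R \<union> add_closure C M) \<longrightarrow> M \<in> R)"

text \<open>\<open>R[-1]\<close>: since \<open>R\<close> is closed under isomorphism, its closure under isomorphism consists of the
  objects whose shift lies in \<open>R\<close>, whatever quasi-inverse of the shift is chosen.\<close>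

definition unshift :: "('k, 'o, 'm, 'c) tri_cat_scheme \<Rightarrow> 'o set \<Rightarrow> 'o set"
  where "unshift C R = {X \<in> Obj C. Shift C X \<in> R}"

definition star :: "('k, 'o, 'm, 'c) tri_cat_scheme \<Rightarrow> 'o set \<Rightarrow> 'o set \<Rightarrow> 'o set"
  where "star C \<X> \<Y> = {E. \<exists>X\<in>\<X>. \<exists>Y\<in>\<Y>. \<exists>f g h. triangle C X E Y f g h}"


section \<open>The quotient of a subcategory by a subcategory\<close>

definition factoring ::
    "('k, 'o, 'm, 'c) lin_cat_scheme \<Rightarrow> 'o set \<Rightarrow> 'o \<Rightarrow> 'o \<Rightarrow> 'm set"
  where "factoring C R X Y = {v \<cdot>\<^bsub>C\<^esub> u | u v T. T \<in> R \<and> u \<in> arr C X T \<and> v \<in> arr C T Y}"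

text \<open>The residue class of a morphism modulo those factoring through an object of \<open>R\<close>. The objects
  \<open>X\<close> and \<open>Y\<close> are the domain and codomain of \<open>f\<close>.\<close>

definition residue :: "('k, 'o, 'm, 'c) lin_cat_scheme \<Rightarrow> 'o set \<Rightarrow> 'm \<Rightarrow> 'm set"
  where "residue C R f = {f'. \<exists>X\<in>Obj C. \<exists>Y\<in>Obj C. f \<in> arr C X Y \<and> f' \<in> arr C X Y \<and>
    f' \<ominus>\<^bsub>Hom C X Y\<^esub> f \<in> factoring C R X Y}"

text \<open>The quotient by \<open>R\<close> of the full subcategory with objects \<open>D\<close>. As in \<^const>\<open>FactRing\<close>, the
  operations on residue classes are given by unions over all representatives.\<close>

definition quotient_category ::
    "('k, 'o, 'm, 'c) lin_cat_scheme \<Rightarrow> 'o set \<Rightarrow> 'o set \<Rightarrow> ('k, 'o, 'm set) lin_cat"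
  where "quotient_category C D R = \<lparr>
    Obj = D,
    Hom = (\<lambda>X Y. \<lparr>
      carrier = residue C R ` arr C X Y,
      monoid.mult = undefined,
      one = undefined,
      zero = residue C R \<zero>\<^bsub>Hom C X Y\<^esub>,
      add = (\<lambda>F G. \<Union>f\<in>F. \<Union>g\<in>G. residue C R (f \<oplus>\<^bsub>Hom C X Y\<^esub> g)),
      smult = (\<lambda>a F. \<Union>f\<in>F. residue C R (a \<odot>\<^bsub>Hom C X Y\<^esub> f))\<rparr>),
    Id = (\<lambda>X. residue C R (Id C X)),
    Comp = (\<lambda>G F. \<Union>g\<in>G. \<Union>f\<in>F. residue C R (g \<cdot>\<^bsub>C\<^esub> f))\<rparr>"

end

theory Submission
  imports Defs
begin

text \<open>
  Write \<open>U\<close> for \<open>R[-1]\<close> and \<open>D\<close> for \<open>R[-1] * R\<close>. The idea is to replace a morphism \<open>f\<close> of \<open>C\<close> by the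
  natural transformation \<open>Hom(U, f)\<close>, without ever forming the category of \<open>R\<close>-modules. Since \<open>R\<close> is
  rigid, \<open>Hom(U, R)\<close> vanishes; and an object of \<open>D\<close> is exactly a cone of a morphism of \<open>U\<close>, that is, it
  comes with a triangle \<open>P \<rightarrow> Q \<rightarrow> X \<rightarrow> P[1]\<close> which \<open>Hom(U, -)\<close> turns into a projective presentation.
  So a morphism that starts in \<open>D\<close> factors through \<open>R\<close> if and only if \<open>Hom(U, -)\<close> kills it
  (\<open>factoring_iff\<close>), and equality, monomorphisms, epimorphisms and exactness in the quotient can be
  tested on morphisms from \<open>U\<close>. Two extension lemmas carry the abelian structure: morphisms lift along
  \<open>U\<close>-monomorphisms and descend along \<open>U\<close>-epimorphisms whenever \<open>Hom(U, -)\<close> allows it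
  (\<open>U_lift\<close>, \<open>U_descend\<close>). Kernels and cokernels are then obtained from approximations and cones
  (\<open>image_object\<close>, \<open>kernel_candidate\<close>, \<open>cokernel_candidate\<close>). The objects of \<open>U\<close> are projective and
  cover everything, by the presentations.

  The Calabi-Yau duality and maximality enter through the injective objects. If \<open>X\<close> is rigid, the cone of
  a left \<open>R\<close>-approximation \<open>X \<rightarrow> T0\<close> has no extensions with itself and with \<open>R\<close>, so it lies in \<open>R\<close> by
  maximality (\<open>rigid_coresolution\<close>). For \<open>X = T[1]\<close> this shows that \<open>R[1]\<close> is contained in \<open>D\<close>. The
  duality between \<open>Hom(X, T[1])\<close> and \<open>Hom(T[-1], X)\<close> turns the projectivity of \<open>R[-1]\<close> into the
  injectivity of \<open>R[1]\<close>, and left \<open>R\<close>-approximations of \<open>X[-1]\<close> into embeddings of \<open>X\<close> into objects of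
  \<open>R[1]\<close>.

  For the Gorenstein property, the presentation \<open>P \<rightarrow> Q \<rightarrow> T[1]\<close> is left exact because
  \<open>Hom(R, R[1]) = 0\<close>, and for \<open>X[1]\<close> in \<open>U\<close> the shift \<open>X[1] \<rightarrow> T0[1] \<rightarrow> T1[1]\<close> of the coresolution of the
  rigid object \<open>X\<close> is an injective coresolution. Arbitrary injective and projective objects are retracts
  of such objects, and dimension at most one passes to retracts in any abelian category
  (\<open>inj_dim_le_one_retract\<close>, \<open>proj_dim_le_one_retract\<close>).
\<close>

section \<open>Calculus of morphisms in a linear category\<close>

context linear_category
begin

abbreviation comp :: "'m \<Rightarrow> 'm \<Rightarrow> 'm" (infixl \<open>\<bullet>\<close> 70)
  where "g \<bullet> f \<equiv> g \<cdot>\<^bsub>C\<^esub> f"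

abbreviation zer :: "'o \<Rightarrow> 'o \<Rightarrow> 'm" where "zer X Y \<equiv> \<zero>\<^bsub>Hom C X Y\<^esub>"

text \<open>Since hom-sets are disjoint, a morphism determines its source and target. The predicate \<open>Mor\<close> and
  the functions \<open>src\<close> and \<open>tgt\<close> turn side conditions into equations without unknown objects, which the
  simplifier can discharge; \<open>maps_iff\<close> translates between the two styles.\<close>

definition maps :: "'m \<Rightarrow> 'o \<Rightarrow> 'o \<Rightarrow> bool" (\<open>\<guillemotleft>_ : _ \<rightarrow> _\<guillemotright>\<close>)
  where "\<guillemotleft>f : X \<rightarrow> Y\<guillemotright> \<longleftrightarrow> X \<in> Obj C \<and> Y \<in> Obj C \<and> f \<in> arr C X Y"

definition Mor :: "'m \<Rightarrow> bool" where "Mor f \<longleftrightarrow> (\<exists>X Y. \<guillemotleft>f : X \<rightarrow> Y\<guillemotright>)"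
definition src :: "'m \<Rightarrow> 'o" where "src f = (THE X. \<exists>Y. \<guillemotleft>f : X \<rightarrow> Y\<guillemotright>)"
definition tgt :: "'m \<Rightarrow> 'o" where "tgt f = (THE Y. \<exists>X. \<guillemotleft>f : X \<rightarrow> Y\<guillemotright>)"

lemma maps_unique: "\<guillemotleft>f : X \<rightarrow> Y\<guillemotright> \<Longrightarrow> \<guillemotleft>f : X' \<rightarrow> Y'\<guillemotright> \<Longrightarrow> X = X' \<and> Y = Y'"
  unfolding maps_def using hom_disjoint by blast

lemma src_tgt: assumes "\<guillemotleft>f : X \<rightarrow> Y\<guillemotright>" shows "src f = X" "tgt f = Y"
  unfolding src_def tgt_def using assms maps_unique by blast+

lemma maps_iff: "\<guillemotleft>f : X \<rightarrow> Y\<guillemotright> \<longleftrightarrow> X \<in> Obj C \<and> Y \<in> Obj C \<and> Mor f \<and> src f = X \<and> tgt f = Y"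
  using src_tgt unfolding Mor_def by (metis maps_def)

lemma arr_iff:
  assumes "X \<in> Obj C" "Y \<in> Obj C" shows "f \<in> arr C X Y \<longleftrightarrow> Mor f \<and> src f = X \<and> tgt f = Y"
  using assms maps_iff maps_def by blast

lemma maps_arr: "\<guillemotleft>f : X \<rightarrow> Y\<guillemotright> \<Longrightarrow> f \<in> arr C X Y"
  by (simp add: maps_def)

lemma maps_objD: assumes "\<guillemotleft>f : X \<rightarrow> Y\<guillemotright>" shows "X \<in> Obj C" "Y \<in> Obj C"
  using assms by (auto simp: maps_def)

lemma Mor_obj [simp]: assumes "Mor f" shows "src f \<in> Obj C" "tgt f \<in> Obj C"
  using assms src_tgt unfolding Mor_def maps_def by metis+

lemma maps_comp: "\<guillemotleft>f : X \<rightarrow> Y\<guillemotright> \<Longrightarrow> \<guillemotleft>g : Y \<rightarrow> Z\<guillemotright> \<Longrightarrow> \<guillemotleft>g \<bullet> f : X \<rightarrow> Z\<guillemotright>"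
  unfolding maps_def using comp_closed by blast

lemma maps_Id: "X \<in> Obj C \<Longrightarrow> \<guillemotleft>Id C X : X \<rightarrow> X\<guillemotright>"
  unfolding maps_def using id_closed by blast

lemma hom_group: "X \<in> Obj C \<Longrightarrow> Y \<in> Obj C \<Longrightarrow> abelian_group (Hom C X Y)"
  using hom_module module.axioms(2) by blast

lemma Mor_comp [simp]:
  assumes "Mor f" "Mor g" "src g = tgt f"
  shows "Mor (g \<bullet> f)" "src (g \<bullet> f) = src f" "tgt (g \<bullet> f) = tgt g"
  using assms maps_comp[of f "src f" "tgt f" g "tgt g"] by (auto simp: maps_iff)

lemma Mor_Id [simp]:
  assumes "X \<in> Obj C" shows "Mor (Id C X)" "src (Id C X) = X" "tgt (Id C X) = X"
  using assms maps_Id[of X] by (auto simp: maps_iff)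

lemma Mor_zero [simp]:
  assumes "X \<in> Obj C" "Y \<in> Obj C"
  shows "Mor (zer X Y)" "src (zer X Y) = X" "tgt (zer X Y) = Y"
proof -
  interpret H: abelian_group "Hom C X Y" using assms hom_group by blast
  have "\<guillemotleft>zer X Y : X \<rightarrow> Y\<guillemotright>" using assms by (auto simp: maps_def)
  then show "Mor (zer X Y)" "src (zer X Y) = X" "tgt (zer X Y) = Y" by (auto simp: maps_iff)
qed

lemma Mor_add [simp]:
  assumes "Mor f" "Mor g" "src f = X" "src g = X" "tgt f = Y" "tgt g = Y"
  shows "Mor (f \<oplus>\<^bsub>Hom C X Y\<^esub> g)" "src (f \<oplus>\<^bsub>Hom C X Y\<^esub> g) = X" "tgt (f \<oplus>\<^bsub>Hom C X Y\<^esub> g) = Y"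
proof -
  have o: "X \<in> Obj C" "Y \<in> Obj C" using assms Mor_obj by blast+
  interpret H: abelian_group "Hom C X Y" using o hom_group by blast
  have "f \<in> arr C X Y" "g \<in> arr C X Y" using assms o by (simp_all add: arr_iff)
  then have "\<guillemotleft>f \<oplus>\<^bsub>Hom C X Y\<^esub> g : X \<rightarrow> Y\<guillemotright>" using assms(4) o by (simp add: maps_def)
  then show "Mor (f \<oplus>\<^bsub>Hom C X Y\<^esub> g)" "src (f \<oplus>\<^bsub>Hom C X Y\<^esub> g) = X" "tgt (f \<oplus>\<^bsub>Hom C X Y\<^esub> g) = Y"
    by (auto simp: maps_iff)
qed

lemma Mor_neg [simp]:
  assumes "Mor f" "src f = X" "tgt f = Y"
  shows "Mor (\<ominus>\<^bsub>Hom C X Y\<^esub> f)" "src (\<ominus>\<^bsub>Hom C X Y\<^esub> f) = X" "tgt (\<ominus>\<^bsub>Hom C X Y\<^esub> f) = Y"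
proof -
  have o: "X \<in> Obj C" "Y \<in> Obj C" using assms Mor_obj by blast+
  interpret H: abelian_group "Hom C X Y" using o hom_group by blast
  have "f \<in> arr C X Y" using assms o by (simp_all add: arr_iff)
  then have "\<guillemotleft>\<ominus>\<^bsub>Hom C X Y\<^esub> f : X \<rightarrow> Y\<guillemotright>" using o by (simp add: maps_def)
  then show "Mor (\<ominus>\<^bsub>Hom C X Y\<^esub> f)" "src (\<ominus>\<^bsub>Hom C X Y\<^esub> f) = X" "tgt (\<ominus>\<^bsub>Hom C X Y\<^esub> f) = Y"
    by (auto simp: maps_iff)
qed

lemma Mor_minus [simp]:
  assumes "Mor f" "Mor g" "src f = X" "src g = X" "tgt f = Y" "tgt g = Y"
  shows "Mor (f \<ominus>\<^bsub>Hom C X Y\<^esub> g)" "src (f \<ominus>\<^bsub>Hom C X Y\<^esub> g) = X" "tgt (f \<ominus>\<^bsub>Hom C X Y\<^esub> g) = Y"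
  unfolding a_minus_def using assms by simp_all

lemma Mor_smult [simp]:
  assumes "Mor f" "src f = X" "tgt f = Y" "a \<in> carrier K"
  shows "Mor (a \<odot>\<^bsub>Hom C X Y\<^esub> f)" "src (a \<odot>\<^bsub>Hom C X Y\<^esub> f) = X" "tgt (a \<odot>\<^bsub>Hom C X Y\<^esub> f) = Y"
proof -
  have o: "X \<in> Obj C" "Y \<in> Obj C" using assms Mor_obj by blast+
  interpret H: module K "Hom C X Y" using o hom_module by blast
  have "f \<in> arr C X Y" using assms o by (simp_all add: arr_iff)
  then have "\<guillemotleft>a \<odot>\<^bsub>Hom C X Y\<^esub> f : X \<rightarrow> Y\<guillemotright>" using assms(4) o by (simp add: maps_def)
  then show "Mor (a \<odot>\<^bsub>Hom C X Y\<^esub> f)" "src (a \<odot>\<^bsub>Hom C X Y\<^esub> f) = X" "tgt (a \<odot>\<^bsub>Hom C X Y\<^esub> f) = Y"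
    by (auto simp: maps_iff)
qed

lemma comp_Id [simp]:
  assumes "Mor f"
  shows "tgt f = Y \<Longrightarrow> Id C Y \<bullet> f = f" "src f = X \<Longrightarrow> f \<bullet> Id C X = f"
  using comp_id_left[of "src f" "tgt f" f] comp_id_right[of "src f" "tgt f" f] assms
  by (auto simp: arr_iff)

lemma assoc [simp]:
  assumes "Mor f" "Mor g" "Mor h" "src g = tgt f" "src h = tgt g"
  shows "(h \<bullet> g) \<bullet> f = h \<bullet> (g \<bullet> f)"
  using assms comp_assoc[of "src f" "tgt f" "tgt g" "tgt h" f g h] by (auto simp: arr_iff)

lemma comp_add [simp]:
  assumes "Mor f" "Mor f'" "src f = X" "src f' = X" "tgt f = Y" "tgt f' = Y"
  shows "Mor g \<Longrightarrow> src g = Y \<Longrightarrow> g \<bullet> (f \<oplus>\<^bsub>Hom C X Y\<^esub> f') = (g \<bullet> f) \<oplus>\<^bsub>Hom C X (tgt g)\<^esub> (g \<bullet> f')"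
    and "Mor h \<Longrightarrow> tgt h = X \<Longrightarrow> (f \<oplus>\<^bsub>Hom C X Y\<^esub> f') \<bullet> h = (f \<bullet> h) \<oplus>\<^bsub>Hom C (src h) Y\<^esub> (f' \<bullet> h)"
  using assms comp_add_right[of X Y "tgt g" f f' g] comp_add_left[of "src h" X Y h f f']
  by (auto simp: arr_iff)

lemma comp_smult [simp]:
  assumes "Mor f" "src f = X" "tgt f = Y" "a \<in> carrier K"
  shows "Mor g \<Longrightarrow> src g = Y \<Longrightarrow> g \<bullet> (a \<odot>\<^bsub>Hom C X Y\<^esub> f) = a \<odot>\<^bsub>Hom C X (tgt g)\<^esub> (g \<bullet> f)"
    and "Mor h \<Longrightarrow> tgt h = X \<Longrightarrow> (a \<odot>\<^bsub>Hom C X Y\<^esub> f) \<bullet> h = a \<odot>\<^bsub>Hom C (src h) Y\<^esub> (f \<bullet> h)"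
  using assms comp_smult_right[of X Y "tgt g" a f g] comp_smult_left[of "src h" X Y a h f]
  by (auto simp: arr_iff)

lemma add_self_zero:
  assumes "Mor f" "src f = X" "tgt f = Y" "f \<oplus>\<^bsub>Hom C X Y\<^esub> f = f"
  shows "f = zer X Y"
proof -
  have o: "X \<in> Obj C" "Y \<in> Obj C" using assms Mor_obj by blast+
  interpret H: abelian_group "Hom C X Y" using o hom_group by blast
  have "f \<in> arr C X Y" using assms o by (simp add: arr_iff)
  then show ?thesis using assms(4) H.add.r_cancel_one' by metis
qed

lemma add_zero [simp]:
  assumes "Mor f" "src f = X" "tgt f = Y"
  shows "zer X Y \<oplus>\<^bsub>Hom C X Y\<^esub> f = f" "f \<oplus>\<^bsub>Hom C X Y\<^esub> zer X Y = f"
proof -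
  have o: "X \<in> Obj C" "Y \<in> Obj C" using assms Mor_obj by blast+
  interpret H: abelian_group "Hom C X Y" using o hom_group by blast
  show "zer X Y \<oplus>\<^bsub>Hom C X Y\<^esub> f = f" "f \<oplus>\<^bsub>Hom C X Y\<^esub> zer X Y = f"
    using assms o by (auto simp: arr_iff)
qed

lemma comp_zero [simp]:
  assumes "Mor g" "X \<in> Obj C"
  shows "src g = Y \<Longrightarrow> g \<bullet> zer X Y = zer X (tgt g)" "tgt g = Y \<Longrightarrow> zer Y X \<bullet> g = zer (src g) X"
proof -
  assume a: "src g = Y"
  then have o: "Y \<in> Obj C" using assms Mor_obj by blast
  show "g \<bullet> zer X Y = zer X (tgt g)"
    using comp_add(1)[of "zer X Y" "zer X Y" X Y g] assms a o
    by (intro add_self_zero) simp_all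
next
  assume a: "tgt g = Y"
  then have o: "Y \<in> Obj C" using assms Mor_obj by blast
  show "zer Y X \<bullet> g = zer (src g) X"
    using comp_add(2)[of "zer Y X" "zer Y X" Y X g] assms a o
    by (intro add_self_zero) simp_all
qed

lemma minus_zero_iff:
  assumes "Mor f" "Mor g" "src f = X" "src g = X" "tgt f = Y" "tgt g = Y"
  shows "f \<ominus>\<^bsub>Hom C X Y\<^esub> g = zer X Y \<longleftrightarrow> f = g"
proof -
  have o: "X \<in> Obj C" "Y \<in> Obj C" using assms Mor_obj by blast+
  interpret H: abelian_group "Hom C X Y" using o hom_group by blast
  have "f \<in> arr C X Y" "g \<in> arr C X Y" using assms o by (simp_all add: arr_iff)
  then show ?thesis by (metis H.minus_eq H.r_neg H.minus_equality H.minus_minus H.a_inv_closed)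
qed

lemma neg_eqI:
  assumes "Mor f" "Mor g" "src f = X" "src g = X" "tgt f = Y" "tgt g = Y"
    and "f \<oplus>\<^bsub>Hom C X Y\<^esub> g = zer X Y"
  shows "f = \<ominus>\<^bsub>Hom C X Y\<^esub> g"
proof -
  have o: "X \<in> Obj C" "Y \<in> Obj C" using assms Mor_obj by blast+
  interpret H: abelian_group "Hom C X Y" using o hom_group by blast
  show ?thesis using H.minus_equality[of f g] assms o by (auto simp: arr_iff)
qed

lemma add_neg [simp]:
  assumes "Mor f" "src f = X" "tgt f = Y"
  shows "f \<oplus>\<^bsub>Hom C X Y\<^esub> (\<ominus>\<^bsub>Hom C X Y\<^esub> f) = zer X Y" "(\<ominus>\<^bsub>Hom C X Y\<^esub> f) \<oplus>\<^bsub>Hom C X Y\<^esub> f = zer X Y"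
proof -
  have o: "X \<in> Obj C" "Y \<in> Obj C" using assms Mor_obj by blast+
  interpret H: abelian_group "Hom C X Y" using o hom_group by blast
  show "f \<oplus>\<^bsub>Hom C X Y\<^esub> (\<ominus>\<^bsub>Hom C X Y\<^esub> f) = zer X Y" "(\<ominus>\<^bsub>Hom C X Y\<^esub> f) \<oplus>\<^bsub>Hom C X Y\<^esub> f = zer X Y"
    using assms o H.r_neg H.l_neg by (auto simp: arr_iff)
qed

lemma neg_neg [simp]:
  assumes "Mor f" "src f = X" "tgt f = Y"
  shows "\<ominus>\<^bsub>Hom C X Y\<^esub> (\<ominus>\<^bsub>Hom C X Y\<^esub> f) = f"
  using assms by (intro neg_eqI[symmetric]) simp_all

lemma neg_eq_zero_iff [simp]:
  assumes "Mor f" "src f = X" "tgt f = Y"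
  shows "\<ominus>\<^bsub>Hom C X Y\<^esub> f = zer X Y \<longleftrightarrow> f = zer X Y"
proof -
  have o: "X \<in> Obj C" "Y \<in> Obj C" using assms Mor_obj by blast+
  interpret H: abelian_group "Hom C X Y" using o hom_group by blast
  have "f \<in> arr C X Y" using assms o by (simp add: arr_iff)
  then show ?thesis by (simp add: H.add.inv_eq_1_iff)
qed

lemma comp_neg [simp]:
  assumes "Mor f" "src f = X" "tgt f = Y"
  shows "Mor g \<Longrightarrow> src g = Y \<Longrightarrow> g \<bullet> (\<ominus>\<^bsub>Hom C X Y\<^esub> f) = \<ominus>\<^bsub>Hom C X (tgt g)\<^esub> (g \<bullet> f)"
    and "Mor h \<Longrightarrow> tgt h = X \<Longrightarrow> (\<ominus>\<^bsub>Hom C X Y\<^esub> f) \<bullet> h = \<ominus>\<^bsub>Hom C (src h) Y\<^esub> (f \<bullet> h)"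
proof -
  have o: "X \<in> Obj C" "Y \<in> Obj C" using assms Mor_obj by blast+
  show "g \<bullet> (\<ominus>\<^bsub>Hom C X Y\<^esub> f) = \<ominus>\<^bsub>Hom C X (tgt g)\<^esub> (g \<bullet> f)" if "Mor g" "src g = Y"
    using that assms o comp_add(1)[of "\<ominus>\<^bsub>Hom C X Y\<^esub> f" f X Y g, symmetric]
    by (intro neg_eqI) (simp_all del: comp_add)
  show "(\<ominus>\<^bsub>Hom C X Y\<^esub> f) \<bullet> h = \<ominus>\<^bsub>Hom C (src h) Y\<^esub> (f \<bullet> h)" if "Mor h" "tgt h = X"
    using that assms o comp_add(2)[of "\<ominus>\<^bsub>Hom C X Y\<^esub> f" f X Y h, symmetric]
    by (intro neg_eqI) (simp_all del: comp_add)
qed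

lemma comp_minus:
  assumes "Mor f" "Mor f'" "src f = X" "src f' = X" "tgt f = Y" "tgt f' = Y"
  shows "Mor g \<Longrightarrow> src g = Y \<Longrightarrow> g \<bullet> (f \<ominus>\<^bsub>Hom C X Y\<^esub> f') = (g \<bullet> f) \<ominus>\<^bsub>Hom C X (tgt g)\<^esub> (g \<bullet> f')"
    and "Mor h \<Longrightarrow> tgt h = X \<Longrightarrow> (f \<ominus>\<^bsub>Hom C X Y\<^esub> f') \<bullet> h = (f \<bullet> h) \<ominus>\<^bsub>Hom C (src h) Y\<^esub> (f' \<bullet> h)"
  unfolding a_minus_def using assms by simp_all

lemma comp_minus_zero_iff:
  assumes "Mor f" "Mor f'" "Mor g" "src f = X" "src f' = X" "tgt f = Y" "tgt f' = Y"
  shows "src g = Y \<Longrightarrow> g \<bullet> (f \<ominus>\<^bsub>Hom C X Y\<^esub> f') = zer X (tgt g) \<longleftrightarrow> g \<bullet> f = g \<bullet> f'"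
    and "tgt g = X \<Longrightarrow> (f \<ominus>\<^bsub>Hom C X Y\<^esub> f') \<bullet> g = zer (src g) Y \<longleftrightarrow> f \<bullet> g = f' \<bullet> g"
  using assms by (simp_all add: comp_minus minus_zero_iff)

lemma neg_zero [simp]:
  assumes "X \<in> Obj C" "Y \<in> Obj C" shows "\<ominus>\<^bsub>Hom C X Y\<^esub> zer X Y = zer X Y"
  using assms by simp

lemma neg_inj:
  assumes "Mor f" "Mor g" "src f = X" "src g = X" "tgt f = Y" "tgt g = Y"
    and "\<ominus>\<^bsub>Hom C X Y\<^esub> f = \<ominus>\<^bsub>Hom C X Y\<^esub> g"
  shows "f = g"
  using neg_neg[of f X Y] neg_neg[of g X Y] assms by metis

lemma add_minus_cancel:
  assumes "Mor f" "Mor g" "src f = X" "src g = X" "tgt f = Y" "tgt g = Y"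
  shows "g \<oplus>\<^bsub>Hom C X Y\<^esub> (f \<ominus>\<^bsub>Hom C X Y\<^esub> g) = f"
proof -
  have o: "X \<in> Obj C" "Y \<in> Obj C" using assms Mor_obj by blast+
  interpret H: abelian_group "Hom C X Y" using o hom_group by blast
  have "f \<in> arr C X Y" "g \<in> arr C X Y" using assms o by (simp_all add: arr_iff)
  then show ?thesis by (simp only: H.minus_eq H.a_lcomm[of g f] H.r_neg H.a_inv_closed H.r_zero)
qed

text \<open>Composites are normalized to the right, which hides a known composite \<open>g \<bullet> f\<close> inside
  \<open>g \<bullet> (f \<bullet> w)\<close>; this exposes it.\<close>

lemma comp_eq_assoc:
  assumes "g \<bullet> f = e" "\<guillemotleft>f : X \<rightarrow> Y\<guillemotright>" "\<guillemotleft>g : Y \<rightarrow> Z\<guillemotright>" "\<guillemotleft>w : W \<rightarrow> X\<guillemotright>"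
  shows "g \<bullet> (f \<bullet> w) = e \<bullet> w"
  using assms assoc[of w f g] by (auto simp: maps_iff)

lemma is_iso_iff:
  assumes "X \<in> Obj C" "Y \<in> Obj C"
  shows "is_iso C X Y f \<longleftrightarrow> \<guillemotleft>f : X \<rightarrow> Y\<guillemotright> \<and>
    (\<exists>g. \<guillemotleft>g : Y \<rightarrow> X\<guillemotright> \<and> g \<bullet> f = Id C X \<and> f \<bullet> g = Id C Y)"
  using assms by (auto simp: is_iso_def maps_def)

lemma exists_iso_inverse:
  assumes "is_iso C X Y e" "X \<in> Obj C" "Y \<in> Obj C"
  obtains d where "\<guillemotleft>e : X \<rightarrow> Y\<guillemotright>" "\<guillemotleft>d : Y \<rightarrow> X\<guillemotright>" "d \<bullet> e = Id C X" "e \<bullet> d = Id C Y"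
    "is_iso C Y X d"
  using assms unfolding is_iso_iff[OF assms(2,3)] is_iso_iff[OF assms(3,2)] by blast

lemma iso_Id: "X \<in> Obj C \<Longrightarrow> is_iso C X X (Id C X)"
  by (auto simp: is_iso_iff maps_iff intro!: exI[of _ "Id C X"])

lemma zero_object_iff:
  assumes "Z \<in> Obj C" shows "is_zero_object C Z \<longleftrightarrow> Id C Z = zer Z Z"
proof
  assume "is_zero_object C Z"
  then show "Id C Z = zer Z Z" using assms id_closed[of Z] unfolding is_zero_object_def by blast
next
  assume z: "Id C Z = zer Z Z"
  have 1: "f = zer X Z" if "\<guillemotleft>f : X \<rightarrow> Z\<guillemotright>" for f X
    using that comp_Id(1)[of f Z] comp_zero(2)[of f Z Z] z by (auto simp: maps_iff)
  have 2: "f = zer Z X" if "\<guillemotleft>f : Z \<rightarrow> X\<guillemotright>" for f X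
    using that comp_Id(2)[of f Z] comp_zero(1)[of f Z Z] z by (auto simp: maps_iff)
  show "is_zero_object C Z"
    unfolding is_zero_object_def
    using assms 1 2 by (auto simp: maps_def[symmetric] arr_iff maps_iff)
qed

lemma zero_object_maps:
  assumes "is_zero_object C Z"
  shows "Z \<in> Obj C" and "\<guillemotleft>f : X \<rightarrow> Z\<guillemotright> \<Longrightarrow> f = zer X Z" and "\<guillemotleft>f : Z \<rightarrow> X\<guillemotright> \<Longrightarrow> f = zer Z X"
  using assms unfolding is_zero_object_def maps_def by auto

lemma direct_sum_empty_iff:
  assumes "Z \<in> Obj C" shows "is_direct_sum C Z [] \<longleftrightarrow> is_zero_object C Z"
proof -
  interpret H: abelian_group "Hom C Z Z" using assms hom_group by blast
  show ?thesis using assms by (auto simp: is_direct_sum_def zero_object_iff)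
qed

lemma direct_sum_two_iff:
  "is_direct_sum C S [X, Y] \<longleftrightarrow> (\<exists>i j p q.
    \<guillemotleft>i : X \<rightarrow> S\<guillemotright> \<and> \<guillemotleft>j : Y \<rightarrow> S\<guillemotright> \<and> \<guillemotleft>p : S \<rightarrow> X\<guillemotright> \<and> \<guillemotleft>q : S \<rightarrow> Y\<guillemotright> \<and>
    p \<bullet> i = Id C X \<and> q \<bullet> j = Id C Y \<and> p \<bullet> j = zer Y X \<and> q \<bullet> i = zer X Y \<and>
    (i \<bullet> p) \<oplus>\<^bsub>Hom C S S\<^esub> (j \<bullet> q) = Id C S)" (is "?L \<longleftrightarrow> ?R")
proof -
  have sum: "(\<Oplus>\<^bsub>Hom C S S\<^esub>l\<in>{..<2}. i l \<bullet> p l) = (i 0 \<bullet> p 0) \<oplus>\<^bsub>Hom C S S\<^esub> (i 1 \<bullet> p 1)"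
    if "\<guillemotleft>i 0 : X \<rightarrow> S\<guillemotright>" "\<guillemotleft>i (1::nat) : Y \<rightarrow> S\<guillemotright>" "\<guillemotleft>p 0 : S \<rightarrow> X\<guillemotright>" "\<guillemotleft>p 1 : S \<rightarrow> Y\<guillemotright>" for i p
  proof -
    have o: "S \<in> Obj C" using that by (simp add: maps_def)
    interpret H: abelian_group "Hom C S S" using o hom_group by blast
    have e: "{..<2::nat} = {0, 1}" by auto
    have "i 0 \<bullet> p 0 \<in> arr C S S" "i 1 \<bullet> p 1 \<in> arr C S S"
      using that o by (auto simp: arr_iff maps_iff)
    then show ?thesis unfolding e by (subst H.finsum_insert) auto
  qed
  have two: "(\<forall>l<2. Q l) \<longleftrightarrow> Q 0 \<and> Q 1" for Q :: "nat \<Rightarrow> bool"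
    by (auto simp: less_2_cases_iff)
  show ?thesis
  proof
    assume ?L
    then obtain i p where *: "S \<in> Obj C" "X \<in> Obj C" "Y \<in> Obj C"
      "\<forall>l<2. i l \<in> arr C ([X,Y] ! l) S \<and> p l \<in> arr C S ([X,Y] ! l)"
      "\<forall>j<2. \<forall>l<2. p l \<bullet> i j = (if l = j then Id C ([X,Y] ! j) else zer ([X,Y] ! j) ([X,Y] ! l))"
      "(\<Oplus>\<^bsub>Hom C S S\<^esub>l\<in>{..<2}. i l \<bullet> p l) = Id C S"
      by (auto simp: is_direct_sum_def numeral_2_eq_2)
    then have m: "\<guillemotleft>i 0 : X \<rightarrow> S\<guillemotright>" "\<guillemotleft>i 1 : Y \<rightarrow> S\<guillemotright>" "\<guillemotleft>p 0 : S \<rightarrow> X\<guillemotright>" "\<guillemotleft>p 1 : S \<rightarrow> Y\<guillemotright>"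
      unfolding two maps_def by simp_all
    show ?R
      using m * sum[of i p, OF m] unfolding two
      by (intro exI[of _ "i 0"] exI[of _ "i 1"] exI[of _ "p 0"] exI[of _ "p 1"]) auto
  next
    assume ?R
    then obtain i j p q where *:
      "\<guillemotleft>i : X \<rightarrow> S\<guillemotright>" "\<guillemotleft>j : Y \<rightarrow> S\<guillemotright>" "\<guillemotleft>p : S \<rightarrow> X\<guillemotright>" "\<guillemotleft>q : S \<rightarrow> Y\<guillemotright>"
      "p \<bullet> i = Id C X" "q \<bullet> j = Id C Y" "p \<bullet> j = zer Y X" "q \<bullet> i = zer X Y"
      "(i \<bullet> p) \<oplus>\<^bsub>Hom C S S\<^esub> (j \<bullet> q) = Id C S" by blast
    define i' where "i' l = (if l = (0::nat) then i else j)" for l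
    define p' where "p' l = (if l = (0::nat) then p else q)" for l
    have s: "(\<Oplus>\<^bsub>Hom C S S\<^esub>l\<in>{..<2}. i' l \<bullet> p' l) = Id C S"
      using sum[of i' p'] * by (simp add: i'_def p'_def)
    have l: "length [X, Y] = 2" by simp
    show ?L
      unfolding is_direct_sum_def l two using * s
      by (intro conjI exI[of _ i'] exI[of _ p']) (auto simp: maps_def i'_def p'_def)
  qed
qed

text \<open>Only the vanishing case of distributivity over finite sums: it says that a morphism out of a finite
  direct sum is zero as soon as its components are.\<close>

lemma comp_finsum_right:
  assumes "finite J" "\<And>j. j \<in> J \<Longrightarrow> \<guillemotleft>f j : X \<rightarrow> Y\<guillemotright>" "\<guillemotleft>g : Y \<rightarrow> Z\<guillemotright>" "X \<in> Obj C"
    "\<And>j. j \<in> J \<Longrightarrow> g \<bullet> f j = zer X Z"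
  shows "g \<bullet> (\<Oplus>\<^bsub>Hom C X Y\<^esub>j\<in>J. f j) = zer X Z"
proof -
  have o: "Y \<in> Obj C" "Z \<in> Obj C" using assms maps_def by auto
  interpret H: abelian_group "Hom C X Y" using o assms hom_group by blast
  have "(\<Oplus>\<^bsub>Hom C X Y\<^esub>j\<in>J. f j) \<in> arr C X Y \<and> g \<bullet> (\<Oplus>\<^bsub>Hom C X Y\<^esub>j\<in>J. f j) = zer X Z"
    using assms(1,2,5)
  proof (induction J rule: finite_induct)
    case empty
    then show ?case using assms o by (auto simp: maps_iff)
  next
    case (insert j J)
    have "f \<in> J \<rightarrow> arr C X Y" "f j \<in> arr C X Y" using insert.prems by (auto simp: maps_def)
    then have e: "(\<Oplus>\<^bsub>Hom C X Y\<^esub>j\<in>insert j J. f j) = f j \<oplus>\<^bsub>Hom C X Y\<^esub> (\<Oplus>\<^bsub>Hom C X Y\<^esub>j\<in>J. f j)"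
      using insert.hyps by (intro H.finsum_insert) auto
    show ?case unfolding e
      using insert.IH insert.prems assms o comp_add(1)[of "f j" "\<Oplus>\<^bsub>Hom C X Y\<^esub>j\<in>J. f j" X Y g]
      by (auto simp: maps_iff arr_iff)
  qed
  then show ?thesis by blast
qed

end

section \<open>Kernels, cokernels and homological dimension of retracts\<close>

context linear_category
begin

lemma is_mono_iff:
  assumes "X \<in> Obj C" "Y \<in> Obj C"
  shows "is_mono C X Y f \<longleftrightarrow> \<guillemotleft>f : X \<rightarrow> Y\<guillemotright> \<and>
    (\<forall>W u v. \<guillemotleft>u : W \<rightarrow> X\<guillemotright> \<longrightarrow> \<guillemotleft>v : W \<rightarrow> X\<guillemotright> \<longrightarrow> f \<bullet> u = f \<bullet> v \<longrightarrow> u = v)"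
  unfolding is_mono_def maps_def using assms by blast

lemma is_epi_iff:
  assumes "X \<in> Obj C" "Y \<in> Obj C"
  shows "is_epi C X Y f \<longleftrightarrow> \<guillemotleft>f : X \<rightarrow> Y\<guillemotright> \<and>
    (\<forall>W u v. \<guillemotleft>u : Y \<rightarrow> W\<guillemotright> \<longrightarrow> \<guillemotleft>v : Y \<rightarrow> W\<guillemotright> \<longrightarrow> u \<bullet> f = v \<bullet> f \<longrightarrow> u = v)"
  unfolding is_epi_def maps_def using assms by blast

lemma kernelD:
  assumes "is_kernel C X Y Z k f" "X \<in> Obj C" "Y \<in> Obj C" "Z \<in> Obj C"
  shows "\<guillemotleft>k : X \<rightarrow> Y\<guillemotright>" "\<guillemotleft>f : Y \<rightarrow> Z\<guillemotright>" "f \<bullet> k = zer X Z"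
    "\<guillemotleft>h : W \<rightarrow> Y\<guillemotright> \<Longrightarrow> f \<bullet> h = zer W Z \<Longrightarrow> \<exists>u. \<guillemotleft>u : W \<rightarrow> X\<guillemotright> \<and> k \<bullet> u = h"
proof -
  note K = assms(1)[unfolded is_kernel_def]
  show k: "\<guillemotleft>k : X \<rightarrow> Y\<guillemotright>" "\<guillemotleft>f : Y \<rightarrow> Z\<guillemotright>" "f \<bullet> k = zer X Z" using K assms by (simp_all add: maps_def)
  assume h: "\<guillemotleft>h : W \<rightarrow> Y\<guillemotright>" "f \<bullet> h = zer W Z"
  then have "\<exists>!u. u \<in> arr C W X \<and> k \<bullet> u = h" using K by (simp add: maps_def)
  then show "\<exists>u. \<guillemotleft>u : W \<rightarrow> X\<guillemotright> \<and> k \<bullet> u = h" using h assms by (auto simp: maps_def)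
qed

lemma cokernelD:
  assumes "is_cokernel C X Y Z f c" "X \<in> Obj C" "Y \<in> Obj C" "Z \<in> Obj C"
  shows "\<guillemotleft>f : X \<rightarrow> Y\<guillemotright>" "\<guillemotleft>c : Y \<rightarrow> Z\<guillemotright>" "c \<bullet> f = zer X Z"
    "\<guillemotleft>h : Y \<rightarrow> W\<guillemotright> \<Longrightarrow> h \<bullet> f = zer X W \<Longrightarrow> \<exists>u. \<guillemotleft>u : Z \<rightarrow> W\<guillemotright> \<and> u \<bullet> c = h"
proof -
  note K = assms(1)[unfolded is_cokernel_def]
  show k: "\<guillemotleft>f : X \<rightarrow> Y\<guillemotright>" "\<guillemotleft>c : Y \<rightarrow> Z\<guillemotright>" "c \<bullet> f = zer X Z" using K assms by (simp_all add: maps_def)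
  assume h: "\<guillemotleft>h : Y \<rightarrow> W\<guillemotright>" "h \<bullet> f = zer X W"
  then have "\<exists>!u. u \<in> arr C Z W \<and> u \<bullet> c = h" using K by (simp add: maps_def)
  then show "\<exists>u. \<guillemotleft>u : Z \<rightarrow> W\<guillemotright> \<and> u \<bullet> c = h" using h assms by (auto simp: maps_def)
qed

lemma kernel_mono:
  assumes "is_kernel C X Y Z k f" "X \<in> Obj C" "Y \<in> Obj C" "Z \<in> Obj C"
  shows "is_mono C X Y k"
proof -
  note K = kernelD(1-3)[OF assms]
  have "u = v" if m: "\<guillemotleft>u : W \<rightarrow> X\<guillemotright>" "\<guillemotleft>v : W \<rightarrow> X\<guillemotright>" "k \<bullet> u = k \<bullet> v" for u v W
  proof -
    have "f \<bullet> (k \<bullet> u) = zer W Z"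
      using comp_eq_assoc[OF K(3) K(1,2) m(1)] m(1) K by (simp add: maps_iff)
    moreover have "k \<bullet> u \<in> arr C W Y" using maps_comp[OF m(1) K(1)] by (simp add: maps_def)
    ultimately have "\<exists>!w. w \<in> arr C W X \<and> k \<bullet> w = k \<bullet> u"
      using assms(1)[unfolded is_kernel_def] maps_objD[OF m(1)] by blast
    then show ?thesis using maps_arr[OF m(1)] maps_arr[OF m(2)] m(3) by (metis (no_types))
  qed
  then show ?thesis using K assms(2-4) by (auto simp: is_mono_iff)
qed

lemma cokernel_epi:
  assumes "is_cokernel C X Y Z f c" "X \<in> Obj C" "Y \<in> Obj C" "Z \<in> Obj C"
  shows "is_epi C Y Z c"
proof -
  note K = cokernelD(1-3)[OF assms]
  have "u = v" if m: "\<guillemotleft>u : Z \<rightarrow> W\<guillemotright>" "\<guillemotleft>v : Z \<rightarrow> W\<guillemotright>" "u \<bullet> c = v \<bullet> c" for u v W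
  proof -
    have "(u \<bullet> c) \<bullet> f = zer X W"
      using m(1) K by (simp add: maps_iff)
    moreover have "u \<bullet> c \<in> arr C Y W" using maps_comp[OF K(2) m(1)] by (simp add: maps_def)
    ultimately have "\<exists>!w. w \<in> arr C Z W \<and> w \<bullet> c = u \<bullet> c"
      using assms(1)[unfolded is_cokernel_def] maps_objD[OF m(1)] by blast
    then show ?thesis using maps_arr[OF m(1)] maps_arr[OF m(2)] m(3) by (metis (no_types))
  qed
  then show ?thesis using K assms(2-4) by (auto simp: is_epi_iff)
qed

text \<open>For a monomorphism the uniqueness part of the universal property is free.\<close>

lemma kernelI:
  assumes "is_mono C X Y k" "\<guillemotleft>k : X \<rightarrow> Y\<guillemotright>" "\<guillemotleft>f : Y \<rightarrow> Z\<guillemotright>" "f \<bullet> k = zer X Z"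
    and ex: "\<And>W h. \<guillemotleft>h : W \<rightarrow> Y\<guillemotright> \<Longrightarrow> f \<bullet> h = zer W Z \<Longrightarrow> \<exists>u. \<guillemotleft>u : W \<rightarrow> X\<guillemotright> \<and> k \<bullet> u = h"
  shows "is_kernel C X Y Z k f"
  unfolding is_kernel_def
proof (intro conjI ballI impI)
  fix W h assume W: "W \<in> Obj C" "h \<in> arr C W Y" "f \<bullet> h = zer W Z"
  then have "\<guillemotleft>h : W \<rightarrow> Y\<guillemotright>" using assms(2) by (simp add: maps_def)
  then obtain u where u: "\<guillemotleft>u : W \<rightarrow> X\<guillemotright>" "k \<bullet> u = h" using ex W(3) by blast
  show "\<exists>!u. u \<in> arr C W X \<and> k \<bullet> u = h"
  proof (rule ex1I[of _ u])
    show "u \<in> arr C W X \<and> k \<bullet> u = h" using u maps_arr by blast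
    fix v assume v: "v \<in> arr C W X \<and> k \<bullet> v = h"
    then show "v = u" using assms(1) u maps_arr[OF u(1)] W(1) unfolding is_mono_def by metis
  qed
qed (use assms(2-4) in \<open>simp_all add: maps_def\<close>)

lemma cokernelI:
  assumes "is_epi C Y Z c" "\<guillemotleft>f : X \<rightarrow> Y\<guillemotright>" "\<guillemotleft>c : Y \<rightarrow> Z\<guillemotright>" "c \<bullet> f = zer X Z"
    and ex: "\<And>W h. \<guillemotleft>h : Y \<rightarrow> W\<guillemotright> \<Longrightarrow> h \<bullet> f = zer X W \<Longrightarrow> \<exists>u. \<guillemotleft>u : Z \<rightarrow> W\<guillemotright> \<and> u \<bullet> c = h"
  shows "is_cokernel C X Y Z f c"
  unfolding is_cokernel_def
proof (intro conjI ballI impI)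
  fix W h assume W: "W \<in> Obj C" "h \<in> arr C Y W" "h \<bullet> f = zer X W"
  then have "\<guillemotleft>h : Y \<rightarrow> W\<guillemotright>" using assms(2) by (simp add: maps_def)
  then obtain u where u: "\<guillemotleft>u : Z \<rightarrow> W\<guillemotright>" "u \<bullet> c = h" using ex W(3) by blast
  show "\<exists>!u. u \<in> arr C Z W \<and> u \<bullet> c = h"
  proof (rule ex1I[of _ u])
    show "u \<in> arr C Z W \<and> u \<bullet> c = h" using u maps_arr by blast
    fix v assume v: "v \<in> arr C Z W \<and> v \<bullet> c = h"
    then show "v = u" using assms(1) u maps_arr[OF u(1)] W(1) unfolding is_epi_def by metis
  qed
qed (use assms(2-4) in \<open>simp_all add: maps_def\<close>)

lemma injectiveD:
  assumes "injective C I"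
  shows "I \<in> Obj C"
    and "is_mono C X Y m \<Longrightarrow> \<guillemotleft>m : X \<rightarrow> Y\<guillemotright> \<Longrightarrow> \<guillemotleft>f : X \<rightarrow> I\<guillemotright> \<Longrightarrow> \<exists>g. \<guillemotleft>g : Y \<rightarrow> I\<guillemotright> \<and> g \<bullet> m = f"
  using assms unfolding injective_def maps_def by (blast+)

lemma projectiveD:
  assumes "projective C P"
  shows "P \<in> Obj C"
    and "is_epi C X Y e \<Longrightarrow> \<guillemotleft>e : X \<rightarrow> Y\<guillemotright> \<Longrightarrow> \<guillemotleft>f : P \<rightarrow> Y\<guillemotright> \<Longrightarrow> \<exists>g. \<guillemotleft>g : P \<rightarrow> X\<guillemotright> \<and> e \<bullet> g = f"
  using assms unfolding projective_def maps_def by (blast+)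

text \<open>\<open>N\<close> is a retract of the direct sum of \<open>I\<close> and \<open>J\<close>, stated without forming the sum.\<close>

lemma injective_retract_of_sum:
  assumes "injective C I" "injective C J" "\<guillemotleft>i : N \<rightarrow> I\<guillemotright>" "\<guillemotleft>j : N \<rightarrow> J\<guillemotright>" "\<guillemotleft>p : I \<rightarrow> N\<guillemotright>" "\<guillemotleft>q : J \<rightarrow> N\<guillemotright>"
    "(p \<bullet> i) \<oplus>\<^bsub>Hom C N N\<^esub> (q \<bullet> j) = Id C N"
  shows "injective C N"
  unfolding injective_def
proof (intro conjI ballI allI impI)
  show "N \<in> Obj C" using assms maps_objD by blast
  fix X Y m f assume X: "X \<in> Obj C" "Y \<in> Obj C" and m: "is_mono C X Y m" and f: "f \<in> arr C X N"
  have m': "\<guillemotleft>m : X \<rightarrow> Y\<guillemotright>" using m X is_mono_iff by blast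
  have f': "\<guillemotleft>f : X \<rightarrow> N\<guillemotright>" using f X \<open>N \<in> Obj C\<close> by (simp add: maps_def)
  obtain g where g: "\<guillemotleft>g : Y \<rightarrow> I\<guillemotright>" "g \<bullet> m = i \<bullet> f"
    using injectiveD(2)[OF assms(1) m m' maps_comp[OF f' assms(3)]] by blast
  obtain h where h: "\<guillemotleft>h : Y \<rightarrow> J\<guillemotright>" "h \<bullet> m = j \<bullet> f"
    using injectiveD(2)[OF assms(2) m m' maps_comp[OF f' assms(4)]] by blast
  have "((p \<bullet> g) \<oplus>\<^bsub>Hom C Y N\<^esub> (q \<bullet> h)) \<bullet> m = ((p \<bullet> i) \<oplus>\<^bsub>Hom C N N\<^esub> (q \<bullet> j)) \<bullet> f"
    using g h m' f' assms(3-6) by (simp add: maps_iff)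
  also have "\<dots> = f" unfolding assms(7) using f' by (simp add: maps_iff)
  finally have *: "((p \<bullet> g) \<oplus>\<^bsub>Hom C Y N\<^esub> (q \<bullet> h)) \<bullet> m = f" .
  have "(p \<bullet> g) \<oplus>\<^bsub>Hom C Y N\<^esub> (q \<bullet> h) \<in> arr C Y N"
    using g(1) h(1) assms(5,6) by (simp add: arr_iff maps_iff)
  then show "\<exists>g\<in>arr C Y N. g \<bullet> m = f" using * by blast
qed

lemma projective_retract_of_sum:
  assumes "projective C I" "projective C J" "\<guillemotleft>i : N \<rightarrow> I\<guillemotright>" "\<guillemotleft>j : N \<rightarrow> J\<guillemotright>" "\<guillemotleft>p : I \<rightarrow> N\<guillemotright>" "\<guillemotleft>q : J \<rightarrow> N\<guillemotright>"
    "(p \<bullet> i) \<oplus>\<^bsub>Hom C N N\<^esub> (q \<bullet> j) = Id C N"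
  shows "projective C N"
  unfolding projective_def
proof (intro conjI ballI allI impI)
  show "N \<in> Obj C" using assms maps_objD by blast
  fix X Y m f assume X: "X \<in> Obj C" "Y \<in> Obj C" and m: "is_epi C X Y m" and f: "f \<in> arr C N Y"
  have m': "\<guillemotleft>m : X \<rightarrow> Y\<guillemotright>" using m X is_epi_iff by blast
  have f': "\<guillemotleft>f : N \<rightarrow> Y\<guillemotright>" using f X \<open>N \<in> Obj C\<close> by (simp add: maps_def)
  obtain g where g: "\<guillemotleft>g : I \<rightarrow> X\<guillemotright>" "m \<bullet> g = f \<bullet> p"
    using projectiveD(2)[OF assms(1) m m' maps_comp[OF assms(5) f']] by blast
  obtain h where h: "\<guillemotleft>h : J \<rightarrow> X\<guillemotright>" "m \<bullet> h = f \<bullet> q"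
    using projectiveD(2)[OF assms(2) m m' maps_comp[OF assms(6) f']] by blast
  have "m \<bullet> (g \<bullet> i) = f \<bullet> (p \<bullet> i)" "m \<bullet> (h \<bullet> j) = f \<bullet> (q \<bullet> j)"
    using comp_eq_assoc[OF g(2) g(1) m' assms(3)] comp_eq_assoc[OF h(2) h(1) m' assms(4)]
      f' assms(3-6) by (simp_all add: maps_iff)
  then have "m \<bullet> ((g \<bullet> i) \<oplus>\<^bsub>Hom C N X\<^esub> (h \<bullet> j)) = f \<bullet> ((p \<bullet> i) \<oplus>\<^bsub>Hom C N N\<^esub> (q \<bullet> j))"
    using g h m' f' assms(3-6) by (simp add: maps_iff)
  also have "\<dots> = f" unfolding assms(7) using f' by (simp add: maps_iff)
  finally have *: "m \<bullet> ((g \<bullet> i) \<oplus>\<^bsub>Hom C N X\<^esub> (h \<bullet> j)) = f" .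
  have "(g \<bullet> i) \<oplus>\<^bsub>Hom C N X\<^esub> (h \<bullet> j) \<in> arr C N X"
    using g(1) h(1) assms(3,4) by (simp add: arr_iff maps_iff)
  then show "\<exists>g\<in>arr C N X. m \<bullet> g = f" using * by blast
qed

end

context abelian_category
begin

text \<open>If \<open>f\<close> is the kernel of \<open>g\<close>, then \<open>g\<close> factors through the cokernel \<open>c\<close>, so whatever \<open>c\<close> kills is
  killed by \<open>g\<close>.\<close>

lemma mono_kernel_of_cokernel:
  assumes "is_mono C X Y f" "is_cokernel C X Y Z f c" and o: "X \<in> Obj C" "Y \<in> Obj C" "Z \<in> Obj C"
  shows "is_kernel C X Y Z f c"
proof -
  note c = cokernelD[OF assms(2) o]
  obtain V g where V: "V \<in> Obj C" and k: "is_kernel C X Y V f g"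
    using mono_is_kernel[OF o(1,2) assms(1)] by blast
  note k' = kernelD[OF k o(1,2) V]
  obtain g' where g': "\<guillemotleft>g' : Z \<rightarrow> V\<guillemotright>" "g' \<bullet> c = g" using c(4)[OF k'(2,3)] by blast
  show ?thesis
  proof (rule kernelI[OF assms(1) c(1-3)])
    fix W h assume h: "\<guillemotleft>h : W \<rightarrow> Y\<guillemotright>" "c \<bullet> h = zer W Z"
    have "g \<bullet> h = g' \<bullet> (c \<bullet> h)" unfolding g'(2)[symmetric] using g'(1) h(1) c(2) by (simp add: maps_iff)
    then have "g \<bullet> h = zer W V" using h g'(1) by (simp add: maps_iff)
    then show "\<exists>u. \<guillemotleft>u : W \<rightarrow> X\<guillemotright> \<and> f \<bullet> u = h" using k'(4)[OF h(1)] by blast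
  qed
qed

lemma epi_cokernel_of_kernel:
  assumes "is_epi C Y Z f" "is_kernel C X Y Z k f" and o: "X \<in> Obj C" "Y \<in> Obj C" "Z \<in> Obj C"
  shows "is_cokernel C X Y Z k f"
proof -
  note k = kernelD[OF assms(2) o]
  obtain V g where V: "V \<in> Obj C" and c: "is_cokernel C V Y Z g f"
    using epi_is_cokernel[OF o(2,3) assms(1)] by blast
  note c' = cokernelD[OF c V o(2,3)]
  obtain g' where g': "\<guillemotleft>g' : V \<rightarrow> X\<guillemotright>" "k \<bullet> g' = g" using k(4)[OF c'(1,3)] by blast
  show ?thesis
  proof (rule cokernelI[OF assms(1) k(1-3)])
    fix W h assume h: "\<guillemotleft>h : Y \<rightarrow> W\<guillemotright>" "h \<bullet> k = zer X W"
    have "h \<bullet> g = (h \<bullet> k) \<bullet> g'" unfolding g'(2)[symmetric] using g'(1) h(1) k(1) by (simp add: maps_iff)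
    then have "h \<bullet> g = zer V W" using h g'(1) by (simp add: maps_iff)
    then show "\<exists>u. \<guillemotleft>u : Z \<rightarrow> W\<guillemotright> \<and> u \<bullet> f = h" using c'(4)[OF h(1)] by blast
  qed
qed

text \<open>Let \<open>X\<close> be a retract of \<open>P\<close>, with \<open>P \<rightarrow> I \<rightarrow> J\<close> an injective coresolution. Embed \<open>X\<close> into \<open>I\<close> through
  \<open>P\<close>, with cokernel \<open>c : I \<rightarrow> N\<close>. The idempotent \<open>s \<bullet> p\<close> of \<open>P\<close> extends to an endomorphism \<open>t\<close> of \<open>I\<close>;
  the map \<open>c \<bullet> t\<close> factors through \<open>J\<close>, while \<open>1 - t\<close> kills \<open>X\<close> and so factors through \<open>c\<close>. Therefore
  \<open>c = c \<bullet> t + c \<bullet> (1 - t)\<close> exhibits \<open>N\<close> as a retract of the sum of \<open>J\<close> and \<open>I\<close>, and \<open>N\<close> is injective.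
  The complement of \<open>X\<close> in \<open>P\<close> is never split off.\<close>

lemma inj_dim_le_one_retract:
  assumes P: "inj_dim_le_one C P" and s: "\<guillemotleft>s : X \<rightarrow> P\<guillemotright>" and p: "\<guillemotleft>p : P \<rightarrow> X\<guillemotright>" and ps: "p \<bullet> s = Id C X"
  shows "inj_dim_le_one C X"
proof -
  obtain I J a b where I: "injective C I" "injective C J" and se: "short_exact C P I J a b"
    using P unfolding inj_dim_le_one_def by blast
  have o: "P \<in> Obj C" "I \<in> Obj C" "J \<in> Obj C" and ka: "is_kernel C P I J a b"
    and cb: "is_cokernel C P I J a b"
    using se unfolding short_exact_def by auto
  have X: "X \<in> Obj C" using s maps_objD by blast
  note a = kernelD[OF ka o] note b = cokernelD[OF cb o]
  have amono: "is_mono C P I a" using kernel_mono[OF ka o] .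
  have as: "\<guillemotleft>a \<bullet> s : X \<rightarrow> I\<guillemotright>" by (rule maps_comp[OF s a(1)])
  have as_mono: "is_mono C X I (a \<bullet> s)"
    unfolding is_mono_iff[OF X o(2)]
  proof (intro conjI allI impI as)
    fix W u v assume m: "\<guillemotleft>u : W \<rightarrow> X\<guillemotright>" "\<guillemotleft>v : W \<rightarrow> X\<guillemotright>" "(a \<bullet> s) \<bullet> u = (a \<bullet> s) \<bullet> v"
    then have "a \<bullet> (s \<bullet> u) = a \<bullet> (s \<bullet> v)" using s a(1) by (simp add: maps_iff)
    then have "s \<bullet> u = s \<bullet> v"
      using amono[unfolded is_mono_iff[OF o(1,2)]] maps_comp[OF m(1) s] maps_comp[OF m(2) s] by blast
    then have "p \<bullet> (s \<bullet> u) = p \<bullet> (s \<bullet> v)" by simp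
    then show "u = v" using comp_eq_assoc[OF ps s p] m by (simp add: maps_iff)
  qed
  obtain N c where N: "N \<in> Obj C" and c: "is_cokernel C X I N (a \<bullet> s) c"
    using cokernel_exists[OF X o(2) maps_arr[OF as]] by blast
  note c' = cokernelD[OF c X o(2) N]
  obtain t where t: "\<guillemotleft>t : I \<rightarrow> I\<guillemotright>" "t \<bullet> a = a \<bullet> (s \<bullet> p)"
    using injectiveD(2)[OF I(1) amono a(1), of "a \<bullet> (s \<bullet> p)"] maps_comp[OF maps_comp[OF p s] a(1)] by blast
  have "b \<bullet> (a \<bullet> s) = zer X J" using comp_eq_assoc[OF a(3) a(1,2) s] s o by (simp add: maps_iff)
  then obtain b' where b': "\<guillemotleft>b' : N \<rightarrow> J\<guillemotright>" "b' \<bullet> c = b" using c'(4)[OF a(2)] by blast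
  have cas: "c \<bullet> (a \<bullet> (s \<bullet> p)) = zer P N"
    using comp_eq_assoc[OF c'(3) as c'(2) p] p s a(1) c'(2) by (simp add: maps_iff)
  have "(c \<bullet> t) \<bullet> a = zer P N" using cas t a(1) c'(2) by (simp add: maps_iff)
  then obtain d where d: "\<guillemotleft>d : J \<rightarrow> N\<guillemotright>" "d \<bullet> b = c \<bullet> t"
    using b(4)[OF maps_comp[OF t(1) c'(2)]] by blast
  let ?e = "Id C I \<ominus>\<^bsub>Hom C I I\<^esub> t"
  have e: "\<guillemotleft>?e : I \<rightarrow> I\<guillemotright>" using t o by (simp add: maps_iff)
  have "t \<bullet> (a \<bullet> s) = a \<bullet> s"
    using comp_eq_assoc[OF t(2) a(1) t(1) s] ps a(1) s p by (simp add: maps_iff)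
  then have "?e \<bullet> (a \<bullet> s) = zer X I"
    using as t(1) o comp_minus_zero_iff(2)[of "Id C I" t "a \<bullet> s" I I] by (simp add: maps_iff)
  then obtain r where r: "\<guillemotleft>r : N \<rightarrow> I\<guillemotright>" "r \<bullet> c = ?e" using c'(4)[OF e] by blast
  let ?n = "(d \<bullet> b') \<oplus>\<^bsub>Hom C N N\<^esub> (c \<bullet> r)"
  have "?n \<bullet> c = (c \<bullet> t) \<oplus>\<^bsub>Hom C I N\<^esub> (c \<bullet> ?e)"
    unfolding d(2)[symmetric] b'(2)[symmetric] r(2)[symmetric]
    using d(1) b'(1) r(1) c'(2) by (simp add: maps_iff)
  also have "\<dots> = c \<bullet> (t \<oplus>\<^bsub>Hom C I I\<^esub> ?e)"
    using t(1) e c'(2) comp_add(1)[of t ?e I I c] by (simp add: maps_iff)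
  also have "t \<oplus>\<^bsub>Hom C I I\<^esub> ?e = Id C I"
    using t(1) o by (intro add_minus_cancel) (simp_all add: maps_iff)
  finally have "?n \<bullet> c = Id C N \<bullet> c" using c'(2) by (simp add: maps_iff)
  moreover have "\<guillemotleft>?n : N \<rightarrow> N\<guillemotright>" using d(1) b'(1) r(1) c'(2) by (simp add: maps_iff)
  ultimately have "?n = Id C N"
    using cokernel_epi[OF c X o(2) N, unfolded is_epi_iff[OF o(2) N]] maps_Id[OF N] by blast
  then have "injective C N"
    using injective_retract_of_sum[OF I(2,1) b'(1) r(1) d(1) c'(2)] by blast
  then show ?thesis
    unfolding inj_dim_le_one_def short_exact_def
    using I(1) c mono_kernel_of_cokernel[OF as_mono c X o(2) N] X o N by blast
qed

text \<open>Dual to the previous argument: the idempotent of \<open>J\<close> lifts to the middle term of its resolution.\<close>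

lemma proj_dim_le_one_retract:
  assumes J: "proj_dim_le_one C J" and s: "\<guillemotleft>s : X \<rightarrow> J\<guillemotright>" and p: "\<guillemotleft>p : J \<rightarrow> X\<guillemotright>" and ps: "p \<bullet> s = Id C X"
  shows "proj_dim_le_one C X"
proof -
  obtain P Q i e where P: "projective C P" "projective C Q" and se: "short_exact C P Q J i e"
    using J unfolding proj_dim_le_one_def by blast
  have o: "P \<in> Obj C" "Q \<in> Obj C" "J \<in> Obj C" and ki: "is_kernel C P Q J i e"
    and ce: "is_cokernel C P Q J i e"
    using se unfolding short_exact_def by auto
  have X: "X \<in> Obj C" using s maps_objD by blast
  note i = kernelD[OF ki o] note e = cokernelD[OF ce o]
  have eepi: "is_epi C Q J e" using cokernel_epi[OF ce o] .
  have pe: "\<guillemotleft>p \<bullet> e : Q \<rightarrow> X\<guillemotright>" by (rule maps_comp[OF e(2) p])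
  have pe_epi: "is_epi C Q X (p \<bullet> e)"
    unfolding is_epi_iff[OF o(2) X]
  proof (intro conjI allI impI pe)
    fix W u v assume m: "\<guillemotleft>u : X \<rightarrow> W\<guillemotright>" "\<guillemotleft>v : X \<rightarrow> W\<guillemotright>" "u \<bullet> (p \<bullet> e) = v \<bullet> (p \<bullet> e)"
    then have "(u \<bullet> p) \<bullet> e = (v \<bullet> p) \<bullet> e" using p e(2) by (simp add: maps_iff)
    then have "u \<bullet> p = v \<bullet> p"
      using eepi[unfolded is_epi_iff[OF o(2,3)]] maps_comp[OF p m(1)] maps_comp[OF p m(2)] by blast
    then have "(u \<bullet> p) \<bullet> s = (v \<bullet> p) \<bullet> s" by simp
    then show "u = v" using ps p s m by (simp add: maps_iff)
  qed
  obtain N k where N: "N \<in> Obj C" and k: "is_kernel C N Q X k (p \<bullet> e)"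
    using kernel_exists[OF o(2) X maps_arr[OF pe]] by blast
  note k' = kernelD[OF k N o(2) X]
  obtain t where t: "\<guillemotleft>t : Q \<rightarrow> Q\<guillemotright>" "e \<bullet> t = s \<bullet> (p \<bullet> e)"
    using projectiveD(2)[OF P(2) eepi e(2) maps_comp[OF pe s]] by blast
  have "(p \<bullet> e) \<bullet> i = zer P X" using i(3) i(1) e(2) p by (simp add: maps_iff)
  then obtain i' where i': "\<guillemotleft>i' : P \<rightarrow> N\<guillemotright>" "k \<bullet> i' = i" using k'(4)[OF i(1)] by blast
  have pek: "p \<bullet> (e \<bullet> k) = zer N X" using k'(1,3) e(2) p by (simp add: maps_iff)
  have "e \<bullet> (t \<bullet> k) = zer N J"
    using comp_eq_assoc[OF t(2) t(1) e(2) k'(1)] pek s p e(2) k'(1) by (simp add: maps_iff)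
  then obtain d where d: "\<guillemotleft>d : N \<rightarrow> P\<guillemotright>" "i \<bullet> d = t \<bullet> k"
    using i(4)[OF maps_comp[OF k'(1) t(1)]] by blast
  let ?e = "Id C Q \<ominus>\<^bsub>Hom C Q Q\<^esub> t"
  have e': "\<guillemotleft>?e : Q \<rightarrow> Q\<guillemotright>" using t o by (simp add: maps_iff)
  have "(p \<bullet> e) \<bullet> t = p \<bullet> e"
    using t comp_eq_assoc[OF ps s p pe] pe s p e(2) by (simp add: maps_iff)
  then have "(p \<bullet> e) \<bullet> ?e = zer Q X"
    using pe t(1) o comp_minus_zero_iff(1)[of "Id C Q" t "p \<bullet> e" Q Q] by (simp add: maps_iff)
  then obtain r where r: "\<guillemotleft>r : Q \<rightarrow> N\<guillemotright>" "k \<bullet> r = ?e" using k'(4)[OF e'] by blast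
  let ?n = "(i' \<bullet> d) \<oplus>\<^bsub>Hom C N N\<^esub> (r \<bullet> k)"
  have "k \<bullet> ?n = (t \<bullet> k) \<oplus>\<^bsub>Hom C N Q\<^esub> (?e \<bullet> k)"
    unfolding d(2)[symmetric] i'(2)[symmetric] r(2)[symmetric]
    using d(1) i'(1) r(1) k'(1) by (simp add: maps_iff)
  also have "\<dots> = (t \<oplus>\<^bsub>Hom C Q Q\<^esub> ?e) \<bullet> k"
    using t(1) e' k'(1) comp_add(2)[of t ?e Q Q k] by (simp add: maps_iff)
  also have "t \<oplus>\<^bsub>Hom C Q Q\<^esub> ?e = Id C Q"
    using t(1) o by (intro add_minus_cancel) (simp_all add: maps_iff)
  finally have "k \<bullet> ?n = k \<bullet> Id C N" using k'(1) by (simp add: maps_iff)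
  moreover have "\<guillemotleft>?n : N \<rightarrow> N\<guillemotright>" using d(1) i'(1) r(1) k'(1) by (simp add: maps_iff)
  ultimately have "?n = Id C N"
    using kernel_mono[OF k N o(2) X, unfolded is_mono_iff[OF N o(2)]] maps_Id[OF N] by blast
  then have "projective C N"
    using projective_retract_of_sum[OF P d(1) k'(1) i'(1) r(1)] by blast
  then show ?thesis
    unfolding proj_dim_le_one_def short_exact_def
    using P(2) k epi_cokernel_of_kernel[OF pe_epi k N o(2) X] X o N by blast
qed

end

section \<open>Triangles\<close>

context triangulated_category
begin

abbreviation sh :: "'o \<Rightarrow> 'o" where "sh X \<equiv> Shift C X"
abbreviation shm :: "'m \<Rightarrow> 'm" where "shm f \<equiv> ShiftM C f"

lemma sh_obj [simp]: "X \<in> Obj C \<Longrightarrow> sh X \<in> Obj C"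
  by (rule shift_closed)

lemma maps_shm: assumes "\<guillemotleft>f : X \<rightarrow> Y\<guillemotright>" shows "\<guillemotleft>shm f : sh X \<rightarrow> sh Y\<guillemotright>"
  using assms bij_betwE[OF shift_fully_faithful[of X Y]] by (simp add: maps_def)

lemma Mor_shm [simp]:
  assumes "Mor f" shows "Mor (shm f)" "src (shm f) = sh (src f)" "tgt (shm f) = sh (tgt f)"
  using maps_shm[of f "src f" "tgt f"] assms by (auto simp: maps_iff)

lemma shm_Id [simp]: "X \<in> Obj C \<Longrightarrow> shm (Id C X) = Id C (sh X)"
  by (rule shift_id)

lemma shm_comp [simp]:
  "Mor f \<Longrightarrow> Mor g \<Longrightarrow> src g = tgt f \<Longrightarrow> shm (g \<bullet> f) = shm g \<bullet> shm f"
  by (rule shift_comp[of "src f" "tgt f" "tgt g"]) (auto simp: arr_iff)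

lemma shm_add:
  assumes "Mor f" "Mor g" "src f = X" "src g = X" "tgt f = Y" "tgt g = Y"
  shows "shm (f \<oplus>\<^bsub>Hom C X Y\<^esub> g) = shm f \<oplus>\<^bsub>Hom C (sh X) (sh Y)\<^esub> shm g"
proof -
  have "X \<in> Obj C" "Y \<in> Obj C" using assms Mor_obj by blast+
  then show ?thesis using assms by (intro shift_add) (auto simp: arr_iff)
qed

lemma shm_zero [simp]:
  assumes "X \<in> Obj C" "Y \<in> Obj C" shows "shm (zer X Y) = zer (sh X) (sh Y)"
  using shm_add[of "zer X Y" "zer X Y" X Y] assms by (intro add_self_zero) simp_all

lemma shm_inj:
  assumes "Mor f" "Mor g" "src f = src g" "tgt f = tgt g" shows "shm f = shm g \<longleftrightarrow> f = g"
proof -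
  have "f \<in> arr C (src f) (tgt f)" "g \<in> arr C (src f) (tgt f)" using assms by (simp_all add: arr_iff)
  then show ?thesis
    using bij_betw_imp_inj_on[OF shift_fully_faithful[of "src f" "tgt f"]] assms inj_on_eq_iff
    by fastforce
qed

lemma shm_surj:
  assumes "\<guillemotleft>u : sh X \<rightarrow> sh Y\<guillemotright>" "X \<in> Obj C" "Y \<in> Obj C"
  obtains v where "\<guillemotleft>v : X \<rightarrow> Y\<guillemotright>" "shm v = u"
proof -
  have "u \<in> shm ` arr C X Y"
    using bij_betw_imp_surj_on[OF shift_fully_faithful[OF assms(2,3)]] maps_arr[OF assms(1)] by simp
  then obtain v where "v \<in> arr C X Y" "u = shm v" by (rule imageE)
  then show ?thesis using that[of v] assms(2,3) by (simp add: maps_def)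
qed

lemma shm_zero_iff:
  assumes "Mor f" "src f = X" "tgt f = Y" shows "shm f = zer (sh X) (sh Y) \<longleftrightarrow> f = zer X Y"
proof -
  have "X \<in> Obj C" "Y \<in> Obj C" using assms Mor_obj by blast+
  then show ?thesis using shm_inj[of f "zer X Y"] assms by simp
qed

lemma unshift_object:
  assumes "Y \<in> Obj C"
  obtains X e d where "X \<in> Obj C" "\<guillemotleft>e : sh X \<rightarrow> Y\<guillemotright>" "\<guillemotleft>d : Y \<rightarrow> sh X\<guillemotright>"
    "d \<bullet> e = Id C (sh X)" "e \<bullet> d = Id C Y" "is_iso C Y (sh X) d"
proof -
  obtain X e where X: "X \<in> Obj C" "is_iso C (sh X) Y e" using shift_ess_surj[OF assms] by blast
  show ?thesis using exists_iso_inverse[OF X(2)] X assms that by (metis sh_obj)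
qed

lemma shift_zero_object:
  assumes "is_zero_object C Z" shows "is_zero_object C (sh Z)"
proof -
  have Z: "Z \<in> Obj C" using assms zero_object_maps(1) by blast
  then have "shm (Id C Z) = shm (zer Z Z)" using assms zero_object_iff by simp
  then show ?thesis using Z zero_object_iff by simp
qed

lemma shift_direct_sum:
  assumes "is_direct_sum C S [X, Y]" shows "is_direct_sum C (sh S) [sh X, sh Y]"
proof -
  obtain i j p q where m: "\<guillemotleft>i : X \<rightarrow> S\<guillemotright>" "\<guillemotleft>j : Y \<rightarrow> S\<guillemotright>" "\<guillemotleft>p : S \<rightarrow> X\<guillemotright>" "\<guillemotleft>q : S \<rightarrow> Y\<guillemotright>"
    and e: "p \<bullet> i = Id C X" "q \<bullet> j = Id C Y" "p \<bullet> j = zer Y X" "q \<bullet> i = zer X Y"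
      "(i \<bullet> p) \<oplus>\<^bsub>Hom C S S\<^esub> (j \<bullet> q) = Id C S"
    using assms unfolding direct_sum_two_iff by blast
  have "shm p \<bullet> shm i = Id C (sh X)" "shm q \<bullet> shm j = Id C (sh Y)"
    "shm p \<bullet> shm j = zer (sh Y) (sh X)" "shm q \<bullet> shm i = zer (sh X) (sh Y)"
    using m arg_cong[OF e(1), of shm] arg_cong[OF e(2), of shm] arg_cong[OF e(3), of shm]
      arg_cong[OF e(4), of shm] by (simp_all add: maps_iff)
  moreover have "(shm i \<bullet> shm p) \<oplus>\<^bsub>Hom C (sh S) (sh S)\<^esub> (shm j \<bullet> shm q) = Id C (sh S)"
    using m arg_cong[OF e(5), of shm] by (simp add: maps_iff shm_add)
  ultimately show ?thesis unfolding direct_sum_two_iff using m maps_shm by blast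
qed

lemma triangle_maps:
  assumes "triangle C X Y Z f g h"
  shows "\<guillemotleft>f : X \<rightarrow> Y\<guillemotright>" "\<guillemotleft>g : Y \<rightarrow> Z\<guillemotright>" "\<guillemotleft>h : Z \<rightarrow> sh X\<guillemotright>"
  using assms unfolding triangle_def maps_def by auto

lemma rotate:
  assumes "triangle C X Y Z f g h"
  shows "triangle C Y Z (sh X) g h (\<ominus>\<^bsub>Hom C (sh X) (sh Y)\<^esub> shm f)"
  using triangle_rotate[of X Y Z f g h] assms unfolding triangle_def by blast

text \<open>Compare with the trivial triangle on the identity of \<open>X\<close>; the third component of the comparison starts
  at a zero object.\<close>

lemma triangle_comp_zero1:
  assumes t: "triangle C X Y Z f g h" shows "g \<bullet> f = zer X Z"
proof -
  note m = triangle_maps[OF t]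
  obtain O' where O: "is_zero_object C O'" using zero_object_exists by blast
  have X: "X \<in> Obj C" using m maps_objD by blast
  obtain r where "r \<in> arr C O' Z" "r \<bullet> zer X O' = g \<bullet> f"
    using triangle_morphism[OF triangle_id[OF X O] t id_closed[OF X] maps_arr[OF m(1)]] by blast
  then show ?thesis using O m zero_object_maps(1)[OF O] by (auto simp: maps_iff arr_iff)
qed

lemma triangle_comp_zero2:
  assumes t: "triangle C X Y Z f g h" shows "h \<bullet> g = zer Y (sh X)"
  using triangle_comp_zero1[OF rotate[OF t]] .

lemma triangle_comp_zero3:
  assumes t: "triangle C X Y Z f g h" shows "shm f \<bullet> h = zer Z (sh Y)"
  using triangle_comp_zero2[OF rotate[OF t]] triangle_maps[OF t] by (simp add: maps_iff)

text \<open>A morphism that vanishes on \<open>X\<close> is the middle component of a morphism into the triangle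
  \<open>0 \<rightarrow> W \<rightarrow> W \<rightarrow> 0[1]\<close>, which is a rotation of the trivial one.\<close>

lemma triangle_extend:
  assumes t: "triangle C X Y Z f g h" and u: "\<guillemotleft>u : Y \<rightarrow> W\<guillemotright>" and uf: "u \<bullet> f = zer X W"
  obtains w where "\<guillemotleft>w : Z \<rightarrow> W\<guillemotright>" "w \<bullet> g = u"
proof -
  note m = triangle_maps[OF t]
  obtain O' where O: "is_zero_object C O'" using zero_object_exists by blast
  note O1 = shift_zero_object[OF O]
  have o: "O' \<in> Obj C" "W \<in> Obj C" "X \<in> Obj C" using O zero_object_maps(1) u m maps_objD by blast+
  have "\<ominus>\<^bsub>Hom C (sh O') (sh W)\<^esub> shm (zer O' W) = zer (sh O') (sh W)"
    using o by simp
  then have t': "triangle C O' W W (zer O' W) (Id C W) (zer W (sh O'))"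
    using triangle_rotate[of O' W W "zer O' W" "Id C W" "zer W (sh O')"] o
      triangle_id[OF o(2) O1] by (simp add: arr_iff)
  have "u \<bullet> f = zer O' W \<bullet> zer X O'" using uf o by simp
  then obtain r where "r \<in> arr C Z W" "r \<bullet> g = Id C W \<bullet> u"
    using triangle_morphism[OF t t' _ maps_arr[OF u], of "zer X O'"] o by (auto simp: arr_iff)
  then show ?thesis using that[of r] u m by (auto simp: maps_iff arr_iff)
qed

lemma triangle_extend2:
  assumes t: "triangle C X Y Z f g h" and u: "\<guillemotleft>u : Z \<rightarrow> W\<guillemotright>" "u \<bullet> g = zer Y W"
  obtains w where "\<guillemotleft>w : sh X \<rightarrow> W\<guillemotright>" "w \<bullet> h = u"
  using triangle_extend[OF rotate[OF t] u] .

text \<open>Dually, rotate the trivial triangle on \<open>W\<close> and complete \<open>u\<close>, which gives a factorization of the shift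
  of \<open>u\<close>. Both rotations introduce a sign, and the two signs cancel.\<close>

lemma triangle_lift1:
  assumes t: "triangle C X Y Z f g h" and u: "\<guillemotleft>u : W \<rightarrow> Y\<guillemotright>" and gu: "g \<bullet> u = zer W Z"
  obtains w where "\<guillemotleft>w : W \<rightarrow> X\<guillemotright>" "f \<bullet> w = u"
proof -
  note m = triangle_maps[OF t]
  obtain O' where O: "is_zero_object C O'" using zero_object_exists by blast
  have o: "O' \<in> Obj C" "W \<in> Obj C" "X \<in> Obj C" "Z \<in> Obj C"
    using O zero_object_maps(1) u m maps_objD by blast+
  \<comment> \<open>the triangle from \<open>W\<close> to \<open>0\<close> to \<open>W[1]\<close>\<close>
  note tW = rotate[OF triangle_id[OF o(2) O]]
  have "zer O' Z \<bullet> zer W O' = g \<bullet> u" "zer O' Z \<in> arr C O' Z" using gu o by (simp_all add: arr_iff)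
  then obtain r where r: "r \<in> arr C (sh W) (sh X)"
    "shm u \<bullet> (\<ominus>\<^bsub>Hom C (sh W) (sh W)\<^esub> shm (Id C W)) = (\<ominus>\<^bsub>Hom C (sh X) (sh Y)\<^esub> shm f) \<bullet> r"
    using triangle_morphism[OF tW rotate[OF t] maps_arr[OF u]] by blast
  have r': "\<guillemotleft>r : sh W \<rightarrow> sh X\<guillemotright>" using r o by (simp add: maps_def)
  obtain w where w: "\<guillemotleft>w : W \<rightarrow> X\<guillemotright>" "shm w = r" using shm_surj[OF r' o(2,3)] .
  have "\<ominus>\<^bsub>Hom C (sh W) (sh Y)\<^esub> shm u = \<ominus>\<^bsub>Hom C (sh W) (sh Y)\<^esub> (shm f \<bullet> r)"
    using r(2) r' u m(1) by (simp add: maps_iff)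
  then have "shm u = shm f \<bullet> r"
    using r' u m(1) neg_inj[of "shm u" "shm f \<bullet> r" "sh W" "sh Y"] by (simp add: maps_iff)
  then have "shm u = shm (f \<bullet> w)" using w m(1) by (simp add: maps_iff)
  then have "f \<bullet> w = u" using shm_inj[of u "f \<bullet> w"] w u m(1) by (simp add: maps_iff)
  then show ?thesis using that w by blast
qed

lemma triangle_lift2:
  assumes t: "triangle C X Y Z f g h" and u: "\<guillemotleft>u : W \<rightarrow> Z\<guillemotright>" "h \<bullet> u = zer W (sh X)"
  obtains w where "\<guillemotleft>w : W \<rightarrow> Y\<guillemotright>" "g \<bullet> w = u"
  using triangle_lift1[OF rotate[OF t] u] .

lemma triangle_lift3:
  assumes t: "triangle C X Y Z f g h" and u: "\<guillemotleft>u : W \<rightarrow> sh X\<guillemotright>" "shm f \<bullet> u = zer W (sh Y)"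
  obtains w where "\<guillemotleft>w : W \<rightarrow> Z\<guillemotright>" "h \<bullet> w = u"
proof -
  have "(\<ominus>\<^bsub>Hom C (sh X) (sh Y)\<^esub> shm f) \<bullet> u = zer W (sh Y)"
    using u triangle_maps[OF t] by (simp add: maps_iff)
  then show ?thesis using triangle_lift2[OF rotate[OF t] u(1)] that by blast
qed

text \<open>The shift is only essentially surjective, so \<open>V\<close> is a shift only up to an isomorphism \<open>q\<close>.
  With \<open>q\<close>, membership of \<open>X[1]\<close> in a subcategory closed under isomorphism can be read off from \<open>V\<close>.\<close>

lemma unrotate:
  assumes t: "triangle C Y Z V g h k"
  obtains X f h' q where "triangle C X Y Z f g h'" "is_iso C V (sh X) q"
proof -
  note m = triangle_maps[OF t]
  have o: "V \<in> Obj C" "Y \<in> Obj C" "Z \<in> Obj C" using m maps_objD by blast+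
  obtain X e d where X: "X \<in> Obj C" "\<guillemotleft>e : sh X \<rightarrow> V\<guillemotright>" "\<guillemotleft>d : V \<rightarrow> sh X\<guillemotright>"
    "d \<bullet> e = Id C (sh X)" "e \<bullet> d = Id C V" "is_iso C V (sh X) d"
    using unshift_object[OF o(1)] .
  have "\<guillemotleft>\<ominus>\<^bsub>Hom C (sh X) (sh Y)\<^esub> (k \<bullet> e) : sh X \<rightarrow> sh Y\<guillemotright>" using X m by (simp add: maps_iff)
  then obtain f where f: "\<guillemotleft>f : X \<rightarrow> Y\<guillemotright>" "shm f = \<ominus>\<^bsub>Hom C (sh X) (sh Y)\<^esub> (k \<bullet> e)"
    using shm_surj X(1) o(2) by blast
  \<comment> \<open>\<open>f\<close> is chosen so that its sign cancels the one introduced by rotation\<close>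
  have nf: "\<ominus>\<^bsub>Hom C (sh X) (sh Y)\<^esub> shm f = k \<bullet> e" unfolding f(2) using X m by (simp add: maps_iff)
  have "triangle C Y Z (sh X) g (d \<bullet> h) (k \<bullet> e)"
  proof (rule triangle_iso[OF t o(2,3)])
    show "is_iso C Y Y (Id C Y)" "is_iso C Z Z (Id C Z)" using iso_Id o by auto
    show "is_iso C V (sh X) d" using X by blast
  qed (use X m o in \<open>auto simp: maps_iff arr_iff\<close>)
  then have "triangle C X Y Z f g (d \<bullet> h)"
    using triangle_rotate[of X Y Z f g "d \<bullet> h"] X o m f nf by (simp add: maps_iff arr_iff)
  then show ?thesis using that X(6) by blast
qed

end

section \<open>Vanishing of extensions and the Calabi-Yau pairing\<close>

context triangulated_category
begin

definition ext_vanishes :: "'o \<Rightarrow> 'o \<Rightarrow> bool"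
  where "ext_vanishes X Y \<longleftrightarrow> (\<forall>f. \<guillemotleft>f : X \<rightarrow> sh Y\<guillemotright> \<longrightarrow> f = zer X (sh Y))"

lemma ext_vanishesD: "ext_vanishes X Y \<Longrightarrow> \<guillemotleft>f : X \<rightarrow> sh Y\<guillemotright> \<Longrightarrow> f = zer X (sh Y)"
  unfolding ext_vanishes_def by blast

lemma ext_vanishes_carrier:
  assumes "ext_vanishes X Y" "X \<in> Obj C" "Y \<in> Obj C" shows "carrier (Ext1 C X Y) = {zer X (sh Y)}"
proof -
  interpret H: abelian_group "Hom C X (sh Y)" using hom_group assms by simp
  show ?thesis using assms H.zero_closed unfolding ext_vanishes_def maps_def by auto
qed

lemma ext_vanishes_shift:
  assumes "ext_vanishes (sh X) (sh Y)" "X \<in> Obj C" "Y \<in> Obj C" shows "ext_vanishes X Y"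
  unfolding ext_vanishes_def
proof (intro allI impI)
  fix f assume f: "\<guillemotleft>f : X \<rightarrow> sh Y\<guillemotright>"
  have "shm f = zer (sh X) (sh (sh Y))" using ext_vanishesD[OF assms(1) maps_shm[OF f]] .
  then show "f = zer X (sh Y)" using shm_zero_iff[of f X "sh Y"] f by (simp add: maps_iff)
qed

lemma ext_vanishes_shifted:
  assumes "ext_vanishes X Y" "X \<in> Obj C" "Y \<in> Obj C" shows "ext_vanishes (sh X) (sh Y)"
  unfolding ext_vanishes_def
proof (intro allI impI)
  fix f assume f: "\<guillemotleft>f : sh X \<rightarrow> sh (sh Y)\<guillemotright>"
  obtain v where v: "\<guillemotleft>v : X \<rightarrow> sh Y\<guillemotright>" "shm v = f" using shm_surj[OF f assms(2) sh_obj[OF assms(3)]] .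
  then show "f = zer (sh X) (sh (sh Y))" using ext_vanishesD[OF assms(1) v(1)] assms(2,3) by auto
qed

text \<open>A summand of \<open>M\<^sup>n\<close> has no extensions by \<open>W\<close> because a morphism from \<open>M\<^sup>n\<close> is determined by its
  components.\<close>

lemma ext_vanishes_add_closure:
  assumes M: "ext_vanishes M W" and Z: "Z \<in> add_closure C M" and W: "W \<in> Obj C"
  shows "ext_vanishes Z W"
  unfolding ext_vanishes_def
proof (intro allI impI)
  fix f assume f: "\<guillemotleft>f : Z \<rightarrow> sh W\<guillemotright>"
  obtain n S Y where S: "is_direct_sum C S (replicate n M)" and "is_direct_sum C S [Z, Y]"
    using Z unfolding add_closure_def direct_summand_def by blast
  then obtain i p where ip: "\<guillemotleft>i : Z \<rightarrow> S\<guillemotright>" "\<guillemotleft>p : S \<rightarrow> Z\<guillemotright>" "p \<bullet> i = Id C Z"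
    unfolding direct_sum_two_iff by blast
  have So: "S \<in> Obj C" using ip maps_objD by blast
  obtain j q where jq: "\<forall>l<n. j l \<in> arr C M S \<and> q l \<in> arr C S M"
    and sum: "(\<Oplus>\<^bsub>Hom C S S\<^esub>l\<in>{..<n}. j l \<bullet> q l) = Id C S"
    using S unfolding is_direct_sum_def by auto
  have "set (replicate n M) \<subseteq> Obj C" using S unfolding is_direct_sum_def by blast
  then have m: "\<guillemotleft>j l : M \<rightarrow> S\<guillemotright>" "\<guillemotleft>q l : S \<rightarrow> M\<guillemotright>" if "l < n" for l
    using that So jq by (auto simp: maps_def)
  have fp: "\<guillemotleft>f \<bullet> p : S \<rightarrow> sh W\<guillemotright>" using maps_comp[OF ip(2) f] .
  have "(f \<bullet> p) \<bullet> (\<Oplus>\<^bsub>Hom C S S\<^esub>l\<in>{..<n}. j l \<bullet> q l) = zer S (sh W)"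
  proof (rule comp_finsum_right[OF finite_lessThan _ fp So])
    fix l assume "l \<in> {..<n}"
    then have l: "l < n" by simp
    show "\<guillemotleft>j l \<bullet> q l : S \<rightarrow> S\<guillemotright>" using maps_comp[OF m(2,1)[OF l]] .
    have "(f \<bullet> p) \<bullet> j l = zer M (sh W)" using ext_vanishesD[OF M maps_comp[OF m(1)[OF l] fp]] .
    then show "(f \<bullet> p) \<bullet> (j l \<bullet> q l) = zer S (sh W)"
      using comp_eq_assoc[of "f \<bullet> p" "j l" _ M S "sh W" "q l" S] m[OF l] fp W
      by (simp add: maps_iff)
  qed
  then have "f \<bullet> p = zer S (sh W)" unfolding sum using fp by (simp add: maps_iff)
  then have "(f \<bullet> p) \<bullet> i = zer Z (sh W)" using ip W by (simp add: maps_iff)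
  then show "f = zer Z (sh W)" using ip f by (simp add: maps_iff)
qed

text \<open>The Calabi-Yau isomorphism read as a pairing of \<open>Ext\<^sup>1(X, Y)\<close> with \<open>Ext\<^sup>1(Y, X)\<close>. Only additivity in
  the weak form of preserving zero, nondegeneracy on the left and the adjunction formula are recorded:
  every use of the duality shows that some morphism is zero.\<close>

definition ext_pairing :: "('o \<Rightarrow> 'o \<Rightarrow> 'm \<Rightarrow> 'm \<Rightarrow> 'k) \<Rightarrow> bool"
  where "ext_pairing \<phi> \<longleftrightarrow>
    (\<forall>X Y f. X \<in> Obj C \<longrightarrow> Y \<in> Obj C \<longrightarrow> \<guillemotleft>f : X \<rightarrow> sh Y\<guillemotright> \<longrightarrow>
      \<phi> X Y f (zer Y (sh X)) = \<zero>\<^bsub>K\<^esub> \<and>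
      ((\<forall>g. \<guillemotleft>g : Y \<rightarrow> sh X\<guillemotright> \<longrightarrow> \<phi> X Y f g = \<zero>\<^bsub>K\<^esub>) \<longleftrightarrow> f = zer X (sh Y))) \<and>
    (\<forall>X X' Y Y' a b f g. \<guillemotleft>a : X' \<rightarrow> X\<guillemotright> \<longrightarrow> \<guillemotleft>b : Y \<rightarrow> Y'\<guillemotright> \<longrightarrow> \<guillemotleft>f : X \<rightarrow> sh Y\<guillemotright> \<longrightarrow>
      \<guillemotleft>g : Y' \<rightarrow> sh X'\<guillemotright> \<longrightarrow> \<phi> X' Y' (shm b \<bullet> f \<bullet> a) g = \<phi> X Y f (shm a \<bullet> g \<bullet> b))"

lemma ext_pairingD:
  assumes "ext_pairing \<phi>"
  shows "\<guillemotleft>f : X \<rightarrow> sh Y\<guillemotright> \<Longrightarrow> X \<in> Obj C \<Longrightarrow> Y \<in> Obj C \<Longrightarrow>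
      (\<And>g. \<guillemotleft>g : Y \<rightarrow> sh X\<guillemotright> \<Longrightarrow> \<phi> X Y f g = \<zero>\<^bsub>K\<^esub>) \<Longrightarrow> f = zer X (sh Y)"
    and "\<guillemotleft>f : X \<rightarrow> sh Y\<guillemotright> \<Longrightarrow> X \<in> Obj C \<Longrightarrow> Y \<in> Obj C \<Longrightarrow> \<phi> X Y f (zer Y (sh X)) = \<zero>\<^bsub>K\<^esub>"
    and "\<guillemotleft>g : Y \<rightarrow> sh X\<guillemotright> \<Longrightarrow> X \<in> Obj C \<Longrightarrow> Y \<in> Obj C \<Longrightarrow> \<phi> X Y (zer X (sh Y)) g = \<zero>\<^bsub>K\<^esub>"
    and "\<guillemotleft>a : X' \<rightarrow> X\<guillemotright> \<Longrightarrow> \<guillemotleft>b : Y \<rightarrow> Y'\<guillemotright> \<Longrightarrow> \<guillemotleft>f : X \<rightarrow> sh Y\<guillemotright> \<Longrightarrow> \<guillemotleft>g : Y' \<rightarrow> sh X'\<guillemotright> \<Longrightarrow>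
      \<phi> X' Y' (shm b \<bullet> f \<bullet> a) g = \<phi> X Y f (shm a \<bullet> g \<bullet> b)"
proof -
  note P = assms[unfolded ext_pairing_def]
  show "\<guillemotleft>f : X \<rightarrow> sh Y\<guillemotright> \<Longrightarrow> X \<in> Obj C \<Longrightarrow> Y \<in> Obj C \<Longrightarrow>
      (\<And>g. \<guillemotleft>g : Y \<rightarrow> sh X\<guillemotright> \<Longrightarrow> \<phi> X Y f g = \<zero>\<^bsub>K\<^esub>) \<Longrightarrow> f = zer X (sh Y)"
    using P[THEN conjunct1, THEN spec, THEN spec, THEN spec, of X Y f] by simp
  show "\<guillemotleft>f : X \<rightarrow> sh Y\<guillemotright> \<Longrightarrow> X \<in> Obj C \<Longrightarrow> Y \<in> Obj C \<Longrightarrow> \<phi> X Y f (zer Y (sh X)) = \<zero>\<^bsub>K\<^esub>"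
    using P[THEN conjunct1, THEN spec, THEN spec, THEN spec, of X Y f] by simp
  show "\<phi> X Y (zer X (sh Y)) g = \<zero>\<^bsub>K\<^esub>" if "\<guillemotleft>g : Y \<rightarrow> sh X\<guillemotright>" "X \<in> Obj C" "Y \<in> Obj C"
    using P[THEN conjunct1, THEN spec, THEN spec, THEN spec, of X Y "zer X (sh Y)"] that
    by (simp add: maps_iff)
  show "\<guillemotleft>a : X' \<rightarrow> X\<guillemotright> \<Longrightarrow> \<guillemotleft>b : Y \<rightarrow> Y'\<guillemotright> \<Longrightarrow> \<guillemotleft>f : X \<rightarrow> sh Y\<guillemotright> \<Longrightarrow> \<guillemotleft>g : Y' \<rightarrow> sh X'\<guillemotright> \<Longrightarrow>
      \<phi> X' Y' (shm b \<bullet> f \<bullet> a) g = \<phi> X Y f (shm a \<bullet> g \<bullet> b)"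
    using P[THEN conjunct2] by blast
qed

lemma calabi_yau_pairing:
  assumes "calabi_yau_2 K C"
  obtains \<phi> where "ext_pairing \<phi>"
proof -
  obtain \<phi> where cy: "\<forall>X\<in>Obj C. \<forall>Y\<in>Obj C. linear_iso K (Ext1 C X Y) (dual_space K (Ext1 C Y X)) (\<phi> X Y)"
    "\<forall>X\<in>Obj C. \<forall>X'\<in>Obj C. \<forall>Y\<in>Obj C. \<forall>Y'\<in>Obj C. \<forall>a\<in>arr C X' X. \<forall>b\<in>arr C Y Y'.
      \<forall>f\<in>carrier (Ext1 C X Y). \<forall>g\<in>carrier (Ext1 C Y' X').
        \<phi> X' Y' (shm b \<bullet> f \<bullet> a) g = \<phi> X Y f (shm a \<bullet> g \<bullet> b)"
    using assms unfolding calabi_yau_2_def by (elim exE conjE) (rule that)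
  note iso = cy(1)[rule_format] and nat = cy(2)[rule_format]
  \<comment> \<open>values at zero equal their own double\<close>
  have double: "x = \<zero>\<^bsub>K\<^esub>" if "x \<in> carrier K" "x \<oplus>\<^bsub>K\<^esub> x = x" for x
    using that add.r_cancel_one' by metis
  have dual: "\<psi> x \<in> carrier K" "\<psi> (x \<oplus>\<^bsub>V\<^esub> y) = \<psi> x \<oplus>\<^bsub>K\<^esub> \<psi> y"
    if "\<psi> \<in> carrier (dual_space K V)" "x \<in> carrier V" "y \<in> carrier V"
    for \<psi> x y and V :: "('k, 'm) module"
    using that unfolding dual_space_def by auto
  have mem: "\<phi> X Y f \<in> carrier (dual_space K (Ext1 C Y X))" if "X \<in> Obj C" "Y \<in> Obj C" "\<guillemotleft>f : X \<rightarrow> sh Y\<guillemotright>" for X Y f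
    using iso[OF that(1,2)] maps_arr[OF that(3)] unfolding linear_iso_def by (blast dest: bij_betwE)
  have z2: "\<phi> X Y f (zer Y (sh X)) = \<zero>\<^bsub>K\<^esub>" if f: "\<guillemotleft>f : X \<rightarrow> sh Y\<guillemotright>" and Y: "Y \<in> Obj C" for X Y f
  proof -
    have o: "X \<in> Obj C" "sh X \<in> Obj C" using maps_objD(1)[OF f] by auto
    interpret H: abelian_group "Hom C Y (sh X)" using hom_group Y o by blast
    let ?z = "zer Y (sh X)"
    have zz: "?z \<oplus>\<^bsub>Hom C Y (sh X)\<^esub> ?z = ?z" by simp
    have "\<phi> X Y f (?z \<oplus>\<^bsub>Hom C Y (sh X)\<^esub> ?z) = \<phi> X Y f ?z \<oplus>\<^bsub>K\<^esub> \<phi> X Y f ?z"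
      by (rule dual(2)[OF mem[OF o(1) Y f] H.zero_closed H.zero_closed])
    moreover have "\<phi> X Y f ?z \<in> carrier K"
      by (rule dual(1)[OF mem[OF o(1) Y f] H.zero_closed H.zero_closed])
    ultimately show ?thesis unfolding zz by (intro double) simp_all
  qed
  have z1: "\<phi> X Y (zer X (sh Y)) g = \<zero>\<^bsub>K\<^esub>" if g: "\<guillemotleft>g : Y \<rightarrow> sh X\<guillemotright>" and X: "X \<in> Obj C" for X Y g
  proof -
    have o: "Y \<in> Obj C" "sh Y \<in> Obj C" using maps_objD(1)[OF g] by auto
    interpret H: abelian_group "Hom C X (sh Y)" using hom_group X o by blast
    let ?z = "zer X (sh Y)"
    have zm: "\<guillemotleft>?z : X \<rightarrow> sh Y\<guillemotright>" using X o by (simp add: maps_iff)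
    have zz: "?z \<oplus>\<^bsub>Hom C X (sh Y)\<^esub> ?z = ?z" by simp
    have "\<phi> X Y (?z \<oplus>\<^bsub>Hom C X (sh Y)\<^esub> ?z) g = (\<phi> X Y ?z \<oplus>\<^bsub>dual_space K (Ext1 C Y X)\<^esub> \<phi> X Y ?z) g"
      using iso[OF X o(1)] H.zero_closed unfolding linear_iso_def by metis
    also have "\<dots> = \<phi> X Y ?z g \<oplus>\<^bsub>K\<^esub> \<phi> X Y ?z g"
      using maps_arr[OF g] unfolding dual_space_def by simp
    finally have "\<phi> X Y ?z g = \<phi> X Y ?z g \<oplus>\<^bsub>K\<^esub> \<phi> X Y ?z g" unfolding zz .
    moreover have "\<phi> X Y ?z g \<in> carrier K"
      using dual(1)[OF mem[OF X o(1) zm] maps_arr[OF g] maps_arr[OF g]] .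
    ultimately show ?thesis by (intro double) simp_all
  qed
  have inj: "f = zer X (sh Y)" if f: "\<guillemotleft>f : X \<rightarrow> sh Y\<guillemotright>" and o: "X \<in> Obj C" "Y \<in> Obj C"
    and z: "\<And>g. \<guillemotleft>g : Y \<rightarrow> sh X\<guillemotright> \<Longrightarrow> \<phi> X Y f g = \<zero>\<^bsub>K\<^esub>" for X Y f
  proof -
    have zm: "\<guillemotleft>zer X (sh Y) : X \<rightarrow> sh Y\<guillemotright>" using o by (simp add: maps_iff)
    have "\<phi> X Y f = \<phi> X Y (zer X (sh Y))"
    proof (rule extensionalityI)
      show "\<phi> X Y f \<in> extensional (carrier (Ext1 C Y X))"
        using mem[OF o f] unfolding dual_space_def by (auto simp: PiE_def)
      show "\<phi> X Y (zer X (sh Y)) \<in> extensional (carrier (Ext1 C Y X))"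
        using mem[OF o zm] unfolding dual_space_def by (auto simp: PiE_def)
      fix g assume "g \<in> carrier (Ext1 C Y X)"
      then have "\<guillemotleft>g : Y \<rightarrow> sh X\<guillemotright>" using o by (simp add: maps_def)
      then show "\<phi> X Y f g = \<phi> X Y (zer X (sh Y)) g" using z z1 o by simp
    qed
    moreover have "inj_on (\<phi> X Y) (carrier (Ext1 C X Y))"
      using iso[OF o] unfolding linear_iso_def by (blast dest: bij_betw_imp_inj_on)
    ultimately show ?thesis using maps_arr[OF f] maps_arr[OF zm] by (blast dest: inj_onD)
  qed
  have "ext_pairing \<phi>"
    unfolding ext_pairing_def
  proof (intro conjI allI impI iffI)
    fix X X' Y Y' a b f g
    assume m: "\<guillemotleft>a : X' \<rightarrow> X\<guillemotright>" "\<guillemotleft>b : Y \<rightarrow> Y'\<guillemotright>" "\<guillemotleft>f : X \<rightarrow> sh Y\<guillemotright>" "\<guillemotleft>g : Y' \<rightarrow> sh X'\<guillemotright>"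
    show "\<phi> X' Y' (shm b \<bullet> f \<bullet> a) g = \<phi> X Y f (shm a \<bullet> g \<bullet> b)"
      by (rule nat[OF maps_objD(2,1)[OF m(1)] maps_objD[OF m(2)] maps_arr[OF m(1)] maps_arr[OF m(2)]
        maps_arr[OF m(3)] maps_arr[OF m(4)]])
  qed (use inj z2 z1 in blast)+
  then show ?thesis by (rule that)
qed

lemma ext_vanishes_sym:
  assumes cy: "calabi_yau_2 K C" and e: "ext_vanishes Y X" and o: "X \<in> Obj C" "Y \<in> Obj C"
  shows "ext_vanishes X Y"
proof -
  obtain \<phi> where pairing: "ext_pairing \<phi>" by (rule calabi_yau_pairing[OF cy])
  note inj = ext_pairingD(1)[OF pairing] and z2 = ext_pairingD(2)[OF pairing]
  show ?thesis
    unfolding ext_vanishes_def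
  proof (intro allI impI)
    fix f assume f: "\<guillemotleft>f : X \<rightarrow> sh Y\<guillemotright>"
    show "f = zer X (sh Y)"
    proof (rule inj[OF f o])
      fix g assume "\<guillemotleft>g : Y \<rightarrow> sh X\<guillemotright>"
      then have "g = zer Y (sh X)" using ext_vanishesD[OF e] by blast
      then show "\<phi> X Y f g = \<zero>\<^bsub>K\<^esub>" using z2[OF f o] by simp
    qed
  qed
qed

text \<open>By the adjunction formula the pairing of \<open>f \<bullet> w\<close> with \<open>g\<close> is the pairing of \<open>f\<close> with \<open>w[1] \<bullet> g = 0\<close>.\<close>

lemma calabi_yau_comp_zero:
  assumes cy: "calabi_yau_2 K C" and f: "\<guillemotleft>f : X \<rightarrow> sh Y\<guillemotright>" and w: "\<guillemotleft>w : V \<rightarrow> X\<guillemotright>" and Y: "Y \<in> Obj C"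
    and z: "\<And>g. \<guillemotleft>g : Y \<rightarrow> sh V\<guillemotright> \<Longrightarrow> shm w \<bullet> g = zer Y (sh X)"
  shows "f \<bullet> w = zer V (sh Y)"
proof -
  obtain \<phi> where pairing: "ext_pairing \<phi>" by (rule calabi_yau_pairing[OF cy])
  note inj = ext_pairingD(1)[OF pairing] and z2 = ext_pairingD(2)[OF pairing]
    and nat = ext_pairingD(4)[OF pairing]
  show ?thesis
  proof (rule inj[OF maps_comp[OF w f] maps_objD(1)[OF w] Y])
    fix g assume g: "\<guillemotleft>g : Y \<rightarrow> sh V\<guillemotright>"
    have "\<phi> V Y (f \<bullet> w) g = \<phi> V Y (shm (Id C Y) \<bullet> f \<bullet> w) g" using f w Y by (simp add: maps_iff)
    also have "\<dots> = \<phi> X Y f (shm w \<bullet> g \<bullet> Id C Y)" using nat[OF w maps_Id[OF Y] f g] .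
    also have "shm w \<bullet> g \<bullet> Id C Y = zer Y (sh X)" using z[OF g] g w Y by (simp add: maps_iff)
    finally show "\<phi> V Y (f \<bullet> w) g = \<zero>\<^bsub>K\<^esub>" using z2[OF f maps_objD(2)[OF w] Y] by simp
  qed
qed

text \<open>The pairing of \<open>u\<close> with \<open>g = t \<bullet> a\<close> is the pairing of \<open>a[1] \<bullet> u = 0\<close> with \<open>t\<close>. In words: what is
  invisible to a morphism through which everything factors is zero.\<close>

lemma calabi_yau_zero:
  assumes cy: "calabi_yau_2 K C" and u: "\<guillemotleft>u : X \<rightarrow> sh Y\<guillemotright>" and a: "\<guillemotleft>a : Y \<rightarrow> T\<guillemotright>" and X: "X \<in> Obj C"
    and z: "shm a \<bullet> u = zer X (sh T)"
    and fac: "\<And>g. \<guillemotleft>g : Y \<rightarrow> sh X\<guillemotright> \<Longrightarrow> \<exists>t. \<guillemotleft>t : T \<rightarrow> sh X\<guillemotright> \<and> t \<bullet> a = g"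
  shows "u = zer X (sh Y)"
proof -
  obtain \<phi> where pairing: "ext_pairing \<phi>" by (rule calabi_yau_pairing[OF cy])
  note inj = ext_pairingD(1)[OF pairing] and z1 = ext_pairingD(3)[OF pairing]
    and nat = ext_pairingD(4)[OF pairing]
  show ?thesis
  proof (rule inj[OF u X maps_objD(1)[OF a]])
    fix g assume "\<guillemotleft>g : Y \<rightarrow> sh X\<guillemotright>"
    then obtain t where t: "\<guillemotleft>t : T \<rightarrow> sh X\<guillemotright>" "t \<bullet> a = g" using fac by blast
    have "g = shm (Id C X) \<bullet> t \<bullet> a" using t a X by (auto simp: maps_iff)
    then have "\<phi> X Y u g = \<phi> X T (shm a \<bullet> u \<bullet> Id C X) t"
      using nat[OF maps_Id[OF X] a u t(1)] by simp
    also have "shm a \<bullet> u \<bullet> Id C X = zer X (sh T)" unfolding z using X a by (simp add: maps_iff)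
    finally show "\<phi> X Y u g = \<zero>\<^bsub>K\<^esub>" using z1[OF t(1) X maps_objD(2)[OF a]] by simp
  qed
qed

end

section \<open>Morphisms seen from the shifted rigid subcategory\<close>

locale rigid_subcategory = triangulated_category K C
  for K :: "('k, 'b) ring_scheme" (structure)
  and C :: "('k, 'o, 'm, 'c) tri_cat_scheme" (structure) +
  fixes R :: "'o set"
  assumes R_rigid: "rigid C R"
    and R_contravariantly_finite: "contravariantly_finite C R"
begin

abbreviation U :: "'o set" where "U \<equiv> unshift C R"
abbreviation D :: "'o set" where "D \<equiv> star C U R"

lemma R_obj [simp]: "T \<in> R \<Longrightarrow> T \<in> Obj C"
  using R_rigid unfolding rigid_def subcategory_def by blast

lemma R_iso: "T \<in> R \<Longrightarrow> Y \<in> Obj C \<Longrightarrow> is_iso C T Y e \<Longrightarrow> Y \<in> R"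
  using R_rigid unfolding rigid_def subcategory_def by blast

lemma U_I: "P \<in> Obj C \<Longrightarrow> sh P \<in> R \<Longrightarrow> P \<in> U"
  by (simp add: unshift_def)

lemma U_obj [simp]: "P \<in> U \<Longrightarrow> P \<in> Obj C"
  by (simp add: unshift_def)

lemma U_shift: "P \<in> U \<Longrightarrow> sh P \<in> R"
  unfolding unshift_def by blast

lemma ext_R_zero:
  assumes "T \<in> R" "T' \<in> R" "\<guillemotleft>u : T \<rightarrow> sh T'\<guillemotright>" shows "u = zer T (sh T')"
  using R_rigid assms unfolding rigid_def ext_orthogonal_def maps_def by blast

lemma hom_U_R_zero:
  assumes "P \<in> U" "T \<in> R" "\<guillemotleft>u : P \<rightarrow> T\<guillemotright>" shows "u = zer P T"
proof -
  have "shm u = zer (sh P) (sh T)" using ext_R_zero[OF U_shift[OF assms(1)] assms(2) maps_shm[OF assms(3)]] .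
  then show ?thesis using shm_zero_iff assms(3) by (simp add: maps_iff)
qed

lemma R_sums: "set Xs \<subseteq> R \<Longrightarrow> is_direct_sum C S Xs \<Longrightarrow> S \<in> R"
  using R_rigid unfolding rigid_def summand_sum_closed_def by blast

lemma zero_object_R: assumes "is_zero_object C Z" shows "Z \<in> R"
  using R_sums[of "[]" Z] direct_sum_empty_iff[OF zero_object_maps(1)[OF assms]] assms by simp

lemma zero_object_U: assumes "is_zero_object C Z" shows "Z \<in> U"
  by (rule U_I[OF zero_object_maps(1)[OF assms] zero_object_R[OF shift_zero_object[OF assms]]])

lemma U_sum: assumes "P \<in> U" "Q \<in> U" "is_direct_sum C S [P, Q]" shows "S \<in> U"
proof -
  have "S \<in> Obj C" using assms(3) unfolding is_direct_sum_def by blast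
  moreover have "sh S \<in> R" using R_sums[OF _ shift_direct_sum[OF assms(3)]] assms U_shift by simp
  ultimately show ?thesis by (rule U_I)
qed

lemma unshift_R:
  assumes "Y \<in> R"
  obtains P e d where "P \<in> U" "\<guillemotleft>e : sh P \<rightarrow> Y\<guillemotright>" "\<guillemotleft>d : Y \<rightarrow> sh P\<guillemotright>" "d \<bullet> e = Id C (sh P)" "e \<bullet> d = Id C Y"
proof -
  obtain P e d where P: "P \<in> Obj C" "\<guillemotleft>e : sh P \<rightarrow> Y\<guillemotright>" "\<guillemotleft>d : Y \<rightarrow> sh P\<guillemotright>"
    "d \<bullet> e = Id C (sh P)" "e \<bullet> d = Id C Y" "is_iso C Y (sh P) d"
    using unshift_object[OF R_obj[OF assms]] .
  then have "P \<in> U" using U_I[OF P(1)] R_iso[OF assms _ P(6)] P(1) by simp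
  then show ?thesis using that P by blast
qed

text \<open>The shift of a right approximation of \<open>X\<close> by \<open>U\<close> is a right approximation of \<open>X[1]\<close> by \<open>R\<close>.\<close>

lemma U_approximation:
  assumes X: "X \<in> Obj C"
  obtains P a where "P \<in> U" "\<guillemotleft>a : P \<rightarrow> X\<guillemotright>"
    "\<And>Q u. Q \<in> U \<Longrightarrow> \<guillemotleft>u : Q \<rightarrow> X\<guillemotright> \<Longrightarrow> \<exists>v. \<guillemotleft>v : Q \<rightarrow> P\<guillemotright> \<and> a \<bullet> v = u"
proof -
  obtain T f where ra: "right_approximation C R (sh X) T f"
    using R_contravariantly_finite sh_obj[OF X] unfolding contravariantly_finite_def by blast
  then have T: "T \<in> R" and f: "\<guillemotleft>f : T \<rightarrow> sh X\<guillemotright>"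
    unfolding right_approximation_def maps_def using X by simp_all
  have app: "\<exists>h. \<guillemotleft>h : T' \<rightarrow> T\<guillemotright> \<and> f \<bullet> h = g" if T': "T' \<in> R" "\<guillemotleft>g : T' \<rightarrow> sh X\<guillemotright>" for T' g
  proof -
    obtain h where "h \<in> arr C T' T" "f \<bullet> h = g"
      using ra T'(1) maps_arr[OF T'(2)] unfolding right_approximation_def by blast
    then show ?thesis using T T'(1) by (auto simp: maps_def)
  qed
  obtain P e d where P: "P \<in> U" "\<guillemotleft>e : sh P \<rightarrow> T\<guillemotright>" "\<guillemotleft>d : T \<rightarrow> sh P\<guillemotright>"
    "d \<bullet> e = Id C (sh P)" "e \<bullet> d = Id C T"
    using unshift_R[OF T] .
  obtain a where a: "\<guillemotleft>a : P \<rightarrow> X\<guillemotright>" "shm a = f \<bullet> e"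
    using shm_surj[OF maps_comp[OF P(2) f] U_obj[OF P(1)] X] .
  have "\<exists>v. \<guillemotleft>v : Q \<rightarrow> P\<guillemotright> \<and> a \<bullet> v = u" if Q: "Q \<in> U" "\<guillemotleft>u : Q \<rightarrow> X\<guillemotright>" for Q u
  proof -
    obtain h where h: "\<guillemotleft>h : sh Q \<rightarrow> T\<guillemotright>" "f \<bullet> h = shm u"
      using app[OF U_shift[OF Q(1)] maps_shm[OF Q(2)]] by blast
    obtain v where v: "\<guillemotleft>v : Q \<rightarrow> P\<guillemotright>" "shm v = d \<bullet> h"
      using shm_surj[OF maps_comp[OF h(1) P(3)] U_obj[OF Q(1)] U_obj[OF P(1)]] .
    have "shm (a \<bullet> v) = f \<bullet> (e \<bullet> (d \<bullet> h))" using a v P(2,3) f h(1) by (simp add: maps_iff)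
    also have "\<dots> = shm u" using comp_eq_assoc[OF P(5) P(3) P(2) h(1)] h by (simp add: maps_iff)
    finally have "a \<bullet> v = u" using shm_inj[of "a \<bullet> v" u] a v Q by (simp add: maps_iff)
    then show ?thesis using v by blast
  qed
  then show ?thesis using that P a by blast
qed

lemma D_I:
  assumes "triangle C P Q X i p r" "P \<in> U" "Q \<in> U" shows "X \<in> D"
  unfolding star_def using rotate[OF assms(1)] assms(3) U_shift[OF assms(2)] by blast

text \<open>With \<open>D_I\<close>: the objects of \<open>D\<close> are the cones of morphisms of \<open>U\<close>.\<close>

lemma D_presentation:
  assumes "X \<in> D"
  obtains P Q i p r where "P \<in> U" "Q \<in> U" "triangle C P Q X i p r"
proof -
  obtain Q T f g h where Q: "Q \<in> U" "T \<in> R" and t: "triangle C Q X T f g h"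
    using assms unfolding star_def by blast
  obtain P i r d where P: "triangle C P Q X i f r" "is_iso C T (sh P) d" using unrotate[OF t] .
  have "P \<in> Obj C" using maps_objD(1)[OF triangle_maps(1)[OF P(1)]] .
  then have "P \<in> U" using U_I R_iso[OF Q(2) _ P(2)] by simp
  then show ?thesis using that P Q by blast
qed

lemma D_obj [simp]: "X \<in> D \<Longrightarrow> X \<in> Obj C"
  unfolding star_def triangle_def by blast

text \<open>The obstruction to lifting \<open>u\<close> lies in \<open>Hom(W, P[1])\<close>, which vanishes as \<open>P[1]\<close> is in \<open>R\<close>.\<close>

lemma presentation_epi:
  assumes "triangle C P Q X i p r" "P \<in> U" and W: "W \<in> U" "\<guillemotleft>u : W \<rightarrow> X\<guillemotright>"
  shows "\<exists>v. \<guillemotleft>v : W \<rightarrow> Q\<guillemotright> \<and> p \<bullet> v = u"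
proof -
  have "r \<bullet> u = zer W (sh P)"
    using hom_U_R_zero[OF W(1) U_shift[OF assms(2)] maps_comp[OF W(2) triangle_maps(3)[OF assms(1)]]] .
  then show ?thesis using triangle_lift2[OF assms(1) W(2)] by blast
qed

text \<open>Equality, injectivity, surjectivity and exactness after applying \<open>Hom(U, -)\<close>.\<close>

definition U_eq :: "'m \<Rightarrow> 'm \<Rightarrow> bool" (infix \<open>\<approx>\<close> 50)
  where "f \<approx> g \<longleftrightarrow> (\<forall>P\<in>U. \<forall>u. \<guillemotleft>u : P \<rightarrow> src f\<guillemotright> \<longrightarrow> f \<bullet> u = g \<bullet> u)"

definition U_mono :: "'m \<Rightarrow> bool"
  where "U_mono f \<longleftrightarrow> (\<forall>P\<in>U. \<forall>u. \<guillemotleft>u : P \<rightarrow> src f\<guillemotright> \<longrightarrow> f \<bullet> u = zer P (tgt f) \<longrightarrow> u = zer P (src f))"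

definition U_epi :: "'m \<Rightarrow> bool"
  where "U_epi f \<longleftrightarrow> (\<forall>P\<in>U. \<forall>u. \<guillemotleft>u : P \<rightarrow> tgt f\<guillemotright> \<longrightarrow> (\<exists>v. \<guillemotleft>v : P \<rightarrow> src f\<guillemotright> \<and> f \<bullet> v = u))"

definition U_exact :: "'m \<Rightarrow> 'm \<Rightarrow> bool"
  where "U_exact f g \<longleftrightarrow> (\<forall>P\<in>U. \<forall>u. \<guillemotleft>u : P \<rightarrow> src g\<guillemotright> \<longrightarrow>
    (g \<bullet> u = zer P (tgt g) \<longleftrightarrow> (\<exists>v. \<guillemotleft>v : P \<rightarrow> src f\<guillemotright> \<and> f \<bullet> v = u)))"

lemma U_eqD:
  assumes "f \<approx> g" "\<guillemotleft>f : X \<rightarrow> Y\<guillemotright>" "P \<in> U" "\<guillemotleft>u : P \<rightarrow> X\<guillemotright>" shows "f \<bullet> u = g \<bullet> u"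
  using assms unfolding U_eq_def by (simp add: maps_iff)

lemma U_eqI:
  assumes "\<guillemotleft>f : X \<rightarrow> Y\<guillemotright>" "\<And>P u. P \<in> U \<Longrightarrow> \<guillemotleft>u : P \<rightarrow> X\<guillemotright> \<Longrightarrow> f \<bullet> u = g \<bullet> u" shows "f \<approx> g"
  unfolding U_eq_def using assms(2) src_tgt[OF assms(1)] by simp

lemma U_monoD:
  assumes "U_mono f" "\<guillemotleft>f : X \<rightarrow> Y\<guillemotright>" "P \<in> U" "\<guillemotleft>u : P \<rightarrow> X\<guillemotright>" "f \<bullet> u = zer P Y" shows "u = zer P X"
  using assms unfolding U_mono_def by (simp add: maps_iff)

lemma U_monoI:
  assumes "\<guillemotleft>f : X \<rightarrow> Y\<guillemotright>" "\<And>P u. P \<in> U \<Longrightarrow> \<guillemotleft>u : P \<rightarrow> X\<guillemotright> \<Longrightarrow> f \<bullet> u = zer P Y \<Longrightarrow> u = zer P X"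
  shows "U_mono f"
  unfolding U_mono_def using assms(2) src_tgt[OF assms(1)] by simp

lemma U_mono_cancel:
  assumes "U_mono f" "\<guillemotleft>f : X \<rightarrow> Y\<guillemotright>" "P \<in> U" "\<guillemotleft>u : P \<rightarrow> X\<guillemotright>" "\<guillemotleft>v : P \<rightarrow> X\<guillemotright>" "f \<bullet> u = f \<bullet> v"
  shows "u = v"
proof -
  let ?w = "u \<ominus>\<^bsub>Hom C P X\<^esub> v"
  have "\<guillemotleft>?w : P \<rightarrow> X\<guillemotright>" using assms(4,5) by (simp add: maps_iff)
  moreover have "f \<bullet> ?w = zer P Y"
    using comp_minus_zero_iff(1)[of u v f P X] assms by (simp add: maps_iff)
  ultimately have "?w = zer P X" using U_monoD assms(1-3) by blast
  then show ?thesis using minus_zero_iff[of u v P X] assms(4,5) by (simp add: maps_iff)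
qed

lemma U_epiD:
  assumes "U_epi f" "\<guillemotleft>f : X \<rightarrow> Y\<guillemotright>" "P \<in> U" "\<guillemotleft>u : P \<rightarrow> Y\<guillemotright>"
  obtains v where "\<guillemotleft>v : P \<rightarrow> X\<guillemotright>" "f \<bullet> v = u"
  using assms(1,3,4) src_tgt[OF assms(2)] unfolding U_epi_def by metis

lemma U_epiI:
  assumes "\<guillemotleft>f : X \<rightarrow> Y\<guillemotright>" "\<And>P u. P \<in> U \<Longrightarrow> \<guillemotleft>u : P \<rightarrow> Y\<guillemotright> \<Longrightarrow> \<exists>v. \<guillemotleft>v : P \<rightarrow> X\<guillemotright> \<and> f \<bullet> v = u"
  shows "U_epi f"
  unfolding U_epi_def using assms(2) src_tgt[OF assms(1)] by simp

lemma U_exactD1: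
  assumes "U_exact f g" "\<guillemotleft>f : X \<rightarrow> Y\<guillemotright>" "\<guillemotleft>g : Y \<rightarrow> Z\<guillemotright>" "P \<in> U" "\<guillemotleft>u : P \<rightarrow> Y\<guillemotright>" "g \<bullet> u = zer P Z"
  obtains v where "\<guillemotleft>v : P \<rightarrow> X\<guillemotright>" "f \<bullet> v = u"
  using assms(1,4-6) src_tgt[OF assms(2)] src_tgt[OF assms(3)] unfolding U_exact_def by metis

lemma U_exactD2:
  assumes "U_exact f g" "\<guillemotleft>f : X \<rightarrow> Y\<guillemotright>" "\<guillemotleft>g : Y \<rightarrow> Z\<guillemotright>" "P \<in> U" "\<guillemotleft>v : P \<rightarrow> X\<guillemotright>"
  shows "g \<bullet> (f \<bullet> v) = zer P Z"
  using assms(1,4,5) maps_comp[OF assms(5,2)] src_tgt[OF assms(2)] src_tgt[OF assms(3)]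
  unfolding U_exact_def by metis

lemma U_exactI:
  assumes "\<guillemotleft>f : X \<rightarrow> Y\<guillemotright>" "\<guillemotleft>g : Y \<rightarrow> Z\<guillemotright>"
    "\<And>P u. P \<in> U \<Longrightarrow> \<guillemotleft>u : P \<rightarrow> Y\<guillemotright> \<Longrightarrow> g \<bullet> u = zer P Z \<Longrightarrow> \<exists>v. \<guillemotleft>v : P \<rightarrow> X\<guillemotright> \<and> f \<bullet> v = u"
    "\<And>P v. P \<in> U \<Longrightarrow> \<guillemotleft>v : P \<rightarrow> X\<guillemotright> \<Longrightarrow> g \<bullet> (f \<bullet> v) = zer P Z"
  shows "U_exact f g"
  unfolding U_exact_def src_tgt[OF assms(1)] src_tgt[OF assms(2)]
  using assms(3,4) by metis

lemma U_exact_comp_zero: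
  assumes "U_exact f g" "\<guillemotleft>f : X \<rightarrow> Y\<guillemotright>" "\<guillemotleft>g : Y \<rightarrow> Z\<guillemotright>"
  shows "g \<bullet> f \<approx> zer X Z"
proof (rule U_eqI[OF maps_comp[OF assms(2,3)]])
  fix P u assume u: "P \<in> U" "\<guillemotleft>u : P \<rightarrow> X\<guillemotright>"
  show "(g \<bullet> f) \<bullet> u = zer X Z \<bullet> u"
    using U_exactD2[OF assms u] u assms(2,3) by (simp add: maps_iff)
qed

lemma U_exact_triangle:
  assumes "triangle C X Y Z f g h" shows "U_exact f g"
proof -
  note m = triangle_maps[OF assms]
  show ?thesis
  proof (rule U_exactI[OF m(1,2)])
    fix P v assume "P \<in> U" "\<guillemotleft>v : P \<rightarrow> X\<guillemotright>"
    then show "g \<bullet> (f \<bullet> v) = zer P Z"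
      using comp_eq_assoc[OF triangle_comp_zero1[OF assms] m(1,2)] m by (simp add: maps_iff)
  next
    fix P u assume "P \<in> U" "\<guillemotleft>u : P \<rightarrow> Y\<guillemotright>" "g \<bullet> u = zer P Z"
    then show "\<exists>v. \<guillemotleft>v : P \<rightarrow> X\<guillemotright> \<and> f \<bullet> v = u" using triangle_lift1[OF assms] by blast
  qed
qed

text \<open>A morphism killed by \<open>Hom(U, -)\<close> vanishes on \<open>Q\<close> in a presentation \<open>P \<rightarrow> Q \<rightarrow> X \<rightarrow> P[1]\<close>, so it factors
  through \<open>P[1]\<close>, an object of \<open>R\<close>. This is where the objects of \<open>D\<close> are special.\<close>

lemma factoring_iff:
  assumes X: "X \<in> D" and f: "\<guillemotleft>f : X \<rightarrow> Y\<guillemotright>"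
  shows "f \<in> factoring C R X Y \<longleftrightarrow> f \<approx> zer X Y"
proof
  assume "f \<in> factoring C R X Y"
  then obtain u v T where T: "T \<in> R" "f = v \<bullet> u" "\<guillemotleft>u : X \<rightarrow> T\<guillemotright>" "\<guillemotleft>v : T \<rightarrow> Y\<guillemotright>"
    using f unfolding factoring_def maps_def by auto
  show "f \<approx> zer X Y"
  proof (rule U_eqI[OF f])
    fix P w assume w: "P \<in> U" "\<guillemotleft>w : P \<rightarrow> X\<guillemotright>"
    have "u \<bullet> w = zer P T" using hom_U_R_zero[OF w(1) T(1) maps_comp[OF w(2) T(3)]] .
    then show "f \<bullet> w = zer X Y \<bullet> w" unfolding T(2) using w T(3,4) by (simp add: maps_iff)
  qed
next
  assume z: "f \<approx> zer X Y"
  obtain P Q i p r where P: "P \<in> U" "Q \<in> U" and t: "triangle C P Q X i p r"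
    using D_presentation[OF X] .
  note m = triangle_maps[OF t]
  have "f \<bullet> p = zer Q Y" using U_eqD[OF z f P(2) m(2)] m f by (simp add: maps_iff)
  then obtain w where "\<guillemotleft>w : sh P \<rightarrow> Y\<guillemotright>" "w \<bullet> r = f" by (rule triangle_extend2[OF t f])
  then show "f \<in> factoring C R X Y"
    unfolding factoring_def using m(3) U_shift[OF P(1)] maps_arr by blast
qed

text \<open>The image of \<open>Hom(U, a)\<close> is represented by an object of \<open>D\<close>, even if \<open>X\<close> is not in \<open>D\<close>: approximate
  the fibre \<open>L\<close> of \<open>a\<close> by \<open>P\<close> in \<open>U\<close> and take the cone of \<open>P \<rightarrow> L \<rightarrow> Q\<close>.\<close>

lemma image_object:
  assumes Q: "Q \<in> U" and a: "\<guillemotleft>a : Q \<rightarrow> X\<guillemotright>"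
  obtains N k where "N \<in> D" "\<guillemotleft>k : N \<rightarrow> X\<guillemotright>" "U_mono k"
    "\<And>P u. P \<in> U \<Longrightarrow> \<guillemotleft>u : P \<rightarrow> X\<guillemotright> \<Longrightarrow> (\<exists>v. \<guillemotleft>v : P \<rightarrow> N\<guillemotright> \<and> k \<bullet> v = u) \<longleftrightarrow> (\<exists>v. \<guillemotleft>v : P \<rightarrow> Q\<guillemotright> \<and> a \<bullet> v = u)"
proof -
  have o: "X \<in> Obj C" "Q \<in> Obj C" using a maps_objD by blast+
  obtain V g h where "triangle C Q X V a g h" using triangle_exists[OF o(2,1) maps_arr[OF a]] by blast
  then obtain L l h' q where t: "triangle C L Q X l a h'" by (rule unrotate)
  note m = triangle_maps[OF t]
  obtain P b where P: "P \<in> U" and b: "\<guillemotleft>b : P \<rightarrow> L\<guillemotright>"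
    and app: "\<And>Q u. Q \<in> U \<Longrightarrow> \<guillemotleft>u : Q \<rightarrow> L\<guillemotright> \<Longrightarrow> \<exists>v. \<guillemotleft>v : Q \<rightarrow> P\<guillemotright> \<and> b \<bullet> v = u"
    using U_approximation[OF maps_objD(1)[OF m(1)]] by blast
  have lb: "\<guillemotleft>l \<bullet> b : P \<rightarrow> Q\<guillemotright>" using maps_comp[OF b m(1)] .
  obtain N p r where t': "triangle C P Q N (l \<bullet> b) p r"
    using triangle_exists[OF U_obj[OF P] o(2) maps_arr[OF lb]] by blast
  note m' = triangle_maps[OF t']
  have N: "N \<in> D" using D_I[OF t' P Q] .
  have "a \<bullet> (l \<bullet> b) = zer P X"
    using comp_eq_assoc[OF triangle_comp_zero1[OF t] m(1,2) b] b o by (simp add: maps_iff)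
  then obtain k where k: "\<guillemotleft>k : N \<rightarrow> X\<guillemotright>" "k \<bullet> p = a" by (rule triangle_extend[OF t' a])
  have "U_mono k"
  proof (rule U_monoI[OF k(1)])
    fix W u assume W: "W \<in> U" and u: "\<guillemotleft>u : W \<rightarrow> N\<guillemotright>" "k \<bullet> u = zer W X"
    obtain v where v: "\<guillemotleft>v : W \<rightarrow> Q\<guillemotright>" "p \<bullet> v = u" using presentation_epi[OF t' P W u(1)] by blast
    have "a \<bullet> v = zer W X" using comp_eq_assoc[OF k(2) m'(2) k(1) v(1)] v(2) u(2) by simp
    then obtain w where w: "\<guillemotleft>w : W \<rightarrow> L\<guillemotright>" "l \<bullet> w = v" using triangle_lift1[OF t v(1)] by blast
    obtain x where x: "\<guillemotleft>x : W \<rightarrow> P\<guillemotright>" "b \<bullet> x = w" using app[OF W w(1)] by blast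
    have "v = (l \<bullet> b) \<bullet> x" using w x b m(1) by (auto simp: maps_iff)
    then have "u = p \<bullet> ((l \<bullet> b) \<bullet> x)" using v by simp
    also have "\<dots> = zer W N"
      using comp_eq_assoc[OF triangle_comp_zero1[OF t'] m'(1,2) x(1)] x(1) maps_objD(2)[OF k(1)] u(1)
      by (simp add: maps_iff)
    finally show "u = zer W N" .
  qed
  moreover have "(\<exists>v. \<guillemotleft>v : W \<rightarrow> N\<guillemotright> \<and> k \<bullet> v = u) \<longleftrightarrow> (\<exists>v. \<guillemotleft>v : W \<rightarrow> Q\<guillemotright> \<and> a \<bullet> v = u)"
    if W: "W \<in> U" "\<guillemotleft>u : W \<rightarrow> X\<guillemotright>" for W u
  proof
    assume "\<exists>v. \<guillemotleft>v : W \<rightarrow> N\<guillemotright> \<and> k \<bullet> v = u"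
    then obtain v where v: "\<guillemotleft>v : W \<rightarrow> N\<guillemotright>" "k \<bullet> v = u" by blast
    obtain w where w: "\<guillemotleft>w : W \<rightarrow> Q\<guillemotright>" "p \<bullet> w = v" using presentation_epi[OF t' P W(1) v(1)] by blast
    have "a \<bullet> w = u" using comp_eq_assoc[OF k(2) m'(2) k(1) w(1)] w v by simp
    then show "\<exists>v. \<guillemotleft>v : W \<rightarrow> Q\<guillemotright> \<and> a \<bullet> v = u" using w by blast
  next
    assume "\<exists>v. \<guillemotleft>v : W \<rightarrow> Q\<guillemotright> \<and> a \<bullet> v = u"
    then obtain v where v: "\<guillemotleft>v : W \<rightarrow> Q\<guillemotright>" "a \<bullet> v = u" by blast
    have "k \<bullet> (p \<bullet> v) = u" using comp_eq_assoc[OF k(2) m'(2) k(1) v(1)] v by simp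
    then show "\<exists>v. \<guillemotleft>v : W \<rightarrow> N\<guillemotright> \<and> k \<bullet> v = u" using maps_comp[OF v(1) m'(2)] by blast
  qed
  ultimately show ?thesis using that[OF N k(1)] by blast
qed

text \<open>Lift the composite \<open>Q \<rightarrow> W \<rightarrow> Y\<close> from a presentation of \<open>W\<close>; the lift kills \<open>P\<close> since its image in \<open>Y\<close>
  does and \<open>k\<close> is a \<open>U\<close>-monomorphism, hence it extends to \<open>W\<close>.\<close>

lemma U_lift:
  assumes W: "W \<in> D" and k: "\<guillemotleft>k : X \<rightarrow> Y\<guillemotright>" "U_mono k" and h: "\<guillemotleft>h : W \<rightarrow> Y\<guillemotright>"
    and im: "\<And>P u. P \<in> U \<Longrightarrow> \<guillemotleft>u : P \<rightarrow> W\<guillemotright> \<Longrightarrow> \<exists>v. \<guillemotleft>v : P \<rightarrow> X\<guillemotright> \<and> k \<bullet> v = h \<bullet> u"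
  obtains w where "\<guillemotleft>w : W \<rightarrow> X\<guillemotright>" "k \<bullet> w \<approx> h"
proof -
  obtain P Q i p r where P: "P \<in> U" "Q \<in> U" and t: "triangle C P Q W i p r"
    using D_presentation[OF W] .
  note m = triangle_maps[OF t]
  obtain v where v: "\<guillemotleft>v : Q \<rightarrow> X\<guillemotright>" "k \<bullet> v = h \<bullet> p" using im[OF P(2) m(2)] by blast
  have "k \<bullet> (v \<bullet> i) = zer P Y"
    using comp_eq_assoc[OF v(2) v(1) k(1) m(1)] h m triangle_comp_zero1[OF t] by (simp add: maps_iff)
  then have "v \<bullet> i = zer P X" using U_monoD[OF k(2,1) P(1) maps_comp[OF m(1) v(1)]] by blast
  then obtain w where w: "\<guillemotleft>w : W \<rightarrow> X\<guillemotright>" "w \<bullet> p = v" using triangle_extend[OF t v(1)] by blast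
  have "k \<bullet> w \<approx> h"
  proof (rule U_eqI[OF maps_comp[OF w(1) k(1)]])
    fix V u assume V: "V \<in> U" "\<guillemotleft>u : V \<rightarrow> W\<guillemotright>"
    obtain x where x: "\<guillemotleft>x : V \<rightarrow> Q\<guillemotright>" "p \<bullet> x = u" using presentation_epi[OF t P(1) V] by blast
    have "(k \<bullet> w) \<bullet> u = k \<bullet> ((w \<bullet> p) \<bullet> x)" unfolding x(2)[symmetric] using x(1) m(2) w(1) k(1)
      by (simp add: maps_iff)
    also have "\<dots> = (h \<bullet> p) \<bullet> x" unfolding w(2) using comp_eq_assoc[OF v(2) v(1) k(1) x(1)] .
    also have "\<dots> = h \<bullet> u" unfolding x(2)[symmetric] using x(1) m(2) h by (simp add: maps_iff)
    finally show "(k \<bullet> w) \<bullet> u = h \<bullet> u" .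
  qed
  then show ?thesis using that w by blast
qed

text \<open>Here \<open>Z\<close> is presented, and the cover \<open>Q \<rightarrow> Z\<close> is lifted to \<open>Y\<close> before \<open>h\<close> is applied.\<close>

lemma U_descend:
  assumes Z: "Z \<in> D" and f: "\<guillemotleft>f : Y \<rightarrow> Z\<guillemotright>" "U_epi f" and h: "\<guillemotleft>h : Y \<rightarrow> W\<guillemotright>"
    and ker: "\<And>P u. P \<in> U \<Longrightarrow> \<guillemotleft>u : P \<rightarrow> Y\<guillemotright> \<Longrightarrow> f \<bullet> u = zer P Z \<Longrightarrow> h \<bullet> u = zer P W"
  obtains w where "\<guillemotleft>w : Z \<rightarrow> W\<guillemotright>" "w \<bullet> f \<approx> h"
proof -
  obtain P Q i p r where P: "P \<in> U" "Q \<in> U" and t: "triangle C P Q Z i p r"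
    using D_presentation[OF Z] .
  note m = triangle_maps[OF t]
  obtain v where v: "\<guillemotleft>v : Q \<rightarrow> Y\<guillemotright>" "f \<bullet> v = p" using U_epiD[OF f(2,1) P(2) m(2)] .
  have "f \<bullet> (v \<bullet> i) = zer P Z"
    using comp_eq_assoc[OF v(2) v(1) f(1) m(1)] triangle_comp_zero1[OF t] by simp
  then have "h \<bullet> (v \<bullet> i) = zer P W" using ker[OF P(1) maps_comp[OF m(1) v(1)]] by blast
  then have "(h \<bullet> v) \<bullet> i = zer P W" using m(1) v(1) h by (simp add: maps_iff)
  then obtain w where w: "\<guillemotleft>w : Z \<rightarrow> W\<guillemotright>" "w \<bullet> p = h \<bullet> v"
    using triangle_extend[OF t maps_comp[OF v(1) h]] by blast
  have "w \<bullet> f \<approx> h"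
  proof (rule U_eqI[OF maps_comp[OF f(1) w(1)]])
    fix V u assume V: "V \<in> U" "\<guillemotleft>u : V \<rightarrow> Y\<guillemotright>"
    obtain x where x: "\<guillemotleft>x : V \<rightarrow> Q\<guillemotright>" "p \<bullet> x = f \<bullet> u"
      using presentation_epi[OF t P(1) V(1) maps_comp[OF V(2) f(1)]] by blast
    have vx: "\<guillemotleft>v \<bullet> x : V \<rightarrow> Y\<guillemotright>" using maps_comp[OF x(1) v(1)] .
    have "f \<bullet> u = f \<bullet> (v \<bullet> x)" using comp_eq_assoc[OF v(2) v(1) f(1) x(1)] x(2) by simp
    then have "f \<bullet> (u \<ominus>\<^bsub>Hom C V Y\<^esub> (v \<bullet> x)) = zer V Z"
      using comp_minus_zero_iff(1)[of u "v \<bullet> x" f V Y] V vx f(1) by (simp add: maps_iff)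
    moreover have "\<guillemotleft>u \<ominus>\<^bsub>Hom C V Y\<^esub> (v \<bullet> x) : V \<rightarrow> Y\<guillemotright>" using V vx by (simp add: maps_iff)
    ultimately have "h \<bullet> (u \<ominus>\<^bsub>Hom C V Y\<^esub> (v \<bullet> x)) = zer V W" using ker[OF V(1)] by blast
    then have "h \<bullet> u = h \<bullet> (v \<bullet> x)"
      using comp_minus_zero_iff(1)[of u "v \<bullet> x" h V Y] V vx h by (simp add: maps_iff)
    also have "\<dots> = (w \<bullet> p) \<bullet> x" unfolding w(2) using h v(1) x(1) by (simp add: maps_iff)
    also have "\<dots> = (w \<bullet> f) \<bullet> u" using w(1) m(2) x f(1) V(2) by (simp add: maps_iff)
    finally show "(w \<bullet> f) \<bullet> u = h \<bullet> u" by simp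
  qed
  then show ?thesis using that w by blast
qed

text \<open>The fibre of \<open>f\<close> has the right image in \<open>Hom(U, Y)\<close>, but it need neither lie in \<open>D\<close> nor inject, so
  the image object of its approximation is taken instead.\<close>

lemma kernel_candidate:
  assumes f: "\<guillemotleft>f : Y \<rightarrow> Z\<guillemotright>"
  obtains N k where "N \<in> D" "\<guillemotleft>k : N \<rightarrow> Y\<guillemotright>" "U_mono k" "U_exact k f"
proof -
  have o: "Y \<in> Obj C" "Z \<in> Obj C" using f maps_objD by blast+
  obtain V g h where "triangle C Y Z V f g h" using triangle_exists[OF o maps_arr[OF f]] by blast
  then obtain L l h' q where t: "triangle C L Y Z l f h'" by (rule unrotate)
  note m = triangle_maps[OF t]
  obtain Q b where Q: "Q \<in> U" and b: "\<guillemotleft>b : Q \<rightarrow> L\<guillemotright>"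
    and app: "\<And>Q' u. Q' \<in> U \<Longrightarrow> \<guillemotleft>u : Q' \<rightarrow> L\<guillemotright> \<Longrightarrow> \<exists>v. \<guillemotleft>v : Q' \<rightarrow> Q\<guillemotright> \<and> b \<bullet> v = u"
    using U_approximation[OF maps_objD(1)[OF m(1)]] by blast
  have lb: "\<guillemotleft>l \<bullet> b : Q \<rightarrow> Y\<guillemotright>" using maps_comp[OF b m(1)] .
  obtain N k where N: "N \<in> D" "\<guillemotleft>k : N \<rightarrow> Y\<guillemotright>" "U_mono k" and
    im: "\<And>P u. P \<in> U \<Longrightarrow> \<guillemotleft>u : P \<rightarrow> Y\<guillemotright> \<Longrightarrow> (\<exists>v. \<guillemotleft>v : P \<rightarrow> N\<guillemotright> \<and> k \<bullet> v = u) \<longleftrightarrow> (\<exists>v. \<guillemotleft>v : P \<rightarrow> Q\<guillemotright> \<and> (l \<bullet> b) \<bullet> v = u)"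
    using image_object[OF Q lb] by blast
  have "U_exact k f"
  proof (rule U_exactI[OF N(2) f])
    fix P u assume u: "P \<in> U" "\<guillemotleft>u : P \<rightarrow> Y\<guillemotright>" "f \<bullet> u = zer P Z"
    obtain w where w: "\<guillemotleft>w : P \<rightarrow> L\<guillemotright>" "l \<bullet> w = u" using triangle_lift1[OF t u(2,3)] .
    obtain x where x: "\<guillemotleft>x : P \<rightarrow> Q\<guillemotright>" "b \<bullet> x = w" using app[OF u(1) w(1)] by blast
    have "(l \<bullet> b) \<bullet> x = u" using x w b m(1) by (auto simp: maps_iff)
    then show "\<exists>v. \<guillemotleft>v : P \<rightarrow> N\<guillemotright> \<and> k \<bullet> v = u" using im[OF u(1,2)] x(1) by blast
  next
    fix P v assume v: "P \<in> U" "\<guillemotleft>v : P \<rightarrow> N\<guillemotright>"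
    obtain w where w: "\<guillemotleft>w : P \<rightarrow> Q\<guillemotright>" "(l \<bullet> b) \<bullet> w = k \<bullet> v"
      using im[OF v(1) maps_comp[OF v(2) N(2)]] v(2) by blast
    have "f \<bullet> (l \<bullet> (b \<bullet> w)) = zer P Z"
      using comp_eq_assoc[OF triangle_comp_zero1[OF t] m(1,2) maps_comp[OF w(1) b]] b w(1) o
      by (simp add: maps_iff)
    moreover have "l \<bullet> (b \<bullet> w) = k \<bullet> v" using w b m(1) by (simp add: maps_iff)
    ultimately show "f \<bullet> (k \<bullet> v) = zer P Z" by simp
  qed
  then show ?thesis using that N by blast
qed

text \<open>With presentations \<open>P' \<rightarrow> Q \<rightarrow> X\<close> and \<open>P \<rightarrow> P0 \<rightarrow> Y\<close>, the cokernel of \<open>Hom(U, f)\<close> is presented by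
  the direct sum of \<open>P\<close> and \<open>Q\<close> mapping to \<open>P0\<close>: the relations of \<open>Y\<close> together with the image of \<open>f\<close>.\<close>

lemma cokernel_candidate:
  assumes X: "X \<in> D" and Y: "Y \<in> D" and f: "\<guillemotleft>f : X \<rightarrow> Y\<guillemotright>"
  obtains N c where "N \<in> D" "\<guillemotleft>c : Y \<rightarrow> N\<guillemotright>" "U_epi c" "U_exact f c"
proof -
  obtain P' Q i' q r' where Q: "P' \<in> U" "Q \<in> U" and tX: "triangle C P' Q X i' q r'"
    using D_presentation[OF X] .
  obtain P P0 i p r where P: "P \<in> U" "P0 \<in> U" and tY: "triangle C P P0 Y i p r"
    using D_presentation[OF Y] .
  note mX = triangle_maps[OF tX] note mY = triangle_maps[OF tY]
  obtain s where s: "\<guillemotleft>s : Q \<rightarrow> P0\<guillemotright>" "p \<bullet> s = f \<bullet> q"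
    using presentation_epi[OF tY P(1) Q(2) maps_comp[OF mX(2) f]] by blast
  obtain S where S: "is_direct_sum C S [P, Q]" using direct_sum_exists[of P Q] P Q by auto
  have SU: "S \<in> U" using U_sum[OF P(1) Q(2) S] .
  obtain j1 j2 p1 p2 where m: "\<guillemotleft>j1 : P \<rightarrow> S\<guillemotright>" "\<guillemotleft>j2 : Q \<rightarrow> S\<guillemotright>" "\<guillemotleft>p1 : S \<rightarrow> P\<guillemotright>" "\<guillemotleft>p2 : S \<rightarrow> Q\<guillemotright>"
    and e: "p1 \<bullet> j1 = Id C P" "p2 \<bullet> j2 = Id C Q" "p1 \<bullet> j2 = zer Q P" "p2 \<bullet> j1 = zer P Q"
    using S unfolding direct_sum_two_iff by blast
  \<comment> \<open>the relations \<open>i\<close> of \<open>Y\<close> on \<open>P\<close>, and a lift \<open>s\<close> of \<open>f\<close> on \<open>Q\<close>\<close>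
  let ?j = "(i \<bullet> p1) \<oplus>\<^bsub>Hom C S P0\<^esub> (s \<bullet> p2)"
  have j: "\<guillemotleft>?j : S \<rightarrow> P0\<guillemotright>" using m s mY by (simp add: maps_iff)
  have j1: "?j \<bullet> j1 = i" and j2: "?j \<bullet> j2 = s"
    using m s(1) mY(1) e by (simp_all add: maps_iff)
  obtain N n r2 where tN: "triangle C S P0 N ?j n r2"
    using triangle_exists[OF _ _ maps_arr[OF j]] SU P by auto
  note mN = triangle_maps[OF tN]
  have N: "N \<in> D" using D_I[OF tN SU P(2)] .
  have nj: "n \<bullet> ?j = zer S N" using triangle_comp_zero1[OF tN] .
  have "n \<bullet> i = zer P N" "n \<bullet> s = zer Q N"
    using comp_eq_assoc[OF nj mN(1,2) m(1)] comp_eq_assoc[OF nj mN(1,2) m(2)] j1 j2 m N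
    by (simp_all add: maps_iff)
  note n0 = this
  obtain c where c: "\<guillemotleft>c : Y \<rightarrow> N\<guillemotright>" "c \<bullet> p = n" using triangle_extend[OF tY mN(2) n0(1)] .
  have "U_epi c"
  proof (rule U_epiI[OF c(1)])
    fix W u assume u: "W \<in> U" "\<guillemotleft>u : W \<rightarrow> N\<guillemotright>"
    obtain v where v: "\<guillemotleft>v : W \<rightarrow> P0\<guillemotright>" "n \<bullet> v = u" using presentation_epi[OF tN SU u] by blast
    have "c \<bullet> (p \<bullet> v) = u" using comp_eq_assoc[OF c(2) mY(2) c(1) v(1)] v(2) by simp
    then show "\<exists>v. \<guillemotleft>v : W \<rightarrow> Y\<guillemotright> \<and> c \<bullet> v = u" using maps_comp[OF v(1) mY(2)] by blast
  qed
  moreover have "U_exact f c"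
  proof (rule U_exactI[OF f c(1)])
    fix W u assume u: "W \<in> U" "\<guillemotleft>u : W \<rightarrow> Y\<guillemotright>" "c \<bullet> u = zer W N"
    obtain v where v: "\<guillemotleft>v : W \<rightarrow> P0\<guillemotright>" "p \<bullet> v = u" using presentation_epi[OF tY P(1) u(1,2)] by blast
    have "n \<bullet> v = zer W N" using comp_eq_assoc[OF c(2) mY(2) c(1) v(1)] v(2) u(3) by simp
    then obtain w where w: "\<guillemotleft>w : W \<rightarrow> S\<guillemotright>" "?j \<bullet> w = v" using triangle_lift1[OF tN v(1)] by blast
    have "p \<bullet> (i \<bullet> (p1 \<bullet> w)) = zer W Y"
      using comp_eq_assoc[OF triangle_comp_zero1[OF tY] mY(1,2) maps_comp[OF w(1) m(3)]] w(1) m(3) Y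
      by (simp add: maps_iff)
    moreover have "p \<bullet> (s \<bullet> (p2 \<bullet> w)) = f \<bullet> (q \<bullet> (p2 \<bullet> w))"
      using comp_eq_assoc[OF s(2) s(1) mY(2) maps_comp[OF w(1) m(4)]] w(1) m(4) f mX(2)
      by (simp add: maps_iff)
    ultimately have "f \<bullet> (q \<bullet> (p2 \<bullet> w)) = p \<bullet> (?j \<bullet> w)"
      using w(1) m(3,4) s(1) mY(1,2) f mX(2) by (simp add: maps_iff)
    then have "f \<bullet> (q \<bullet> (p2 \<bullet> w)) = u" using w(2) v(2) by simp
    then show "\<exists>v. \<guillemotleft>v : W \<rightarrow> X\<guillemotright> \<and> f \<bullet> v = u"
      using maps_comp[OF maps_comp[OF w(1) m(4)] mX(2)] by blast
  next
    fix W v assume v: "W \<in> U" "\<guillemotleft>v : W \<rightarrow> X\<guillemotright>"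
    obtain x where x: "\<guillemotleft>x : W \<rightarrow> Q\<guillemotright>" "q \<bullet> x = v" using presentation_epi[OF tX Q(1) v] by blast
    have "f \<bullet> v = p \<bullet> (s \<bullet> x)"
      using comp_eq_assoc[OF s(2) s(1) mY(2) x(1)] x mX(2) f by (simp add: maps_iff)
    then have "c \<bullet> (f \<bullet> v) = n \<bullet> (s \<bullet> x)"
      using comp_eq_assoc[OF c(2) mY(2) c(1) maps_comp[OF x(1) s(1)]] by simp
    also have "\<dots> = zer W N" using comp_eq_assoc[OF n0(2) s(1) mN(2) x(1)] x(1) N by (simp add: maps_iff)
    finally show "c \<bullet> (f \<bullet> v) = zer W N" .
  qed
  ultimately show ?thesis using that N c by blast
qed

end

section \<open>The quotient is abelian with enough projective objects\<close>

context rigid_subcategory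
begin

abbreviation cls :: "'m \<Rightarrow> 'm set" where "cls f \<equiv> residue C R f"
abbreviation A :: "('k, 'o, 'm set) lin_cat" where "A \<equiv> quotient_category C D R"

text \<open>On morphisms from an object of \<open>D\<close> the congruence modulo \<open>R\<close> is equality after \<open>Hom(U, -)\<close>. All
  computations in the quotient use this description only.\<close>

lemma residue_eq:
  assumes X: "X \<in> D" and f: "\<guillemotleft>f : X \<rightarrow> Y\<guillemotright>"
  shows "cls f = {f'. \<guillemotleft>f' : X \<rightarrow> Y\<guillemotright> \<and> f' \<approx> f}"
proof -
  have *: "f' \<ominus>\<^bsub>Hom C X Y\<^esub> f \<in> factoring C R X Y \<longleftrightarrow> f' \<approx> f" if f': "\<guillemotleft>f' : X \<rightarrow> Y\<guillemotright>" for f'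
  proof -
    have d: "\<guillemotleft>f' \<ominus>\<^bsub>Hom C X Y\<^esub> f : X \<rightarrow> Y\<guillemotright>" using f f' by (simp add: maps_iff)
    have "(f' \<ominus>\<^bsub>Hom C X Y\<^esub> f) \<bullet> u = zer X Y \<bullet> u \<longleftrightarrow> f' \<bullet> u = f \<bullet> u" if "\<guillemotleft>u : P \<rightarrow> X\<guillemotright>" for P u
      using that comp_minus_zero_iff(2)[of f' f u X Y] f f' by (simp add: maps_iff)
    then have "f' \<ominus>\<^bsub>Hom C X Y\<^esub> f \<approx> zer X Y \<longleftrightarrow> f' \<approx> f"
      unfolding U_eq_def src_tgt(1)[OF d] src_tgt(1)[OF f'] by blast
    then show ?thesis using factoring_iff[OF X d] by simp
  qed
  show ?thesis
  proof (intro Set.set_eqI iffI)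
    fix f' assume "f' \<in> cls f"
    then obtain X' Y' where f': "X' \<in> Obj C" "Y' \<in> Obj C" "f \<in> arr C X' Y'" "f' \<in> arr C X' Y'"
      "f' \<ominus>\<^bsub>Hom C X' Y'\<^esub> f \<in> factoring C R X' Y'" unfolding residue_def by blast
    then have "\<guillemotleft>f : X' \<rightarrow> Y'\<guillemotright>" by (simp add: maps_def)
    then have "X' = X" "Y' = Y" using maps_unique[OF f] by auto
    then show "f' \<in> {f'. \<guillemotleft>f' : X \<rightarrow> Y\<guillemotright> \<and> f' \<approx> f}" using f' * by (simp add: maps_def)
  next
    fix f' assume "f' \<in> {f'. \<guillemotleft>f' : X \<rightarrow> Y\<guillemotright> \<and> f' \<approx> f}"
    then have "\<guillemotleft>f' : X \<rightarrow> Y\<guillemotright>" "f' \<ominus>\<^bsub>Hom C X Y\<^esub> f \<in> factoring C R X Y" using * by auto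
    then show "f' \<in> cls f"
      unfolding residue_def using f maps_arr[OF f] maps_objD[OF f] maps_arr by blast
  qed
qed

lemma U_eq_refl: "f \<approx> f"
  unfolding U_eq_def by simp

lemma U_eq_sym:
  assumes "f \<approx> g" "\<guillemotleft>f : X \<rightarrow> Y\<guillemotright>" "\<guillemotleft>g : X \<rightarrow> Y\<guillemotright>" shows "g \<approx> f"
  using assms(1) src_tgt(1)[OF assms(2)] src_tgt(1)[OF assms(3)] unfolding U_eq_def by simp

lemma U_eq_trans:
  assumes "f \<approx> g" "g \<approx> h" "\<guillemotleft>f : X \<rightarrow> Y\<guillemotright>" "\<guillemotleft>g : X \<rightarrow> Y\<guillemotright>" shows "f \<approx> h"
  using assms(1,2) src_tgt(1)[OF assms(3)] src_tgt(1)[OF assms(4)] unfolding U_eq_def by simp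

lemma cls_eq_iff:
  assumes X: "X \<in> D" and f: "\<guillemotleft>f : X \<rightarrow> Y\<guillemotright>" and g: "\<guillemotleft>g : X \<rightarrow> Y\<guillemotright>"
  shows "cls f = cls g \<longleftrightarrow> f \<approx> g"
proof
  assume "cls f = cls g"
  then have "f \<in> cls g" using residue_eq[OF X f] f U_eq_refl by blast
  then show "f \<approx> g" using residue_eq[OF X g] by simp
next
  assume fg: "f \<approx> g"
  have "f' \<approx> f \<longleftrightarrow> f' \<approx> g" if "\<guillemotleft>f' : X \<rightarrow> Y\<guillemotright>" for f'
    using U_eq_trans[OF _ fg that f] U_eq_trans[OF _ U_eq_sym[OF fg f g] that g] by blast
  then show "cls f = cls g" unfolding residue_eq[OF X f] residue_eq[OF X g] by auto
qed

lemma cls_memD: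
  assumes "X \<in> D" "\<guillemotleft>f : X \<rightarrow> Y\<guillemotright>" "f' \<in> cls f"
  shows "\<guillemotleft>f' : X \<rightarrow> Y\<guillemotright>" "f' \<approx> f"
  using assms residue_eq by auto

lemma cls_self: "X \<in> D \<Longrightarrow> \<guillemotleft>f : X \<rightarrow> Y\<guillemotright> \<Longrightarrow> f \<in> cls f"
  using residue_eq U_eq_refl by auto

lemma UN_cls_const:
  assumes "X \<in> D" "\<guillemotleft>f : X \<rightarrow> Y\<guillemotright>" "\<And>f'. \<guillemotleft>f' : X \<rightarrow> Y\<guillemotright> \<Longrightarrow> f' \<approx> f \<Longrightarrow> \<phi> f' = S"
  shows "(\<Union>f'\<in>cls f. \<phi> f') = S"
  using cls_self[OF assms(1,2)] cls_memD[OF assms(1,2)] assms(3) by blast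

lemma A_Obj [simp]: "Obj A = D"
  by (simp add: quotient_category_def)

lemma A_Id [simp]: "Id A X = cls (Id C X)"
  by (simp add: quotient_category_def)

lemma A_zero [simp]: "\<zero>\<^bsub>Hom A X Y\<^esub> = cls (zer X Y)"
  by (simp add: quotient_category_def)

lemma A_arr: "arr A X Y = cls ` arr C X Y"
  by (simp add: quotient_category_def)

lemma A_arrI: "\<guillemotleft>f : X \<rightarrow> Y\<guillemotright> \<Longrightarrow> cls f \<in> arr A X Y"
  unfolding A_arr using maps_arr by blast

lemma A_arrE:
  assumes "F \<in> arr A X Y" "X \<in> Obj C" "Y \<in> Obj C"
  obtains f where "\<guillemotleft>f : X \<rightarrow> Y\<guillemotright>" "F = cls f"
  using assms unfolding A_arr maps_def by blast

lemma A_comp: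
  assumes X: "X \<in> D" and Y: "Y \<in> D" and f: "\<guillemotleft>f : X \<rightarrow> Y\<guillemotright>" and g: "\<guillemotleft>g : Y \<rightarrow> Z\<guillemotright>"
  shows "cls g \<cdot>\<^bsub>A\<^esub> cls f = cls (g \<bullet> f)"
proof -
  have "cls g \<cdot>\<^bsub>A\<^esub> cls f = (\<Union>g'\<in>cls g. \<Union>f'\<in>cls f. cls (g' \<bullet> f'))"
    by (simp add: quotient_category_def)
  also have "\<dots> = cls (g \<bullet> f)"
  proof (rule UN_cls_const[OF Y g], rule UN_cls_const[OF X f])
    fix g' f' assume g': "\<guillemotleft>g' : Y \<rightarrow> Z\<guillemotright>" "g' \<approx> g" and f': "\<guillemotleft>f' : X \<rightarrow> Y\<guillemotright>" "f' \<approx> f"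
    have "g' \<bullet> f' \<approx> g \<bullet> f"
    proof (rule U_eqI[OF maps_comp[OF f'(1) g'(1)]])
      fix P u assume u: "P \<in> U" "\<guillemotleft>u : P \<rightarrow> X\<guillemotright>"
      have "(g' \<bullet> f') \<bullet> u = g' \<bullet> (f \<bullet> u)"
        using U_eqD[OF f'(2,1) u] g'(1) f'(1) u(2) by (simp add: maps_iff)
      also have "\<dots> = g \<bullet> (f \<bullet> u)" using U_eqD[OF g'(2,1) u(1) maps_comp[OF u(2) f]] .
      finally show "(g' \<bullet> f') \<bullet> u = (g \<bullet> f) \<bullet> u" using f g u(2) by (simp add: maps_iff)
    qed
    then show "cls (g' \<bullet> f') = cls (g \<bullet> f)"
      using cls_eq_iff[OF X maps_comp[OF f'(1) g'(1)] maps_comp[OF f g]] by blast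
  qed
  finally show ?thesis .
qed

lemma A_add:
  assumes X: "X \<in> D" and f: "\<guillemotleft>f : X \<rightarrow> Y\<guillemotright>" and g: "\<guillemotleft>g : X \<rightarrow> Y\<guillemotright>"
  shows "cls f \<oplus>\<^bsub>Hom A X Y\<^esub> cls g = cls (f \<oplus>\<^bsub>Hom C X Y\<^esub> g)"
proof -
  have "cls f \<oplus>\<^bsub>Hom A X Y\<^esub> cls g = (\<Union>f'\<in>cls f. \<Union>g'\<in>cls g. cls (f' \<oplus>\<^bsub>Hom C X Y\<^esub> g'))"
    by (simp add: quotient_category_def)
  also have "\<dots> = cls (f \<oplus>\<^bsub>Hom C X Y\<^esub> g)"
  proof (rule UN_cls_const[OF X f], rule UN_cls_const[OF X g])
    fix f' g' assume f': "\<guillemotleft>f' : X \<rightarrow> Y\<guillemotright>" "f' \<approx> f" and g': "\<guillemotleft>g' : X \<rightarrow> Y\<guillemotright>" "g' \<approx> g"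
    have m: "\<guillemotleft>f' \<oplus>\<^bsub>Hom C X Y\<^esub> g' : X \<rightarrow> Y\<guillemotright>" "\<guillemotleft>f \<oplus>\<^bsub>Hom C X Y\<^esub> g : X \<rightarrow> Y\<guillemotright>"
      using f g f' g' by (simp_all add: maps_iff)
    have "f' \<oplus>\<^bsub>Hom C X Y\<^esub> g' \<approx> f \<oplus>\<^bsub>Hom C X Y\<^esub> g"
    proof (rule U_eqI[OF m(1)])
      fix P u assume u: "P \<in> U" "\<guillemotleft>u : P \<rightarrow> X\<guillemotright>"
      show "(f' \<oplus>\<^bsub>Hom C X Y\<^esub> g') \<bullet> u = (f \<oplus>\<^bsub>Hom C X Y\<^esub> g) \<bullet> u"
        using U_eqD[OF f'(2,1) u] U_eqD[OF g'(2,1) u] f g f'(1) g'(1) u(2) by (simp add: maps_iff)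
    qed
    then show "cls (f' \<oplus>\<^bsub>Hom C X Y\<^esub> g') = cls (f \<oplus>\<^bsub>Hom C X Y\<^esub> g)"
      using cls_eq_iff[OF X m] by blast
  qed
  finally show ?thesis .
qed

lemma A_smult:
  assumes X: "X \<in> D" and f: "\<guillemotleft>f : X \<rightarrow> Y\<guillemotright>" and a: "a \<in> carrier K"
  shows "a \<odot>\<^bsub>Hom A X Y\<^esub> cls f = cls (a \<odot>\<^bsub>Hom C X Y\<^esub> f)"
proof -
  have "a \<odot>\<^bsub>Hom A X Y\<^esub> cls f = (\<Union>f'\<in>cls f. cls (a \<odot>\<^bsub>Hom C X Y\<^esub> f'))"
    by (simp add: quotient_category_def)
  also have "\<dots> = cls (a \<odot>\<^bsub>Hom C X Y\<^esub> f)"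
  proof (rule UN_cls_const[OF X f])
    fix f' assume f': "\<guillemotleft>f' : X \<rightarrow> Y\<guillemotright>" "f' \<approx> f"
    have m: "\<guillemotleft>a \<odot>\<^bsub>Hom C X Y\<^esub> f' : X \<rightarrow> Y\<guillemotright>" "\<guillemotleft>a \<odot>\<^bsub>Hom C X Y\<^esub> f : X \<rightarrow> Y\<guillemotright>"
      using f f' a by (simp_all add: maps_iff)
    have "a \<odot>\<^bsub>Hom C X Y\<^esub> f' \<approx> a \<odot>\<^bsub>Hom C X Y\<^esub> f"
    proof (rule U_eqI[OF m(1)])
      fix P u assume u: "P \<in> U" "\<guillemotleft>u : P \<rightarrow> X\<guillemotright>"
      show "(a \<odot>\<^bsub>Hom C X Y\<^esub> f') \<bullet> u = (a \<odot>\<^bsub>Hom C X Y\<^esub> f) \<bullet> u"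
        using U_eqD[OF f'(2,1) u] f f'(1) u(2) a by (simp add: maps_iff)
    qed
    then show "cls (a \<odot>\<^bsub>Hom C X Y\<^esub> f') = cls (a \<odot>\<^bsub>Hom C X Y\<^esub> f)"
      using cls_eq_iff[OF X m] by blast
  qed
  finally show ?thesis .
qed

lemma A_hom_module:
  assumes X: "X \<in> D" and Y: "Y \<in> D" shows "module K (Hom A X Y)"
proof -
  let ?H = "Hom A X Y"
  have o: "X \<in> Obj C" "Y \<in> Obj C" using X Y by auto
  interpret H: module K "Hom C X Y" using hom_module o by blast
  have E: "\<exists>f. f \<in> arr C X Y \<and> F = cls f" if "F \<in> carrier ?H" for F using that unfolding A_arr by blast
  have I: "f \<in> arr C X Y \<Longrightarrow> cls f \<in> carrier ?H" for f unfolding A_arr by blast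
  have add: "cls f \<oplus>\<^bsub>?H\<^esub> cls g = cls (f \<oplus>\<^bsub>Hom C X Y\<^esub> g)" if "f \<in> arr C X Y" "g \<in> arr C X Y" for f g
    using A_add[OF X] that o by (simp add: maps_def)
  have smult: "a \<odot>\<^bsub>?H\<^esub> cls f = cls (a \<odot>\<^bsub>Hom C X Y\<^esub> f)" if "f \<in> arr C X Y" "a \<in> carrier K" for f a
    using A_smult[OF X] that o by (simp add: maps_def)
  have ab: "abelian_group ?H"
  proof (rule abelian_groupI)
    fix F assume "F \<in> carrier ?H"
    then obtain f where m: "f \<in> arr C X Y" and F: "F = cls f" using E by blast
    show "\<zero>\<^bsub>?H\<^esub> \<oplus>\<^bsub>?H\<^esub> F = F" unfolding F using m add by simp
    have "cls (\<ominus>\<^bsub>Hom C X Y\<^esub> f) \<oplus>\<^bsub>?H\<^esub> cls f = \<zero>\<^bsub>?H\<^esub>" using m add H.l_neg by simp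
    then show "\<exists>G\<in>carrier ?H. G \<oplus>\<^bsub>?H\<^esub> F = \<zero>\<^bsub>?H\<^esub>"
      unfolding F using m I H.a_inv_closed by blast
    fix G assume "G \<in> carrier ?H"
    then obtain g where n: "g \<in> arr C X Y" and G: "G = cls g" using E by blast
    show "F \<oplus>\<^bsub>?H\<^esub> G \<in> carrier ?H" unfolding F G using m n I add by simp
    show "F \<oplus>\<^bsub>?H\<^esub> G = G \<oplus>\<^bsub>?H\<^esub> F" unfolding F G using m n add H.a_comm by simp
    fix L assume "L \<in> carrier ?H"
    then obtain l where l: "l \<in> arr C X Y" and L: "L = cls l" using E by blast
    show "(F \<oplus>\<^bsub>?H\<^esub> G) \<oplus>\<^bsub>?H\<^esub> L = F \<oplus>\<^bsub>?H\<^esub> (G \<oplus>\<^bsub>?H\<^esub> L)"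
      unfolding F G L using m n l add H.a_assoc by simp
  next
    show "\<zero>\<^bsub>?H\<^esub> \<in> carrier ?H" using I by simp
  qed
  show ?thesis
  proof (rule moduleI[OF is_cring ab])
    fix F assume "F \<in> carrier ?H"
    then obtain f where m: "f \<in> arr C X Y" and F: "F = cls f" using E by blast
    show "\<one> \<odot>\<^bsub>?H\<^esub> F = F" unfolding F using m smult by simp
    fix a assume a: "a \<in> carrier K"
    show "a \<odot>\<^bsub>?H\<^esub> F \<in> carrier ?H" unfolding F using m a smult I by simp
    show "a \<odot>\<^bsub>?H\<^esub> (F \<oplus>\<^bsub>?H\<^esub> G) = a \<odot>\<^bsub>?H\<^esub> F \<oplus>\<^bsub>?H\<^esub> a \<odot>\<^bsub>?H\<^esub> G"
      if "G \<in> carrier ?H" for G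
    proof -
      obtain g where "g \<in> arr C X Y" and G: "G = cls g" using E \<open>G \<in> carrier ?H\<close> by blast
      then show ?thesis unfolding F G using m a smult add H.smult_r_distr by simp
    qed
    fix b assume b: "b \<in> carrier K"
    show "(a \<oplus> b) \<odot>\<^bsub>?H\<^esub> F = a \<odot>\<^bsub>?H\<^esub> F \<oplus>\<^bsub>?H\<^esub> b \<odot>\<^bsub>?H\<^esub> F"
      unfolding F using m a b smult add H.smult_l_distr by simp
    show "(a \<otimes> b) \<odot>\<^bsub>?H\<^esub> F = a \<odot>\<^bsub>?H\<^esub> (b \<odot>\<^bsub>?H\<^esub> F)"
      unfolding F using m a b smult H.smult_assoc1 by simp
  qed
qed

lemma A_linear_category: "linear_category K A"
proof (intro linear_category.intro linear_category_axioms.intro, unfold A_Obj)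
  show "field K" by (rule field_axioms)
next
  fix X Y assume "X \<in> D" "Y \<in> D"
  then show "module K (Hom A X Y)" using A_hom_module by simp
next
  fix X Y X' Y' F assume D: "X \<in> D" "Y \<in> D" "X' \<in> D" "Y' \<in> D" and o: "F \<in> arr A X Y" "F \<in> arr A X' Y'"
  obtain f where f: "\<guillemotleft>f : X \<rightarrow> Y\<guillemotright>" "F = cls f" using A_arrE[OF o(1)] D by auto
  obtain f' where f': "\<guillemotleft>f' : X' \<rightarrow> Y'\<guillemotright>" "F = cls f'" using A_arrE[OF o(2)] D by auto
  have "f \<in> cls f'" using cls_self[OF D(1) f(1)] f f' by simp
  then show "X = X' \<and> Y = Y'" using cls_memD(1)[OF D(3) f'(1)] maps_unique[OF f(1)] by blast
next
  fix X assume "X \<in> D"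
  then show "Id A X \<in> arr A X X" using A_arrI[OF maps_Id] by simp
next
  fix X Y F assume D: "X \<in> D" "Y \<in> D" and o: "F \<in> arr A X Y"
  obtain f where f: "\<guillemotleft>f : X \<rightarrow> Y\<guillemotright>" "F = cls f" using A_arrE[OF o(1)] D by auto
  show "F \<cdot>\<^bsub>A\<^esub> Id A X = F" using A_comp[OF D(1,1) maps_Id f(1)] f D by (simp add: maps_iff)
  show "Id A Y \<cdot>\<^bsub>A\<^esub> F = F" using A_comp[OF D f(1) maps_Id] f D by (simp add: maps_iff)
next
  fix X Y Z F G assume D: "X \<in> D" "Y \<in> D" "Z \<in> D" and o: "F \<in> arr A X Y" "G \<in> arr A Y Z"
  obtain f where f: "\<guillemotleft>f : X \<rightarrow> Y\<guillemotright>" "F = cls f" using A_arrE[OF o(1)] D by auto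
  obtain g where g: "\<guillemotleft>g : Y \<rightarrow> Z\<guillemotright>" "G = cls g" using A_arrE[OF o(2)] D by auto
  show "G \<cdot>\<^bsub>A\<^esub> F \<in> arr A X Z"
    unfolding f(2) g(2) A_comp[OF D(1,2) f(1) g(1)] by (rule A_arrI[OF maps_comp[OF f(1) g(1)]])
next
  fix W X Y Z F G H
  assume D: "W \<in> D" "X \<in> D" "Y \<in> D" "Z \<in> D" and o: "F \<in> arr A W X" "G \<in> arr A X Y" "H \<in> arr A Y Z"
  obtain f where f: "\<guillemotleft>f : W \<rightarrow> X\<guillemotright>" "F = cls f" using A_arrE[OF o(1)] D by auto
  obtain g where g: "\<guillemotleft>g : X \<rightarrow> Y\<guillemotright>" "G = cls g" using A_arrE[OF o(2)] D by auto
  obtain h where h: "\<guillemotleft>h : Y \<rightarrow> Z\<guillemotright>" "H = cls h" using A_arrE[OF o(3)] D by auto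
  show "(H \<cdot>\<^bsub>A\<^esub> G) \<cdot>\<^bsub>A\<^esub> F = H \<cdot>\<^bsub>A\<^esub> (G \<cdot>\<^bsub>A\<^esub> F)"
    unfolding f(2) g(2) h(2) A_comp[OF D(2,3) g(1) h(1)] A_comp[OF D(1,2) f(1) g(1)]
      A_comp[OF D(1,3) maps_comp[OF f(1) g(1)] h(1)] A_comp[OF D(1,2) f(1) maps_comp[OF g(1) h(1)]]
    using f(1) g(1) h(1) by (simp add: maps_iff)
next
  fix X Y Z F F' G
  assume D: "X \<in> D" "Y \<in> D" "Z \<in> D" and o: "F \<in> arr A X Y" "F' \<in> arr A X Y" "G \<in> arr A Y Z"
  obtain f where f: "\<guillemotleft>f : X \<rightarrow> Y\<guillemotright>" "F = cls f" using A_arrE[OF o(1)] D by auto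
  obtain f' where f': "\<guillemotleft>f' : X \<rightarrow> Y\<guillemotright>" "F' = cls f'" using A_arrE[OF o(2)] D by auto
  obtain g where g: "\<guillemotleft>g : Y \<rightarrow> Z\<guillemotright>" "G = cls g" using A_arrE[OF o(3)] D by auto
  have s: "\<guillemotleft>f \<oplus>\<^bsub>Hom C X Y\<^esub> f' : X \<rightarrow> Y\<guillemotright>" using f f' by (simp add: maps_iff)
  show "G \<cdot>\<^bsub>A\<^esub> (F \<oplus>\<^bsub>Hom A X Y\<^esub> F') = G \<cdot>\<^bsub>A\<^esub> F \<oplus>\<^bsub>Hom A X Z\<^esub> G \<cdot>\<^bsub>A\<^esub> F'"
    unfolding f(2) f'(2) g(2) A_add[OF D(1) f(1) f'(1)] A_comp[OF D(1,2) s g(1)]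
      A_comp[OF D(1,2) f(1) g(1)] A_comp[OF D(1,2) f'(1) g(1)]
      A_add[OF D(1) maps_comp[OF f(1) g(1)] maps_comp[OF f'(1) g(1)]]
    using f(1) f'(1) g(1) by (simp add: maps_iff)
next
  fix X Y Z F G G'
  assume D: "X \<in> D" "Y \<in> D" "Z \<in> D" and o: "F \<in> arr A X Y" "G \<in> arr A Y Z" "G' \<in> arr A Y Z"
  obtain f where f: "\<guillemotleft>f : X \<rightarrow> Y\<guillemotright>" "F = cls f" using A_arrE[OF o(1)] D by auto
  obtain g where g: "\<guillemotleft>g : Y \<rightarrow> Z\<guillemotright>" "G = cls g" using A_arrE[OF o(2)] D by auto
  obtain g' where g': "\<guillemotleft>g' : Y \<rightarrow> Z\<guillemotright>" "G' = cls g'" using A_arrE[OF o(3)] D by auto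
  have s: "\<guillemotleft>g \<oplus>\<^bsub>Hom C Y Z\<^esub> g' : Y \<rightarrow> Z\<guillemotright>" using g g' by (simp add: maps_iff)
  show "(G \<oplus>\<^bsub>Hom A Y Z\<^esub> G') \<cdot>\<^bsub>A\<^esub> F = G \<cdot>\<^bsub>A\<^esub> F \<oplus>\<^bsub>Hom A X Z\<^esub> G' \<cdot>\<^bsub>A\<^esub> F"
    unfolding f(2) g(2) g'(2) A_add[OF D(2) g(1) g'(1)] A_comp[OF D(1,2) f(1) s]
      A_comp[OF D(1,2) f(1) g(1)] A_comp[OF D(1,2) f(1) g'(1)]
      A_add[OF D(1) maps_comp[OF f(1) g(1)] maps_comp[OF f(1) g'(1)]]
    using f(1) g'(1) g(1) by (simp add: maps_iff)
next
  fix X Y Z a F G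
  assume D: "X \<in> D" "Y \<in> D" "Z \<in> D" and o: "a \<in> carrier K" "F \<in> arr A X Y" "G \<in> arr A Y Z"
  obtain f where f: "\<guillemotleft>f : X \<rightarrow> Y\<guillemotright>" "F = cls f" using A_arrE[OF o(2)] D by auto
  obtain g where g: "\<guillemotleft>g : Y \<rightarrow> Z\<guillemotright>" "G = cls g" using A_arrE[OF o(3)] D by auto
  have s: "\<guillemotleft>a \<odot>\<^bsub>Hom C X Y\<^esub> f : X \<rightarrow> Y\<guillemotright>" "\<guillemotleft>a \<odot>\<^bsub>Hom C Y Z\<^esub> g : Y \<rightarrow> Z\<guillemotright>"
    using f g o(1) by (simp_all add: maps_iff)
  show "G \<cdot>\<^bsub>A\<^esub> (a \<odot>\<^bsub>Hom A X Y\<^esub> F) = a \<odot>\<^bsub>Hom A X Z\<^esub> (G \<cdot>\<^bsub>A\<^esub> F)"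
    unfolding f(2) g(2) A_smult[OF D(1) f(1) o(1)] A_comp[OF D(1,2) f(1) g(1)]
      A_comp[OF D(1,2) s(1) g(1)] A_smult[OF D(1) maps_comp[OF f(1) g(1)] o(1)]
    using f(1) g(1) o(1) by (simp add: maps_iff)
  show "(a \<odot>\<^bsub>Hom A Y Z\<^esub> G) \<cdot>\<^bsub>A\<^esub> F = a \<odot>\<^bsub>Hom A X Z\<^esub> (G \<cdot>\<^bsub>A\<^esub> F)"
    unfolding f(2) g(2) A_smult[OF D(2) g(1) o(1)] A_comp[OF D(1,2) f(1) g(1)]
      A_comp[OF D(1,2) f(1) s(2)] A_smult[OF D(1) maps_comp[OF f(1) g(1)] o(1)]
    using f(1) g(1) o(1) by (simp add: maps_iff)
qed

text \<open>Existence is \<open>U_lift\<close>, uniqueness is cancellation of \<open>k\<close>.\<close>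

lemma A_kernel:
  assumes D: "N \<in> D" "Y \<in> D" "Z \<in> D" and k: "\<guillemotleft>k : N \<rightarrow> Y\<guillemotright>" and f: "\<guillemotleft>f : Y \<rightarrow> Z\<guillemotright>"
    and mono: "U_mono k" and exact: "U_exact k f"
  shows "is_kernel A N Y Z (cls k) (cls f)"
  unfolding is_kernel_def A_Obj
proof (intro conjI ballI impI A_arrI[OF k] A_arrI[OF f])
  show "cls f \<cdot>\<^bsub>A\<^esub> cls k = \<zero>\<^bsub>Hom A N Z\<^esub>"
    unfolding A_comp[OF D(1,2) k f] A_zero
    using cls_eq_iff[OF D(1) maps_comp[OF k f]] U_exact_comp_zero[OF exact k f] D by (simp add: maps_iff)
next
  fix W H assume W: "W \<in> D" and H: "H \<in> arr A W Y" and z: "cls f \<cdot>\<^bsub>A\<^esub> H = \<zero>\<^bsub>Hom A W Z\<^esub>"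
  obtain h where h: "\<guillemotleft>h : W \<rightarrow> Y\<guillemotright>" "H = cls h" using A_arrE[OF H] W D by auto
  have "\<guillemotleft>zer W Z : W \<rightarrow> Z\<guillemotright>" using W D by (simp add: maps_iff)
  then have fh: "f \<bullet> h \<approx> zer W Z"
    using z cls_eq_iff[OF W maps_comp[OF h(1) f]] unfolding h(2) A_comp[OF W D(2) h(1) f] A_zero by blast
  have "\<exists>v. \<guillemotleft>v : P \<rightarrow> N\<guillemotright> \<and> k \<bullet> v = h \<bullet> u" if u: "P \<in> U" "\<guillemotleft>u : P \<rightarrow> W\<guillemotright>" for P u
  proof -
    have "f \<bullet> (h \<bullet> u) = zer P Z"
      using U_eqD[OF fh maps_comp[OF h(1) f] u] u(2) h(1) f W D by (simp add: maps_iff)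
    then obtain v where "\<guillemotleft>v : P \<rightarrow> N\<guillemotright>" "k \<bullet> v = h \<bullet> u"
      by (rule U_exactD1[OF exact k f u(1) maps_comp[OF u(2) h(1)]])
    then show ?thesis by blast
  qed
  then obtain w where w: "\<guillemotleft>w : W \<rightarrow> N\<guillemotright>" "k \<bullet> w \<approx> h" by (rule U_lift[OF W k mono h(1)])
  show "\<exists>!V. V \<in> arr A W N \<and> cls k \<cdot>\<^bsub>A\<^esub> V = H"
  proof (rule ex1I[of _ "cls w"])
    show "cls w \<in> arr A W N \<and> cls k \<cdot>\<^bsub>A\<^esub> cls w = H"
      unfolding h(2) A_comp[OF W D(1) w(1) k]
      using A_arrI[OF w(1)] cls_eq_iff[OF W maps_comp[OF w(1) k] h(1)] w(2) by blast
    fix V assume V: "V \<in> arr A W N \<and> cls k \<cdot>\<^bsub>A\<^esub> V = H"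
    obtain v where v: "\<guillemotleft>v : W \<rightarrow> N\<guillemotright>" "V = cls v" using A_arrE[of V W N] V W D by auto
    have "k \<bullet> v \<approx> h"
      using V cls_eq_iff[OF W maps_comp[OF v(1) k] h(1)] unfolding v(2) h(2) A_comp[OF W D(1) v(1) k] by blast
    have "v \<approx> w"
    proof (rule U_eqI[OF v(1)])
      fix P u assume u: "P \<in> U" "\<guillemotleft>u : P \<rightarrow> W\<guillemotright>"
      have "k \<bullet> (v \<bullet> u) = k \<bullet> (w \<bullet> u)"
        using U_eqD[OF \<open>k \<bullet> v \<approx> h\<close> maps_comp[OF v(1) k] u] U_eqD[OF w(2) maps_comp[OF w(1) k] u]
          u(2) v(1) w(1) k by (simp add: maps_iff)
      then show "v \<bullet> u = w \<bullet> u"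
        using U_mono_cancel[OF mono k u(1) maps_comp[OF u(2) v(1)] maps_comp[OF u(2) w(1)]] by blast
    qed
    then show "V = cls w" using cls_eq_iff[OF W v(1) w(1)] v(2) by simp
  qed
qed

text \<open>Existence is \<open>U_descend\<close>, uniqueness is cancellation of \<open>c\<close>.\<close>

lemma A_cokernel:
  assumes D: "X \<in> D" "Y \<in> D" "N \<in> D" and f: "\<guillemotleft>f : X \<rightarrow> Y\<guillemotright>" and c: "\<guillemotleft>c : Y \<rightarrow> N\<guillemotright>"
    and epi: "U_epi c" and exact: "U_exact f c"
  shows "is_cokernel A X Y N (cls f) (cls c)"
  unfolding is_cokernel_def A_Obj
proof (intro conjI ballI impI A_arrI[OF c] A_arrI[OF f])
  show "cls c \<cdot>\<^bsub>A\<^esub> cls f = \<zero>\<^bsub>Hom A X N\<^esub>"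
    unfolding A_comp[OF D(1,2) f c] A_zero
    using cls_eq_iff[OF D(1) maps_comp[OF f c]] U_exact_comp_zero[OF exact f c] D by (simp add: maps_iff)
next
  fix W H assume W: "W \<in> D" and H: "H \<in> arr A Y W" and z: "H \<cdot>\<^bsub>A\<^esub> cls f = \<zero>\<^bsub>Hom A X W\<^esub>"
  obtain h where h: "\<guillemotleft>h : Y \<rightarrow> W\<guillemotright>" "H = cls h" using A_arrE[OF H] W D by auto
  have "\<guillemotleft>zer X W : X \<rightarrow> W\<guillemotright>" using W D by (simp add: maps_iff)
  then have hf: "h \<bullet> f \<approx> zer X W"
    using z cls_eq_iff[OF D(1) maps_comp[OF f h(1)]] unfolding h(2) A_comp[OF D(1,2) f h(1)] A_zero by blast
  have "h \<bullet> u = zer P W" if u: "P \<in> U" "\<guillemotleft>u : P \<rightarrow> Y\<guillemotright>" "c \<bullet> u = zer P N" for P u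
  proof -
    obtain v where v: "\<guillemotleft>v : P \<rightarrow> X\<guillemotright>" "f \<bullet> v = u" using U_exactD1[OF exact f c u] .
    show ?thesis
      unfolding v(2)[symmetric]
      using U_eqD[OF hf maps_comp[OF f h(1)] u(1) v(1)] v(1) h(1) f W D by (simp add: maps_iff)
  qed
  then obtain w where w: "\<guillemotleft>w : N \<rightarrow> W\<guillemotright>" "w \<bullet> c \<approx> h" by (rule U_descend[OF D(3) c epi h(1)])
  show "\<exists>!V. V \<in> arr A N W \<and> V \<cdot>\<^bsub>A\<^esub> cls c = H"
  proof (rule ex1I[of _ "cls w"])
    show "cls w \<in> arr A N W \<and> cls w \<cdot>\<^bsub>A\<^esub> cls c = H"
      unfolding h(2) A_comp[OF D(2,3) c w(1)]
      using A_arrI[OF w(1)] cls_eq_iff[OF D(2) maps_comp[OF c w(1)] h(1)] w(2) by blast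
    fix V assume V: "V \<in> arr A N W \<and> V \<cdot>\<^bsub>A\<^esub> cls c = H"
    obtain v where v: "\<guillemotleft>v : N \<rightarrow> W\<guillemotright>" "V = cls v" using A_arrE[of V N W] V W D by auto
    have "v \<bullet> c \<approx> h"
      using V cls_eq_iff[OF D(2) maps_comp[OF c v(1)] h(1)] unfolding v(2) h(2) A_comp[OF D(2,3) c v(1)] by blast
    have "v \<approx> w"
    proof (rule U_eqI[OF v(1)])
      fix P u assume u: "P \<in> U" "\<guillemotleft>u : P \<rightarrow> N\<guillemotright>"
      obtain x where x: "\<guillemotleft>x : P \<rightarrow> Y\<guillemotright>" "c \<bullet> x = u" using U_epiD[OF epi c u] .
      show "v \<bullet> u = w \<bullet> u"
        unfolding x(2)[symmetric]
        using U_eqD[OF \<open>v \<bullet> c \<approx> h\<close> maps_comp[OF c v(1)] u(1) x(1)]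
          U_eqD[OF w(2) maps_comp[OF c w(1)] u(1) x(1)]
          x(1) v(1) w(1) c by (simp add: maps_iff)
    qed
    then show "V = cls w" using cls_eq_iff[OF D(3) v(1) w(1)] v(2) by simp
  qed
qed

lemma U_subset_D: assumes P: "P \<in> U" shows "P \<in> D"
proof -
  obtain Z where Z: "is_zero_object C Z" using zero_object_exists by blast
  have "triangle C P P Z (Id C P) (zer P Z) (zer Z (sh P))" using triangle_id[OF U_obj[OF P] Z] .
  then show ?thesis unfolding star_def using P zero_object_R[OF Z] by blast
qed

lemma U_eq_from_U:
  assumes "P \<in> U" "\<guillemotleft>u : P \<rightarrow> X\<guillemotright>" "\<guillemotleft>v : P \<rightarrow> X\<guillemotright>" "u \<approx> v" shows "u = v"
  using U_eqD[OF assms(4,2,1) maps_Id[OF U_obj[OF assms(1)]]] assms(2,3) by (simp add: maps_iff)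

text \<open>The objects of \<open>U\<close> lie in \<open>D\<close>, so a monomorphism of the quotient can be tested on them.\<close>

lemma A_mono_iff:
  assumes D: "X \<in> D" "Y \<in> D" and f: "\<guillemotleft>f : X \<rightarrow> Y\<guillemotright>"
  shows "is_mono A X Y (cls f) \<longleftrightarrow> U_mono f"
proof
  assume m: "is_mono A X Y (cls f)"
  show "U_mono f"
  proof (rule U_monoI[OF f])
    fix P u assume P: "P \<in> U" and u: "\<guillemotleft>u : P \<rightarrow> X\<guillemotright>" "f \<bullet> u = zer P Y"
    have PD: "P \<in> D" using U_subset_D[OF P] .
    have z: "\<guillemotleft>zer P X : P \<rightarrow> X\<guillemotright>" using PD D by (simp add: maps_iff)
    have "cls f \<cdot>\<^bsub>A\<^esub> cls u = cls f \<cdot>\<^bsub>A\<^esub> cls (zer P X)"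
      unfolding A_comp[OF PD D(1) u(1) f] A_comp[OF PD D(1) z f] u(2)
      using f PD by (simp add: maps_iff)
    then have "cls u = cls (zer P X)"
      using m PD A_arrI[OF u(1)] A_arrI[OF z] unfolding is_mono_def A_Obj by blast
    then show "u = zer P X" using U_eq_from_U[OF P u(1) z] cls_eq_iff[OF PD u(1) z] by blast
  qed
next
  assume m: "U_mono f"
  show "is_mono A X Y (cls f)"
    unfolding is_mono_def A_Obj
  proof (intro conjI ballI impI A_arrI[OF f])
    fix W F G assume W: "W \<in> D" and F: "F \<in> arr A W X" and G: "G \<in> arr A W X"
      and eq: "cls f \<cdot>\<^bsub>A\<^esub> F = cls f \<cdot>\<^bsub>A\<^esub> G"
    obtain u where u: "\<guillemotleft>u : W \<rightarrow> X\<guillemotright>" "F = cls u" using A_arrE[OF F] W D by auto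
    obtain v where v: "\<guillemotleft>v : W \<rightarrow> X\<guillemotright>" "G = cls v" using A_arrE[OF G] W D by auto
    have e: "f \<bullet> u \<approx> f \<bullet> v"
      using eq cls_eq_iff[OF W maps_comp[OF u(1) f] maps_comp[OF v(1) f]]
      unfolding u(2) v(2) A_comp[OF W D(1) u(1) f] A_comp[OF W D(1) v(1) f] by blast
    have "u \<approx> v"
    proof (rule U_eqI[OF u(1)])
      fix P x assume x: "P \<in> U" "\<guillemotleft>x : P \<rightarrow> W\<guillemotright>"
      have "f \<bullet> (u \<bullet> x) = f \<bullet> (v \<bullet> x)"
        using U_eqD[OF e maps_comp[OF u(1) f] x] u(1) v(1) f x(2) by (simp add: maps_iff)
      then show "u \<bullet> x = v \<bullet> x"
        using U_mono_cancel[OF m f x(1) maps_comp[OF x(2) u(1)] maps_comp[OF x(2) v(1)]] by blast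
    qed
    then show "F = G" using cls_eq_iff[OF W u(1) v(1)] u(2) v(2) by simp
  qed
qed

text \<open>The cokernel candidate of an epimorphism is zero in the quotient, so by exactness \<open>Hom(U, f)\<close> is onto.\<close>

lemma A_epi_iff:
  assumes D: "Y \<in> D" "Z \<in> D" and f: "\<guillemotleft>f : Y \<rightarrow> Z\<guillemotright>"
  shows "is_epi A Y Z (cls f) \<longleftrightarrow> U_epi f"
proof
  assume m: "is_epi A Y Z (cls f)"
  obtain N c where N: "N \<in> D" and c: "\<guillemotleft>c : Z \<rightarrow> N\<guillemotright>" and ex: "U_exact f c"
    using cokernel_candidate[OF D f] by blast
  have z: "\<guillemotleft>zer Z N : Z \<rightarrow> N\<guillemotright>" "\<guillemotleft>zer Y N : Y \<rightarrow> N\<guillemotright>" using N D by (simp_all add: maps_iff)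
  have "cls (c \<bullet> f) = cls (zer Y N)"
    using cls_eq_iff[OF D(1) maps_comp[OF f c] z(2)] U_exact_comp_zero[OF ex f c] by blast
  then have "cls c \<cdot>\<^bsub>A\<^esub> cls f = cls (zer Z N) \<cdot>\<^bsub>A\<^esub> cls f"
    unfolding A_comp[OF D f c] A_comp[OF D f z(1)] using f N by (simp add: maps_iff)
  then have "cls c = cls (zer Z N)"
    using m N A_arrI[OF c] A_arrI[OF z(1)] unfolding is_epi_def A_Obj by blast
  then have cz: "c \<approx> zer Z N" using cls_eq_iff[OF D(2) c z(1)] by blast
  show "U_epi f"
  proof (rule U_epiI[OF f])
    fix P u assume u: "P \<in> U" "\<guillemotleft>u : P \<rightarrow> Z\<guillemotright>"
    have "c \<bullet> u = zer P N" using U_eqD[OF cz c u] u(2) N by (simp add: maps_iff)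
    then obtain v where "\<guillemotleft>v : P \<rightarrow> Y\<guillemotright>" "f \<bullet> v = u" by (rule U_exactD1[OF ex f c u])
    then show "\<exists>v. \<guillemotleft>v : P \<rightarrow> Y\<guillemotright> \<and> f \<bullet> v = u" by blast
  qed
next
  assume m: "U_epi f"
  show "is_epi A Y Z (cls f)"
    unfolding is_epi_def A_Obj
  proof (intro conjI ballI impI A_arrI[OF f])
    fix W F G assume W: "W \<in> D" and F: "F \<in> arr A Z W" and G: "G \<in> arr A Z W"
      and eq: "F \<cdot>\<^bsub>A\<^esub> cls f = G \<cdot>\<^bsub>A\<^esub> cls f"
    obtain u where u: "\<guillemotleft>u : Z \<rightarrow> W\<guillemotright>" "F = cls u" using A_arrE[OF F] W D by auto
    obtain v where v: "\<guillemotleft>v : Z \<rightarrow> W\<guillemotright>" "G = cls v" using A_arrE[OF G] W D by auto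
    have e: "u \<bullet> f \<approx> v \<bullet> f"
      using eq cls_eq_iff[OF D(1) maps_comp[OF f u(1)] maps_comp[OF f v(1)]]
      unfolding u(2) v(2) A_comp[OF D f u(1)] A_comp[OF D f v(1)] by blast
    have "u \<approx> v"
    proof (rule U_eqI[OF u(1)])
      fix P x assume x: "P \<in> U" "\<guillemotleft>x : P \<rightarrow> Z\<guillemotright>"
      obtain y where y: "\<guillemotleft>y : P \<rightarrow> Y\<guillemotright>" "f \<bullet> y = x" using U_epiD[OF m f x] .
      show "u \<bullet> x = v \<bullet> x"
        unfolding y(2)[symmetric]
        using U_eqD[OF e maps_comp[OF f u(1)] x(1) y(1)] u(1) v(1) f y(1) by (simp add: maps_iff)
    qed
    then show "F = G" using cls_eq_iff[OF D(2) u(1) v(1)] u(2) v(2) by simp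
  qed
qed

lemma A_maps: "linear_category.maps A F X Y \<longleftrightarrow> X \<in> D \<and> Y \<in> D \<and> F \<in> arr A X Y"
  by (simp add: linear_category.maps_def[OF A_linear_category])

lemma A_zero_object: "\<exists>Z. is_zero_object A Z"
proof -
  obtain Z where Z: "is_zero_object C Z" using zero_object_exists by blast
  have "Z \<in> D" using U_subset_D[OF zero_object_U[OF Z]] .
  moreover have "arr A X Z = {\<zero>\<^bsub>Hom A X Z\<^esub>} \<and> arr A Z X = {\<zero>\<^bsub>Hom A Z X\<^esub>}" if "X \<in> D" for X
  proof -
    have "arr C X Z = {zer X Z} \<and> arr C Z X = {zer Z X}"
      using Z D_obj[OF that] unfolding is_zero_object_def by blast
    then show ?thesis unfolding A_arr by simp
  qed
  ultimately show ?thesis unfolding is_zero_object_def A_Obj by blast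
qed

text \<open>Showing that the direct sum \<open>S\<close> in \<open>C\<close> lies in \<open>D\<close> would need direct sums of triangles. It is simpler to
  take an object \<open>N\<close> of \<open>D\<close> with a map to \<open>S\<close> that is bijective on \<open>Hom(U, -)\<close>: the projections compose
  with it and the injections lift along it.\<close>

lemma A_direct_sum:
  assumes D: "X \<in> D" "Y \<in> D" shows "\<exists>S. is_direct_sum A S [X, Y]"
proof -
  obtain S where "is_direct_sum C S [X, Y]" using direct_sum_exists[OF D_obj[OF D(1)] D_obj[OF D(2)]] by blast
  then obtain i j p q where m: "\<guillemotleft>i : X \<rightarrow> S\<guillemotright>" "\<guillemotleft>j : Y \<rightarrow> S\<guillemotright>" "\<guillemotleft>p : S \<rightarrow> X\<guillemotright>" "\<guillemotleft>q : S \<rightarrow> Y\<guillemotright>"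
    and e: "p \<bullet> i = Id C X" "q \<bullet> j = Id C Y" "p \<bullet> j = zer Y X" "q \<bullet> i = zer X Y"
      "(i \<bullet> p) \<oplus>\<^bsub>Hom C S S\<^esub> (j \<bullet> q) = Id C S"
    unfolding direct_sum_two_iff by blast
  have So: "S \<in> Obj C" using m maps_objD(2) by blast
  obtain Q a where Q: "Q \<in> U" "\<guillemotleft>a : Q \<rightarrow> S\<guillemotright>"
    and app: "\<And>P u. P \<in> U \<Longrightarrow> \<guillemotleft>u : P \<rightarrow> S\<guillemotright> \<Longrightarrow> \<exists>v. \<guillemotleft>v : P \<rightarrow> Q\<guillemotright> \<and> a \<bullet> v = u"
    using U_approximation[OF So] by blast
  obtain N k where N: "N \<in> D" and k: "\<guillemotleft>k : N \<rightarrow> S\<guillemotright>" and mono: "U_mono k"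
    and im: "\<And>P u. P \<in> U \<Longrightarrow> \<guillemotleft>u : P \<rightarrow> S\<guillemotright> \<Longrightarrow> (\<exists>v. \<guillemotleft>v : P \<rightarrow> N\<guillemotright> \<and> k \<bullet> v = u) \<longleftrightarrow> (\<exists>v. \<guillemotleft>v : P \<rightarrow> Q\<guillemotright> \<and> a \<bullet> v = u)"
    using image_object[OF Q] by blast
  have surj: "\<exists>v. \<guillemotleft>v : P \<rightarrow> N\<guillemotright> \<and> k \<bullet> v = u" if "P \<in> U" "\<guillemotleft>u : P \<rightarrow> S\<guillemotright>" for P u
    using im[OF that] app[OF that] by blast
  obtain i' where i': "\<guillemotleft>i' : X \<rightarrow> N\<guillemotright>" "k \<bullet> i' \<approx> i"
    by (rule U_lift[OF D(1) k mono m(1)]) (use surj maps_comp[OF _ m(1)] in blast)+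
  obtain j' where j': "\<guillemotleft>j' : Y \<rightarrow> N\<guillemotright>" "k \<bullet> j' \<approx> j"
    by (rule U_lift[OF D(2) k mono m(2)]) (use surj maps_comp[OF _ m(2)] in blast)+
  note p' = maps_comp[OF k m(3)] note q' = maps_comp[OF k m(4)]
  \<comment> \<open>\<open>k\<close> identifies \<open>i'\<close>, \<open>j'\<close> with \<open>i\<close>, \<open>j\<close> on morphisms from \<open>U\<close>\<close>
  have ki: "k \<bullet> (i' \<bullet> u) = i \<bullet> u" if "P \<in> U" "\<guillemotleft>u : P \<rightarrow> X\<guillemotright>" for P u
    using U_eqD[OF i'(2) maps_comp[OF i'(1) k] that] that i'(1) k by (simp add: maps_iff)
  have kj: "k \<bullet> (j' \<bullet> u) = j \<bullet> u" if "P \<in> U" "\<guillemotleft>u : P \<rightarrow> Y\<guillemotright>" for P u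
    using U_eqD[OF j'(2) maps_comp[OF j'(1) k] that] that j'(1) k by (simp add: maps_iff)
  have pi: "p \<bullet> (i \<bullet> u) = u" "q \<bullet> (i \<bullet> u) = zer P Y" if "\<guillemotleft>u : P \<rightarrow> X\<guillemotright>" for P u
    using comp_eq_assoc[OF e(1) m(1,3) that] comp_eq_assoc[OF e(4) m(1,4) that] that m
    by (simp_all add: maps_iff)
  have pj: "q \<bullet> (j \<bullet> u) = u" "p \<bullet> (j \<bullet> u) = zer P X" if "\<guillemotleft>u : P \<rightarrow> Y\<guillemotright>" for P u
    using comp_eq_assoc[OF e(2) m(2,4) that] comp_eq_assoc[OF e(3) m(2,3) that] that m
    by (simp_all add: maps_iff)
  have n1: "(p \<bullet> k) \<bullet> i' \<approx> Id C X"
    by (rule U_eqI[OF maps_comp[OF i'(1) p']])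
      (use ki pi i'(1) k m D in \<open>simp add: maps_iff\<close>)
  have n2: "(q \<bullet> k) \<bullet> i' \<approx> zer X Y"
    by (rule U_eqI[OF maps_comp[OF i'(1) q']])
      (use ki pi i'(1) k m D in \<open>simp add: maps_iff\<close>)
  have n3: "(q \<bullet> k) \<bullet> j' \<approx> Id C Y"
    by (rule U_eqI[OF maps_comp[OF j'(1) q']])
      (use kj pj j'(1) k m D in \<open>simp add: maps_iff\<close>)
  have n4: "(p \<bullet> k) \<bullet> j' \<approx> zer Y X"
    by (rule U_eqI[OF maps_comp[OF j'(1) p']])
      (use kj pj j'(1) k m D in \<open>simp add: maps_iff\<close>)
  have n5: "(i' \<bullet> (p \<bullet> k)) \<oplus>\<^bsub>Hom C N N\<^esub> (j' \<bullet> (q \<bullet> k)) \<approx> Id C N" (is "?s \<approx> _")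
  proof (rule U_eqI)
    show s: "\<guillemotleft>?s : N \<rightarrow> N\<guillemotright>" using i' j' k m by (simp add: maps_iff)
    fix P u assume u: "P \<in> U" "\<guillemotleft>u : P \<rightarrow> N\<guillemotright>"
    have ku: "\<guillemotleft>k \<bullet> u : P \<rightarrow> S\<guillemotright>" using maps_comp[OF u(2) k] .
    have "k \<bullet> (?s \<bullet> u) = (i \<bullet> (p \<bullet> (k \<bullet> u))) \<oplus>\<^bsub>Hom C P S\<^esub> (j \<bullet> (q \<bullet> (k \<bullet> u)))"
      using ki[OF u(1) maps_comp[OF ku m(3)]] kj[OF u(1) maps_comp[OF ku m(4)]] i'(1) j'(1) k m u(2)
      by (simp add: maps_iff)
    also have "\<dots> = ((i \<bullet> p) \<oplus>\<^bsub>Hom C S S\<^esub> (j \<bullet> q)) \<bullet> (k \<bullet> u)" using ku m by (simp add: maps_iff)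
    also have "\<dots> = k \<bullet> u" unfolding e(5) using ku by (simp add: maps_iff)
    finally have "?s \<bullet> u = u" using U_mono_cancel[OF mono k u(1) maps_comp[OF u(2) s] u(2)] by blast
    then show "?s \<bullet> u = Id C N \<bullet> u" using u(2) by (simp add: maps_iff)
  qed
  have z: "\<guillemotleft>zer X Y : X \<rightarrow> Y\<guillemotright>" "\<guillemotleft>zer Y X : Y \<rightarrow> X\<guillemotright>" and s: "\<guillemotleft>?s : N \<rightarrow> N\<guillemotright>"
    using i' j' k m D by (simp_all add: maps_iff)
  have "cls (p \<bullet> k) \<cdot>\<^bsub>A\<^esub> cls i' = Id A X"
    unfolding A_Id A_comp[OF D(1) N i'(1) p']
    using n1 cls_eq_iff[OF D(1) maps_comp[OF i'(1) p'] maps_Id[OF D_obj[OF D(1)]]] by blast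
  moreover have "cls (q \<bullet> k) \<cdot>\<^bsub>A\<^esub> cls i' = \<zero>\<^bsub>Hom A X Y\<^esub>"
    unfolding A_zero A_comp[OF D(1) N i'(1) q']
    using n2 cls_eq_iff[OF D(1) maps_comp[OF i'(1) q'] z(1)] by blast
  moreover have "cls (q \<bullet> k) \<cdot>\<^bsub>A\<^esub> cls j' = Id A Y"
    unfolding A_Id A_comp[OF D(2) N j'(1) q']
    using n3 cls_eq_iff[OF D(2) maps_comp[OF j'(1) q'] maps_Id[OF D_obj[OF D(2)]]] by blast
  moreover have "cls (p \<bullet> k) \<cdot>\<^bsub>A\<^esub> cls j' = \<zero>\<^bsub>Hom A Y X\<^esub>"
    unfolding A_zero A_comp[OF D(2) N j'(1) p']
    using n4 cls_eq_iff[OF D(2) maps_comp[OF j'(1) p'] z(2)] by blast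
  moreover have "(cls i' \<cdot>\<^bsub>A\<^esub> cls (p \<bullet> k)) \<oplus>\<^bsub>Hom A N N\<^esub> (cls j' \<cdot>\<^bsub>A\<^esub> cls (q \<bullet> k)) = Id A N"
    unfolding A_Id A_comp[OF N D(1) p' i'(1)] A_comp[OF N D(2) q' j'(1)]
      A_add[OF N maps_comp[OF p' i'(1)] maps_comp[OF q' j'(1)]]
    using n5 cls_eq_iff[OF N s maps_Id[OF D_obj[OF N]]] by blast
  ultimately have "is_direct_sum A N [X, Y]"
    unfolding linear_category.direct_sum_two_iff[OF A_linear_category] A_maps
    using N D A_arrI[OF i'(1)] A_arrI[OF j'(1)] A_arrI[OF p'] A_arrI[OF q']
    by (intro exI[of _ "cls i'"] exI[of _ "cls j'"] exI[of _ "cls (p \<bullet> k)"] exI[of _ "cls (q \<bullet> k)"]) simp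
  then show ?thesis ..
qed

text \<open>A \<open>U\<close>-monomorphism is the kernel of its cokernel candidate and a \<open>U\<close>-epimorphism the cokernel of its
  kernel candidate, as exactness is the only further hypothesis of \<open>A_kernel\<close> and \<open>A_cokernel\<close>.\<close>

theorem A_abelian: "abelian_category K A"
proof (intro abelian_category.intro abelian_category_axioms.intro additive_category.intro
    additive_category_axioms.intro A_linear_category A_zero_object, unfold A_Obj)
  fix X Y assume "X \<in> D" "Y \<in> D"
  then show "\<exists>S. is_direct_sum A S [X, Y]" using A_direct_sum by simp
next
  fix Y Z F assume D: "Y \<in> D" "Z \<in> D" and o: "F \<in> arr A Y Z"
  obtain f where f: "\<guillemotleft>f : Y \<rightarrow> Z\<guillemotright>" "F = cls f" using A_arrE[OF o(1)] D by auto
  obtain N k where N: "N \<in> D" "\<guillemotleft>k : N \<rightarrow> Y\<guillemotright>" "U_mono k" "U_exact k f" using kernel_candidate[OF f(1)] .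
  then show "\<exists>X\<in>D. \<exists>k. is_kernel A X Y Z k F"
    using A_kernel[OF N(1) D N(2) f(1) N(3,4)] f(2) by auto
next
  fix X Y F assume D: "X \<in> D" "Y \<in> D" and o: "F \<in> arr A X Y"
  obtain f where f: "\<guillemotleft>f : X \<rightarrow> Y\<guillemotright>" "F = cls f" using A_arrE[OF o(1)] D by auto
  obtain N c where N: "N \<in> D" "\<guillemotleft>c : Y \<rightarrow> N\<guillemotright>" "U_epi c" "U_exact f c"
    using cokernel_candidate[OF D f(1)] .
  then show "\<exists>Z\<in>D. \<exists>c. is_cokernel A X Y Z F c"
    using A_cokernel[OF D N(1) f(1) N(2-4)] f(2) by auto
next
  fix X Y F assume D: "X \<in> D" "Y \<in> D" and m: "is_mono A X Y F"
  have "F \<in> arr A X Y" using m unfolding is_mono_def by blast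
  then obtain f where f: "\<guillemotleft>f : X \<rightarrow> Y\<guillemotright>" "F = cls f" using A_arrE D D_obj by metis
  have mono: "U_mono f" using m A_mono_iff[OF D f(1)] f(2) by blast
  obtain N c where N: "N \<in> D" "\<guillemotleft>c : Y \<rightarrow> N\<guillemotright>" "U_epi c" "U_exact f c"
    using cokernel_candidate[OF D f(1)] .
  then show "\<exists>Z\<in>D. \<exists>g. is_kernel A X Y Z F g"
    using A_kernel[OF D N(1) f(1) N(2) mono N(4)] f(2) by auto
next
  fix Y Z F assume D: "Y \<in> D" "Z \<in> D" and m: "is_epi A Y Z F"
  have "F \<in> arr A Y Z" using m unfolding is_epi_def by blast
  then obtain f where f: "\<guillemotleft>f : Y \<rightarrow> Z\<guillemotright>" "F = cls f" using A_arrE D D_obj by metis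
  have epi: "U_epi f" using m A_epi_iff[OF D f(1)] f(2) by blast
  obtain N k where N: "N \<in> D" "\<guillemotleft>k : N \<rightarrow> Y\<guillemotright>" "U_mono k" "U_exact k f" using kernel_candidate[OF f(1)] .
  then show "\<exists>X\<in>D. \<exists>g. is_cokernel A X Y Z g F"
    using A_cokernel[OF N(1) D N(2) f(1) epi N(4)] f(2) by auto
qed

lemma U_projective:
  assumes P: "P \<in> U" shows "projective A P"
  unfolding projective_def A_Obj
proof (intro conjI ballI allI impI)
  show PD: "P \<in> D" using U_subset_D[OF P] .
  fix X Y E F assume D: "X \<in> D" "Y \<in> D" and E: "is_epi A X Y E" and F: "F \<in> arr A P Y"
  have "E \<in> arr A X Y" using E unfolding is_epi_def by blast
  then obtain e where e: "\<guillemotleft>e : X \<rightarrow> Y\<guillemotright>" "E = cls e" using A_arrE D D_obj by metis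
  obtain f where f: "\<guillemotleft>f : P \<rightarrow> Y\<guillemotright>" "F = cls f" using A_arrE[OF F] PD D by auto
  have "U_epi e" using E A_epi_iff[OF D e(1)] e(2) by blast
  then obtain v where v: "\<guillemotleft>v : P \<rightarrow> X\<guillemotright>" "e \<bullet> v = f" by (rule U_epiD[OF _ e(1) P f(1)])
  then show "\<exists>G\<in>arr A P X. E \<cdot>\<^bsub>A\<^esub> G = F"
    using A_comp[OF PD D(1) v(1) e(1)] A_arrI[OF v(1)] e(2) f(2) by auto
qed

lemma U_covers:
  assumes X: "X \<in> D"
  obtains Q p where "Q \<in> U" "\<guillemotleft>p : Q \<rightarrow> X\<guillemotright>" "is_epi A Q X (cls p)"
proof -
  obtain P Q i p r where P: "P \<in> U" "Q \<in> U" and t: "triangle C P Q X i p r"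
    using D_presentation[OF X] .
  have p: "\<guillemotleft>p : Q \<rightarrow> X\<guillemotright>" using triangle_maps[OF t] by blast
  have "U_epi p" by (rule U_epiI[OF p]) (rule presentation_epi[OF t P(1)])
  then show ?thesis using that[OF P(2) p] A_epi_iff[OF U_subset_D[OF P(2)] X p] by blast
qed

lemma A_enough_projectives: "enough_projectives A"
  unfolding enough_projectives_def A_Obj using U_covers U_projective by metis

text \<open>Exactness in the middle holds for every triangle; only the two ends need an argument.\<close>

lemma A_short_exact:
  assumes t: "triangle C X Y Z f g h" and D: "X \<in> D" "Y \<in> D" "Z \<in> D" and "U_mono f" "U_epi g"
  shows "short_exact A X Y Z (cls f) (cls g)"
  unfolding short_exact_def A_Obj
  using A_kernel[OF D triangle_maps(1,2)[OF t] assms(5) U_exact_triangle[OF t]]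
    A_cokernel[OF D triangle_maps(1,2)[OF t] assms(6) U_exact_triangle[OF t]] D by blast

end

section \<open>Injective objects and the Gorenstein property\<close>

locale maximal_rigid_calabi_yau = rigid_subcategory K C R
  for K :: "('k, 'b) ring_scheme" (structure)
  and C :: "('k, 'o, 'm, 'c) tri_cat_scheme" (structure)
  and R :: "'o set" +
  assumes CY: "calabi_yau_2 K C"
    and R_maximal: "maximal_rigid C R"
    and R_covariantly_finite: "covariantly_finite C R"
begin

lemma R_approximation:
  assumes X: "X \<in> Obj C"
  obtains T f where "T \<in> R" "\<guillemotleft>f : X \<rightarrow> T\<guillemotright>"
    "\<And>T' g. T' \<in> R \<Longrightarrow> \<guillemotleft>g : X \<rightarrow> T'\<guillemotright> \<Longrightarrow> \<exists>h. \<guillemotleft>h : T \<rightarrow> T'\<guillemotright> \<and> h \<bullet> f = g"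
proof -
  obtain T f where la: "left_approximation C R X T f"
    using R_covariantly_finite X unfolding covariantly_finite_def by blast
  then have T: "T \<in> R" and f: "\<guillemotleft>f : X \<rightarrow> T\<guillemotright>"
    unfolding left_approximation_def maps_def using X by simp_all
  have "\<exists>h. \<guillemotleft>h : T \<rightarrow> T'\<guillemotright> \<and> h \<bullet> f = g" if T': "T' \<in> R" "\<guillemotleft>g : X \<rightarrow> T'\<guillemotright>" for T' g
  proof -
    obtain h where "h \<in> arr C T T'" "h \<bullet> f = g"
      using la T'(1) maps_arr[OF T'(2)] unfolding left_approximation_def by blast
    then show ?thesis using T T'(1) by (auto simp: maps_def)
  qed
  then show ?thesis using that T f by blast
qed

lemma ext_R: "T \<in> R \<Longrightarrow> T' \<in> R \<Longrightarrow> ext_vanishes T T'"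
  unfolding ext_vanishes_def using ext_R_zero by blast

text \<open>By symmetry of the vanishing of extensions, maximality needs to be checked in the first argument only.\<close>

lemma maximality:
  assumes M: "M \<in> Obj C" and MM: "ext_vanishes M M" and MR: "\<And>T. T \<in> R \<Longrightarrow> ext_vanishes M T"
  shows "M \<in> R"
proof -
  have obj: "Z \<in> Obj C" if "Z \<in> add_closure C M" for Z
    using that unfolding add_closure_def direct_summand_def is_direct_sum_def by auto
  note sym = ext_vanishes_sym[OF CY]
  have ZR: "ext_vanishes Z T" if "Z \<in> add_closure C M" "T \<in> R" for Z T
    using ext_vanishes_add_closure[OF MR[OF that(2)] that(1) R_obj[OF that(2)]] .
  have ZM: "ext_vanishes Z M" if "Z \<in> add_closure C M" for Z
    using ext_vanishes_add_closure[OF MM that M] .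
  have ZZ: "ext_vanishes Z Z'" if z: "Z \<in> add_closure C M" "Z' \<in> add_closure C M" for Z Z'
    using ext_vanishes_add_closure[OF sym[OF ZM[OF z(2)] M obj[OF z(2)]] z(1) obj[OF z(2)]] .
  have RZ: "ext_vanishes T Z" if z: "Z \<in> add_closure C M" "T \<in> R" for Z T
    using sym[OF ZR[OF z] R_obj[OF z(2)] obj[OF z(1)]] .
  have "ext_orthogonal C (R \<union> add_closure C M)"
    unfolding ext_orthogonal_def
  proof (intro ballI)
    fix X Y assume "X \<in> R \<union> add_closure C M" "Y \<in> R \<union> add_closure C M"
    then have "ext_vanishes X Y" "X \<in> Obj C" "Y \<in> Obj C"
      using ext_R ZR RZ ZZ obj R_obj by blast+
    then show "carrier (Ext1 C X Y) = {zer X (sh Y)}" using ext_vanishes_carrier by blast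
  qed
  then show ?thesis using R_maximal M unfolding maximal_rigid_def by blast
qed

text \<open>Let \<open>Y\<close> be the cone of a left approximation \<open>f : X \<rightarrow> T\<close>. A morphism \<open>a\<close> from \<open>Y\<close> to \<open>T'[1]\<close> or to
  \<open>Y[1]\<close> vanishes on \<open>T\<close>, hence comes from a morphism \<open>X[1] \<rightarrow> T'[1]\<close> or \<open>X[1] \<rightarrow> Y[1]\<close>. Its unshift \<open>c\<close>
  factors through \<open>f\<close>; in the second case \<open>c\<close> first has to be lifted along \<open>T \<rightarrow> Y\<close>, which is possible
  because \<open>X\<close> is rigid. Then \<open>a\<close> factors through \<open>f[1] \<bullet> h = 0\<close>.\<close>

lemma rigid_coresolution:
  assumes X: "X \<in> Obj C" and rig: "ext_vanishes X X"
  obtains T0 T1 f g h where "T0 \<in> R" "T1 \<in> R" "triangle C X T0 T1 f g h"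
proof -
  obtain T f where T: "T \<in> R" and f: "\<guillemotleft>f : X \<rightarrow> T\<guillemotright>"
    and app: "\<And>T' g. T' \<in> R \<Longrightarrow> \<guillemotleft>g : X \<rightarrow> T'\<guillemotright> \<Longrightarrow> \<exists>h. \<guillemotleft>h : T \<rightarrow> T'\<guillemotright> \<and> h \<bullet> f = g"
    using R_approximation[OF X] by blast
  obtain Y g h where t: "triangle C X T Y f g h"
    using triangle_exists[OF X R_obj[OF T] maps_arr[OF f]] by blast
  note m = triangle_maps[OF t]
  have Y: "Y \<in> Obj C" using maps_objD(2)[OF m(2)] .
  note fh = triangle_comp_zero3[OF t]
  have YR: "ext_vanishes Y T'" if T': "T' \<in> R" for T'
    unfolding ext_vanishes_def
  proof (intro allI impI)
    fix a assume a: "\<guillemotleft>a : Y \<rightarrow> sh T'\<guillemotright>"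
    have "a \<bullet> g = zer T (sh T')" using ext_R_zero[OF T T' maps_comp[OF m(2) a]] .
    then obtain b where b: "\<guillemotleft>b : sh X \<rightarrow> sh T'\<guillemotright>" "b \<bullet> h = a" using triangle_extend2[OF t a] by blast
    obtain c where c: "\<guillemotleft>c : X \<rightarrow> T'\<guillemotright>" "shm c = b" using shm_surj[OF b(1) X R_obj[OF T']] .
    obtain d where d: "\<guillemotleft>d : T \<rightarrow> T'\<guillemotright>" "d \<bullet> f = c" using app[OF T' c(1)] by blast
    have "shm c \<bullet> h = shm d \<bullet> (shm f \<bullet> h)" unfolding d(2)[symmetric] using d(1) f m(3) by (simp add: maps_iff)
    also have "\<dots> = zer Y (sh T')" unfolding fh using d(1) Y by (simp add: maps_iff)
    finally show "a = zer Y (sh T')" using b(2) c(2) by simp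
  qed
  have "ext_vanishes Y Y"
    unfolding ext_vanishes_def
  proof (intro allI impI)
    fix a assume a: "\<guillemotleft>a : Y \<rightarrow> sh Y\<guillemotright>"
    have "ext_vanishes T Y" using ext_vanishes_sym[OF CY YR[OF T] R_obj[OF T] Y] .
    then have "a \<bullet> g = zer T (sh Y)" using ext_vanishesD maps_comp[OF m(2) a] by blast
    then obtain b where b: "\<guillemotleft>b : sh X \<rightarrow> sh Y\<guillemotright>" "b \<bullet> h = a" using triangle_extend2[OF t a] by blast
    obtain c where c: "\<guillemotleft>c : X \<rightarrow> Y\<guillemotright>" "shm c = b" using shm_surj[OF b(1) X Y] .
    have "h \<bullet> c = zer X (sh X)" using ext_vanishesD[OF rig maps_comp[OF c(1) m(3)]] .
    then obtain d where d: "\<guillemotleft>d : X \<rightarrow> T\<guillemotright>" "g \<bullet> d = c" using triangle_lift2[OF t c(1)] by blast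
    obtain e where e: "\<guillemotleft>e : T \<rightarrow> T\<guillemotright>" "e \<bullet> f = d" using app[OF T d(1)] by blast
    have "shm c \<bullet> h = shm (g \<bullet> e) \<bullet> (shm f \<bullet> h)"
      unfolding d(2)[symmetric] e(2)[symmetric] using e(1) f m by (simp add: maps_iff)
    also have "\<dots> = zer Y (sh Y)" unfolding fh using e(1) m(2) Y by (simp add: maps_iff)
    finally show "a = zer Y (sh Y)" using b(2) c(2) by simp
  qed
  then have "Y \<in> R" using maximality[OF Y _ YR] by blast
  then show ?thesis using that T t by blast
qed

lemma shift_R_in_D: assumes T: "T \<in> R" shows "sh T \<in> D"
proof -
  have o: "T \<in> Obj C" "sh T \<in> Obj C" using T by auto
  obtain T0 T1 f g h where R: "T0 \<in> R" "T1 \<in> R" and t: "triangle C (sh T) T0 T1 f g h"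
    using rigid_coresolution[OF o(2) ext_vanishes_shifted[OF ext_R[OF T T] o(1,1)]] .
  obtain X k h' q where X: "triangle C X (sh T) T0 k f h'" "is_iso C T1 (sh X) q" using unrotate[OF t] .
  have "X \<in> Obj C" using maps_objD(1)[OF triangle_maps(1)[OF X(1)]] .
  then have "X \<in> U" using U_I R_iso[OF R(2) _ X(2)] by simp
  then show ?thesis unfolding star_def using X(1) R(1) by blast
qed

text \<open>Let \<open>w : V \<rightarrow> X\<close> be the fibre of a \<open>U\<close>-monomorphism \<open>m\<close>. A morphism \<open>f : X \<rightarrow> T[1]\<close> extends along \<open>m\<close>
  once \<open>f \<bullet> w = 0\<close>, and by duality this follows from \<open>w[1] \<bullet> g = 0\<close> for all \<open>g : T \<rightarrow> V[1]\<close>. As \<open>T[-1]\<close>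
  is in \<open>U\<close>, the unshift of \<open>w[1] \<bullet> g\<close> is a morphism from \<open>U\<close> that \<open>m\<close> kills.\<close>

lemma shift_R_injective:
  assumes T: "T \<in> R" shows "injective A (sh T)"
  unfolding injective_def A_Obj
proof (intro conjI ballI allI impI)
  show TD: "sh T \<in> D" using shift_R_in_D[OF T] .
  fix X Y M F assume D: "X \<in> D" "Y \<in> D" and M: "is_mono A X Y M" and F: "F \<in> arr A X (sh T)"
  have "M \<in> arr A X Y" using M unfolding is_mono_def by blast
  then obtain m where m: "\<guillemotleft>m : X \<rightarrow> Y\<guillemotright>" "M = cls m" using A_arrE D D_obj by metis
  obtain f where f: "\<guillemotleft>f : X \<rightarrow> sh T\<guillemotright>" "F = cls f" using A_arrE[OF F D_obj[OF D(1)] D_obj[OF TD]] .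
  have mono: "U_mono m" using M A_mono_iff[OF D m(1)] m(2) by blast
  obtain Z g h where "triangle C X Y Z m g h"
    using triangle_exists[OF D_obj[OF D(1)] D_obj[OF D(2)] maps_arr[OF m(1)]] by blast
  then obtain V w h' q where t: "triangle C V X Y w m h'" by (rule unrotate)
  note w = triangle_maps(1)[OF t]
  have V: "V \<in> Obj C" using maps_objD(1)[OF w] .
  have "f \<bullet> w = zer V (sh T)"
  proof (rule calabi_yau_comp_zero[OF CY f(1) w R_obj[OF T]])
    fix g assume g: "\<guillemotleft>g : T \<rightarrow> sh V\<guillemotright>"
    obtain P e d where P: "P \<in> U" "\<guillemotleft>e : sh P \<rightarrow> T\<guillemotright>" "\<guillemotleft>d : T \<rightarrow> sh P\<guillemotright>"
      "d \<bullet> e = Id C (sh P)" "e \<bullet> d = Id C T" using unshift_R[OF T] .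
    obtain v where v: "\<guillemotleft>v : P \<rightarrow> V\<guillemotright>" "shm v = g \<bullet> e"
      using shm_surj[OF maps_comp[OF P(2) g] U_obj[OF P(1)] V] .
    have "m \<bullet> (w \<bullet> v) = zer P Y"
      using comp_eq_assoc[OF triangle_comp_zero1[OF t] w m(1) v(1)] v(1) m(1) by (simp add: maps_iff)
    then have "w \<bullet> v = zer P X" using U_monoD[OF mono m(1) P(1) maps_comp[OF v(1) w]] by blast
    then have "shm (w \<bullet> v) = zer (sh P) (sh X)" using P(1) D(1) by simp
    then have "shm w \<bullet> (g \<bullet> e) = zer (sh P) (sh X)" unfolding v(2)[symmetric] using v(1) w by (simp add: maps_iff)
    then have "(shm w \<bullet> (g \<bullet> e)) \<bullet> d = zer T (sh X)" using P(3) D(1) by (simp add: maps_iff)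
    then show "shm w \<bullet> g = zer T (sh X)"
      using P(2,3,5) g w by (simp add: maps_iff)
  qed
  then obtain k where k: "\<guillemotleft>k : Y \<rightarrow> sh T\<guillemotright>" "k \<bullet> m = f" using triangle_extend[OF t f(1)] by blast
  then show "\<exists>G\<in>arr A Y (sh T). G \<cdot>\<^bsub>A\<^esub> M = F"
    using A_comp[OF D m(1) k(1)] A_arrI[OF k(1)] m(2) f(2) by auto
qed

text \<open>The shift of a left approximation of \<open>X[-1]\<close>; that it is a \<open>U\<close>-monomorphism is \<open>calabi_yau_zero\<close>,
  since every morphism from \<open>X[-1]\<close> to \<open>P[1]\<close>, an object of \<open>R\<close>, factors through the approximation.\<close>

lemma shift_R_cogenerates:
  assumes X: "X \<in> D"
  obtains T a where "T \<in> R" "\<guillemotleft>a : X \<rightarrow> sh T\<guillemotright>" "is_mono A X (sh T) (cls a)"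
proof -
  obtain Y e d where Y: "Y \<in> Obj C" "\<guillemotleft>e : sh Y \<rightarrow> X\<guillemotright>" "\<guillemotleft>d : X \<rightarrow> sh Y\<guillemotright>"
    "d \<bullet> e = Id C (sh Y)" "e \<bullet> d = Id C X" using unshift_object[OF D_obj[OF X]] .
  obtain T b where T: "T \<in> R" and b: "\<guillemotleft>b : Y \<rightarrow> T\<guillemotright>"
    and app: "\<And>T' g. T' \<in> R \<Longrightarrow> \<guillemotleft>g : Y \<rightarrow> T'\<guillemotright> \<Longrightarrow> \<exists>h. \<guillemotleft>h : T \<rightarrow> T'\<guillemotright> \<and> h \<bullet> b = g"
    using R_approximation[OF Y(1)] by blast
  have a: "\<guillemotleft>shm b \<bullet> d : X \<rightarrow> sh T\<guillemotright>" using maps_comp[OF Y(3) maps_shm[OF b]] .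
  have "U_mono (shm b \<bullet> d)"
  proof (rule U_monoI[OF a])
    fix P u assume P: "P \<in> U" and u: "\<guillemotleft>u : P \<rightarrow> X\<guillemotright>" "(shm b \<bullet> d) \<bullet> u = zer P (sh T)"
    have "shm b \<bullet> (d \<bullet> u) = zer P (sh T)" using u b Y(3) by (simp add: maps_iff)
    then have "d \<bullet> u = zer P (sh Y)"
      using calabi_yau_zero[OF CY maps_comp[OF u(1) Y(3)] b U_obj[OF P]] app[OF U_shift[OF P]] by blast
    then have "e \<bullet> (d \<bullet> u) = zer P X" using Y(2) u(1) by (simp add: maps_iff)
    then show "u = zer P X" using comp_eq_assoc[OF Y(5) Y(3) Y(2) u(1)] u(1) by (simp add: maps_iff)
  qed
  then show ?thesis using that[OF T a] A_mono_iff[OF X shift_R_in_D[OF T] a] by blast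
qed

lemma A_enough_injectives: "enough_injectives A"
  unfolding enough_injectives_def A_Obj using shift_R_cogenerates shift_R_injective by metis

text \<open>The kernel of \<open>P \<rightarrow> Q\<close> on \<open>Hom(U, -)\<close> comes from \<open>Hom(W[1], T[1])\<close> with \<open>W[1]\<close> in \<open>R\<close>, which vanishes.\<close>

lemma shift_R_proj_dim:
  assumes T: "T \<in> R" shows "proj_dim_le_one A (sh T)"
proof -
  have TD: "sh T \<in> D" using shift_R_in_D[OF T] .
  obtain P Q i p r where P: "P \<in> U" "Q \<in> U" and t: "triangle C P Q (sh T) i p r"
    using D_presentation[OF TD] .
  note m = triangle_maps[OF t]
  have "U_mono i"
  proof (rule U_monoI[OF m(1)])
    fix W u assume W: "W \<in> U" and u: "\<guillemotleft>u : W \<rightarrow> P\<guillemotright>" "i \<bullet> u = zer W Q"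
    have "shm (i \<bullet> u) = zer (sh W) (sh Q)" using u(2) W P by simp
    then have "shm i \<bullet> shm u = zer (sh W) (sh Q)" using m(1) u(1) by (simp add: maps_iff)
    then obtain w where w: "\<guillemotleft>w : sh W \<rightarrow> sh T\<guillemotright>" "r \<bullet> w = shm u"
      by (rule triangle_lift3[OF t maps_shm[OF u(1)]])
    have "w = zer (sh W) (sh T)" using ext_R_zero[OF U_shift[OF W] T w(1)] .
    then have "shm u = zer (sh W) (sh P)" using w(2) W m(3) by (auto simp: maps_iff)
    then show "u = zer W P" using shm_zero_iff[of u W P] u(1) by (simp add: maps_iff)
  qed
  moreover have "U_epi p" by (rule U_epiI[OF m(2)]) (rule presentation_epi[OF t P(1)])
  ultimately show ?thesis
    unfolding proj_dim_le_one_def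
    using A_short_exact[OF t U_subset_D[OF P(1)] U_subset_D[OF P(2)] TD] U_projective P by blast
qed

text \<open>Write \<open>P\<close> as \<open>X[1]\<close>. Then \<open>X\<close> is rigid, since \<open>X[2]\<close> is in \<open>R\<close>, and the shifted coresolution
  \<open>X[1] \<rightarrow> T0[1] \<rightarrow> T1[1]\<close> is exact on \<open>Hom(U, -)\<close> because \<open>Hom(U, T1)\<close> and \<open>Hom(U, X[2])\<close> vanish. As \<open>P\<close>
  is only isomorphic to \<open>X[1]\<close>, it is treated as a retract of it.\<close>

lemma U_inj_dim:
  assumes P: "P \<in> U" shows "inj_dim_le_one A P"
proof -
  obtain X e d where X: "X \<in> Obj C" "\<guillemotleft>e : sh X \<rightarrow> P\<guillemotright>" "\<guillemotleft>d : P \<rightarrow> sh X\<guillemotright>"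
    "d \<bullet> e = Id C (sh X)" "e \<bullet> d = Id C P" using unshift_object[OF U_obj[OF P]] .
  have "shm d \<bullet> shm e = Id C (sh (sh X))" "shm e \<bullet> shm d = Id C (sh P)"
    using arg_cong[OF X(4), of shm] arg_cong[OF X(5), of shm] X(1,2,3) P by (simp_all add: maps_iff)
  then have "is_iso C (sh P) (sh (sh X)) (shm d)"
    using X(1) P maps_shm[OF X(2)] maps_shm[OF X(3)] by (auto simp: is_iso_iff)
  then have XR: "sh (sh X) \<in> R" using R_iso[OF U_shift[OF P]] X(1) by simp
  have XU: "sh X \<in> U" using U_I X(1) XR by simp
  have "ext_vanishes X X"
    using ext_vanishes_shift[OF ext_vanishes_shift[OF ext_R[OF XR XR]]] X(1) by simp
  then obtain T0 T1 f g h where T: "T0 \<in> R" "T1 \<in> R" and t: "triangle C X T0 T1 f g h"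
    by (rule rigid_coresolution[OF X(1)])
  let ?f = "\<ominus>\<^bsub>Hom C (sh X) (sh T0)\<^esub> shm f" and ?g = "\<ominus>\<^bsub>Hom C (sh T0) (sh T1)\<^esub> shm g"
  let ?h = "\<ominus>\<^bsub>Hom C (sh T1) (sh (sh X))\<^esub> shm h"
  have t': "triangle C (sh X) (sh T0) (sh T1) ?f ?g ?h" using rotate[OF rotate[OF rotate[OF t]]] .
  note m = triangle_maps[OF t] note m' = triangle_maps[OF t']
  have "U_mono ?f"
  proof (rule U_monoI[OF m'(1)])
    fix W u assume W: "W \<in> U" and u: "\<guillemotleft>u : W \<rightarrow> sh X\<guillemotright>" "?f \<bullet> u = zer W (sh T0)"
    have "shm f \<bullet> u = zer W (sh T0)" using u m(1) by (simp add: maps_iff)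
    then obtain w where w: "\<guillemotleft>w : W \<rightarrow> T1\<guillemotright>" "h \<bullet> w = u" by (rule triangle_lift3[OF t u(1)])
    have "w = zer W T1" using hom_U_R_zero[OF W T(2) w(1)] .
    then show "u = zer W (sh X)" using w m(3) W by (auto simp: maps_iff)
  qed
  moreover have "U_epi ?g"
  proof (rule U_epiI[OF m'(2)])
    fix W u assume W: "W \<in> U" and u: "\<guillemotleft>u : W \<rightarrow> sh T1\<guillemotright>"
    have "?h \<bullet> u = zer W (sh (sh X))" using hom_U_R_zero[OF W XR maps_comp[OF u m'(3)]] .
    then obtain w where "\<guillemotleft>w : W \<rightarrow> sh T0\<guillemotright>" "?g \<bullet> w = u" by (rule triangle_lift2[OF t' u])
    then show "\<exists>v. \<guillemotleft>v : W \<rightarrow> sh T0\<guillemotright> \<and> ?g \<bullet> v = u" by blast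
  qed
  ultimately have dim: "inj_dim_le_one A (sh X)"
    unfolding inj_dim_le_one_def
    using A_short_exact[OF t' U_subset_D[OF XU] shift_R_in_D[OF T(1)] shift_R_in_D[OF T(2)]]
      shift_R_injective T by blast
  have D: "P \<in> D" "sh X \<in> D" using U_subset_D P XU by blast+
  show ?thesis
  proof (rule abelian_category.inj_dim_le_one_retract[OF A_abelian dim])
    show "linear_category.maps A (cls d) P (sh X)" "linear_category.maps A (cls e) (sh X) P"
      unfolding A_maps using D A_arrI[OF X(2)] A_arrI[OF X(3)] by auto
    show "cls e \<cdot>\<^bsub>A\<^esub> cls d = Id A P" unfolding A_comp[OF D X(3,2)] X(5) A_Id ..
  qed
qed

lemma A_injective_proj_dim:
  assumes I: "injective A I" shows "proj_dim_le_one A I"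
proof -
  have ID: "I \<in> D" using I unfolding injective_def by simp
  obtain T a where T: "T \<in> R" and a: "\<guillemotleft>a : I \<rightarrow> sh T\<guillemotright>" and mono: "is_mono A I (sh T) (cls a)"
    using shift_R_cogenerates[OF ID] .
  have TD: "sh T \<in> D" using shift_R_in_D[OF T] .
  have am: "linear_category.maps A (cls a) I (sh T)" unfolding A_maps using ID TD A_arrI[OF a] by blast
  have "linear_category.maps A (Id A I) I I"
    using linear_category.maps_Id[OF A_linear_category] ID by simp
  then obtain S where "linear_category.maps A S (sh T) I" "S \<cdot>\<^bsub>A\<^esub> cls a = Id A I"
    using linear_category.injectiveD(2)[OF A_linear_category I mono am] by blast
  then show ?thesis
    using abelian_category.proj_dim_le_one_retract[OF A_abelian shift_R_proj_dim[OF T] am] by blast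
qed

lemma A_projective_inj_dim:
  assumes P: "projective A P" shows "inj_dim_le_one A P"
proof -
  have PD: "P \<in> D" using P unfolding projective_def by simp
  obtain Q p where Q: "Q \<in> U" and p: "\<guillemotleft>p : Q \<rightarrow> P\<guillemotright>" and epi: "is_epi A Q P (cls p)"
    using U_covers[OF PD] .
  have pm: "linear_category.maps A (cls p) Q P"
    unfolding A_maps using PD U_subset_D[OF Q] A_arrI[OF p] by blast
  have "linear_category.maps A (Id A P) P P"
    using linear_category.maps_Id[OF A_linear_category] PD by simp
  then obtain S where "linear_category.maps A S P Q" "cls p \<cdot>\<^bsub>A\<^esub> S = Id A P"
    using linear_category.projectiveD(2)[OF A_linear_category P epi pm] by blast
  then show ?thesis
    using abelian_category.inj_dim_le_one_retract[OF A_abelian U_inj_dim[OF Q] _ pm] by blast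
qed

theorem A_gorenstein: "gorenstein_dim_le_one K A"
  unfolding gorenstein_dim_le_one_def
  using A_abelian A_enough_projectives A_enough_injectives A_injective_proj_dim A_projective_inj_dim
  by blast

end

theorem theorem4p4:
  fixes K :: "('k, 'b) ring_scheme"
    and C :: "('k, 'o, 'm, 'c) tri_cat_scheme"
    and R :: "'o set"
    and A :: "('k, 'o, 'm set) lin_cat"
  assumes "algebraically_closed K"
    and "triangulated_category K C"
    and "hom_finite K C"
    and "krull_remak_schmidt C"
    and "calabi_yau_2 K C"
    and "maximal_rigid C R"
    and "functorially_finite C R"
    and "A = quotient_category C (star C (unshift C R) R) R"
  shows "enough_projectives A \<and> enough_injectives A \<and> gorenstein_dim_le_one K A"
proof -
  interpret triangulated_category K C by (rule assms(2))
  interpret M: maximal_rigid_calabi_yau K C R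
    by unfold_locales
      (use assms(5-7) in \<open>auto simp: maximal_rigid_def functorially_finite_def\<close>)
  show ?thesis
    unfolding assms(8)
    using M.A_enough_projectives M.A_enough_injectives M.A_gorenstein by blast
qed

end
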